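(* For every choice of constants $0<b_2<b_1<1$, the $(b_1,b_2)$-approximate similarity search problem under Braun-Blanquet similarity on a collection $P$ of $n$ sets can be solved with query time $O(|q|n^{\rho}\log n)$ and space usage $O(n^{1+\rho}\log n+\sum_{x\in P}|x|)$, where $\rho=\log(1/b_1)/\log(1/b_2)$.
   Context: Vectors $x\in\{0,1\}^d$ are identified with subsets $\{i: x_i=1\}$ of $\{1,\dots,d\}$. Braun-Blanquet similarity: $B(x,y)=|x\cap y|/\max(|x|,|y|)$. The $(s_1,s_2)$-similarity search problem (with $s_1>s_2$) for $P\subseteq\{0,1\}^d$: build a data structure that, given a query $q\in\{0,1\}^d$ for which some $x\in P$ has $B(x,q)\ge s_1$, returns $x'\in P$ with $B(x',q)>s_2$; queries succeed with probability at least $1/2$. Model: word RAM with word size $\Theta(\log n)$, augmented with an instruction generating a uniformly random word in constant time. *)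

theory Defs
  imports "HOL-Probability.Probability_Mass_Function"
begin

definition braun_blanquet :: "nat set \<Rightarrow> nat set \<Rightarrow> real" where
  "braun_blanquet x y = real (card (x \<inter> y)) / real (max (card x) (card y))"

text \<open>
  The word RAM with word size \<open>w\<close>. A word is a natural number below \<open>2 ^ w\<close>; memory is addressed
  by words. Besides the memory there are registers (a program names only finitely many of them)
  and a read-only, randomly accessible input array.
\<close>

datatype binop = Plus | Minus | Times | Div | Mod | And | Or | Xor | Shl | Shr | Less | Equal

fun binop_val :: "nat \<Rightarrow> binop \<Rightarrow> nat \<Rightarrow> nat \<Rightarrow> nat" where
  "binop_val w Plus a b = (a + b) mod 2 ^ w"
| "binop_val w Minus a b = (a + 2 ^ w - b) mod 2 ^ w"
| "binop_val w Times a b = (a * b) mod 2 ^ w"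
| "binop_val w Div a b = a div b"
| "binop_val w Mod a b = a mod b"
| "binop_val w And a b = semiring_bit_operations_class.and a b"
| "binop_val w Or a b = semiring_bit_operations_class.or a b"
| "binop_val w Xor a b = semiring_bit_operations_class.xor a b"
| "binop_val w Shl a b = push_bit b a mod 2 ^ w"
| "binop_val w Shr a b = drop_bit b a"
| "binop_val w Less a b = of_bool (a < b)"
| "binop_val w Equal a b = of_bool (a = b)"

datatype exp = Const nat | Reg nat | Mem exp | Inp exp | Bin binop exp exp

datatype com =
    Assign nat exp
  | Store exp exp
  | Rand nat
  | Seq com com
  | If exp com com
  | While exp com

record store =
  regs :: "nat \<Rightarrow> nat"
  mem :: "nat \<Rightarrow> nat"

fun eval :: "nat \<Rightarrow> nat list \<Rightarrow> store \<Rightarrow> exp \<Rightarrow> nat" where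
  "eval w inp s (Const c) = c mod 2 ^ w"
| "eval w inp s (Reg r) = regs s r"
| "eval w inp s (Mem e) = mem s (eval w inp s e)"
| "eval w inp s (Inp e) = (let i = eval w inp s e in if i < length inp then inp ! i else 0)"
| "eval w inp s (Bin f e1 e2) = binop_val w f (eval w inp s e1) (eval w inp s e2)"

text \<open>
  A configuration is a stack of commands still to be executed together with a store; it has halted
  when the stack is empty. Expressions are part of the program and hence of constant size, so one
  step stands for a constant number of elementary RAM instructions.
\<close>

type_synonym config = "com list \<times> store"

fun step :: "nat \<Rightarrow> nat list \<Rightarrow> config \<Rightarrow> config pmf" where
  "step w inp ([], s) = return_pmf ([], s)"
| "step w inp (Assign r e # k, s) =
     return_pmf (k, s\<lparr>regs := (regs s)(r := eval w inp s e)\<rparr>)"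
| "step w inp (Store e1 e2 # k, s) =
     return_pmf (k, s\<lparr>mem := (mem s)(eval w inp s e1 := eval w inp s e2)\<rparr>)"
| "step w inp (Rand r # k, s) =
     map_pmf (\<lambda>u. (k, s\<lparr>regs := (regs s)(r := u)\<rparr>)) (pmf_of_set {0..<2 ^ w})"
| "step w inp (Seq c1 c2 # k, s) = return_pmf (c1 # c2 # k, s)"
| "step w inp (If e c1 c2 # k, s) =
     return_pmf ((if eval w inp s e \<noteq> 0 then c1 else c2) # k, s)"
| "step w inp (While e c # k, s) =
     return_pmf (if eval w inp s e \<noteq> 0 then c # While e c # k else k, s)"

primrec run :: "nat \<Rightarrow> nat list \<Rightarrow> nat \<Rightarrow> config \<Rightarrow> config pmf" where
  "run w inp 0 cfg = return_pmf cfg"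
| "run w inp (Suc t) cfg = bind_pmf (step w inp cfg) (run w inp t)"

definition init :: "(nat \<Rightarrow> nat) \<Rightarrow> store" where
  "init m = \<lparr>regs = (\<lambda>_. 0), mem = m\<rparr>"

definition halts_within :: "nat \<Rightarrow> nat list \<Rightarrow> com \<Rightarrow> (nat \<Rightarrow> nat) \<Rightarrow> nat \<Rightarrow> bool" where
  "halts_within w inp c m t \<longleftrightarrow> (\<forall>cfg \<in> set_pmf (run w inp t ([c], init m)). fst cfg = [])"

text \<open>
  The distribution of the store after \<open>t\<close> steps. Halted configurations are fixed points of
  \<^const>\<open>step\<close>, so under \<^const>\<open>halts_within\<close> this is the distribution of the final store.
\<close>

definition result :: "nat \<Rightarrow> nat list \<Rightarrow> com \<Rightarrow> (nat \<Rightarrow> nat) \<Rightarrow> nat \<Rightarrow> store pmf" where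
  "result w inp c m t = map_pmf snd (run w inp t ([c], init m))"

definition encode_set :: "nat set \<Rightarrow> nat list" where
  "encode_set x = card x # sorted_list_of_set x"

definition fixed_point :: "nat \<Rightarrow> real \<Rightarrow> nat" where
  "fixed_point w r = nat \<lfloor>r * 2 ^ w\<rfloor>"

text \<open>
  The collection is presented as a list in arbitrary order. The real parameters \<open>s1\<close>, \<open>s2\<close> are
  supplied rounded to word precision, since a finite program cannot contain an arbitrary real.
\<close>

definition encode_instance :: "nat \<Rightarrow> nat \<Rightarrow> real \<Rightarrow> real \<Rightarrow> nat set list \<Rightarrow> nat list" where
  "encode_instance w d s1 s2 ps =
     [length ps, d, fixed_point w s1, fixed_point w s2] @ concat (map encode_set ps)"

text \<open>A query returns a set by leaving in register 0 the address of its encoding in memory.\<close>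

definition returns :: "store \<Rightarrow> nat set \<Rightarrow> bool" where
  "returns s x \<longleftrightarrow>
     (\<forall>i < length (encode_set x). mem s (regs s 0 + i) = encode_set x ! i)"

text \<open>
  The programs \<open>build\<close> and \<open>query\<close> solve the \<open>(s1, s2)\<close>-similarity search problem for the
  collection \<open>ps\<close> of subsets of \<open>{1..d}\<close>: \<open>build\<close> halts on every sequence of random words and
  leaves a data structure in the memory cells below \<open>cells\<close>; with this memory, \<open>query\<close> halts on
  every \<open>q\<close> within \<open>qtime (card q)\<close> steps, again for all random words. The success probability,
  for each fixed \<open>q\<close>, is over the random words of both programs.
\<close>

definition solves_similarity_search ::
  "nat \<Rightarrow> nat \<Rightarrow> real \<Rightarrow> real \<Rightarrow> nat set list \<Rightarrow> com \<Rightarrow> com \<Rightarrow> nat \<Rightarrow> (nat \<Rightarrow> nat) \<Rightarrow> bool" where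
  "solves_similarity_search w d s1 s2 ps build query cells qtime \<longleftrightarrow>
     (\<exists>T D. halts_within w (encode_instance w d s1 s2 ps) build (\<lambda>_. 0) T \<and>
        D = map_pmf mem (result w (encode_instance w d s1 s2 ps) build (\<lambda>_. 0) T) \<and>
        (\<forall>m \<in> set_pmf D. \<forall>a \<ge> cells. m a = 0) \<and>
        (\<forall>q \<subseteq> {1..d}.
           (\<forall>m \<in> set_pmf D. halts_within w (encode_set q) query m (qtime (card q))) \<and>
           ((\<exists>x \<in> set ps. braun_blanquet x q \<ge> s1) \<longrightarrow>
              measure_pmf.prob
                (bind_pmf D (\<lambda>m. result w (encode_set q) query m (qtime (card q))))
                {s. \<exists>x \<in> set ps. braun_blanquet x q > s2 \<and> returns s x} \<ge> 1 / 2)))"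

end

theory Submission
  imports Defs
begin

text \<open>
  The data structure is the Chosen Path filter. Every set \<open>x\<close> grows a random tree of paths: a path with
  identifier \<open>v\<close> is extended by those \<open>i \<in> x\<close> whose hash value \<open>h (v, i)\<close> falls below a threshold of
  relative size \<open>1 / (b1 * |x|)\<close>, so the expected branching factor is \<open>1 / b1\<close>; the hash value is the
  identifier of the new path. At depth \<open>k\<close>, about \<open>ln n / ln (1 / b2)\<close>, there are
  \<open>(1 / b1) ^ k = O(n powr \<rho>)\<close> paths per set. The paths shared by two sets of similarity at least \<open>b1\<close>
  form a process with branching factor at least 1, which by the second moment method survives to depth \<open>k\<close>
  with probability at least \<open>1 / (2 * k + 2)\<close>; hence \<open>O(log n)\<close> independent repetitions suffice. For two
  sets of similarity at most \<open>b2\<close> the factor is \<open>b2 / b1\<close>, so \<open>n\<close> such sets together share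
  \<open>n * (b2 / b1) ^ k\<close>, about \<open>(1 / b1) ^ k\<close>, paths with the query. The paths of all sets are kept in a chained
  hash table. Queues and candidate lists are truncated at a constant times their expected length, which turns
  the expected bounds on time and space into worst-case ones and costs, by Markov's inequality, a constant
  failure probability.
\<close>

subsection \<open>Averages over random words\<close>

text \<open>Path identifiers are \<open>z\<close>-bit values of a hash family that is only pairwise
  independent, so distinct paths may receive equal identifiers and the trees are not genuine
  branching processes. Pairwise independence supports first and second moments, and these suffice:
  average lengths are exact, and the pairs of equal identifiers obey linear recursions whose error
  terms carry a factor 1 / Z with Z = 2 ^ z. As the universe size is polynomial in n, a word of c0 *
  log n bits makes Z exceed the power of n that is required; this drowns the accidental collisions
  as well as the rounding of b1 and b2, and keeps all address arithmetic free of overflow. One seed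
  per level serves all sets. Hence the tree grown from the intersection of x and q, with the smaller
  of their two thresholds, is contained in both trees, and any leaf of it is shared by x and q. All
  random words are drawn before any of them is used, so the rest of the computation is a
  deterministic function of them, and every probability becomes a finite average over lists of
  words.\<close>

primrec avg :: "nat \<Rightarrow> nat \<Rightarrow> (nat list \<Rightarrow> real) \<Rightarrow> real" where
  "avg W 0 f = f []"
| "avg W (Suc n) f = (\<Sum>u<W. avg W n (\<lambda>ws. f (u # ws))) / real W"

lemma avg_const [simp]: "W > 0 \<Longrightarrow> avg W n (\<lambda>_. c) = c"
  by (induction n) auto

lemma avg_add: "avg W n (\<lambda>ws. f ws + g ws) = avg W n f + avg W n g"
  by (induction n arbitrary: f g) (auto simp: sum.distrib add_divide_distrib)

lemma avg_cmult: "avg W n (\<lambda>ws. c * f ws) = c * avg W n f"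
  by (induction n arbitrary: f) (auto simp: sum_distrib_left)

lemma avg_diff: "avg W n (\<lambda>ws. f ws - g ws) = avg W n f - avg W n g"
  using avg_add[of W n f "\<lambda>ws. (-1) * g ws"] avg_cmult[of W n "-1" g] by simp

lemma avg_sum: "W > 0 \<Longrightarrow> finite A \<Longrightarrow> avg W n (\<lambda>ws. \<Sum>i\<in>A. f i ws) = (\<Sum>i\<in>A. avg W n (f i))"
  by (rotate_tac, induction A rule: finite_induct) (auto simp: avg_add)

lemma avg_sum_list: "W > 0 \<Longrightarrow> avg W n (\<lambda>ws. \<Sum>x\<leftarrow>xs. f x ws) = (\<Sum>x\<leftarrow>xs. avg W n (f x))"
  by (induction xs) (auto simp: avg_add)

lemma avg_mono:
  assumes "\<And>ws. length ws = n \<Longrightarrow> set ws \<subseteq> {..<W} \<Longrightarrow> f ws \<le> g ws"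
  shows "avg W n f \<le> avg W n g"
  using assms
proof (induction n arbitrary: f g)
  case (Suc n)
  have "avg W n (\<lambda>ws. f (u # ws)) \<le> avg W n (\<lambda>ws. g (u # ws))" if "u < W" for u
    using that by (intro Suc.IH Suc.prems) auto
  then show ?case by (auto intro!: divide_right_mono sum_mono)
qed auto

lemma avg_cong:
  assumes "\<And>ws. length ws = n \<Longrightarrow> set ws \<subseteq> {..<W} \<Longrightarrow> f ws = g ws"
  shows "avg W n f = avg W n g"
  using assms by (intro antisym avg_mono) auto

text \<open>The form in which independence of disjoint blocks of words is used.\<close>

lemma avg_append: "avg W (m + n) f = avg W m (\<lambda>xs. avg W n (\<lambda>ys. f (xs @ ys)))"
  by (induction m arbitrary: f) auto

lemma avg_block:
  assumes "W > 0"
  shows "avg W (p + m + q) (\<lambda>ws. f (take m (drop p ws))) = avg W m f"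
proof -
  have "avg W (p + m + q) (\<lambda>ws. f (take m (drop p ws))) =
    avg W p (\<lambda>xs. avg W m (\<lambda>ys. avg W q (\<lambda>zs. f (take m (drop p ((xs @ ys) @ zs))))))"
    by (simp only: avg_append)
  also have "\<dots> = avg W p (\<lambda>xs. avg W m (\<lambda>ys. avg W q (\<lambda>zs. f ys)))"
    by (intro avg_cong) simp
  finally show ?thesis using assms by simp
qed

text \<open>Independence of the repetitions, each of which reads its own block of \<open>B\<close>
  words: the probability that all of them fail becomes a power.\<close>

lemma avg_prod_blocks:
  "avg W (L * B) (\<lambda>ws. \<Prod>r<L. f (take B (drop (r * B) ws))) = avg W B f ^ L"
proof (induction L)
  case (Suc L)
  have "avg W (Suc L * B) (\<lambda>ws. \<Prod>r<Suc L. f (take B (drop (r * B) ws))) =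
    avg W B (\<lambda>xs. avg W (L * B) (\<lambda>ys. \<Prod>r<Suc L. f (take B (drop (r * B) (xs @ ys)))))"
    by (simp only: avg_append mult_Suc)
  also have "\<dots> = avg W B (\<lambda>xs. avg W (L * B) (\<lambda>ys. f xs * (\<Prod>r<L. f (take B (drop (r * B) ys)))))"
    by (intro avg_cong) (simp add: prod.lessThan_Suc_shift del: prod.lessThan_Suc)
  also have "\<dots> = avg W B (\<lambda>xs. avg W B f ^ L * f xs)"
    by (simp only: avg_cmult Suc.IH mult.commute[of _ "avg W B f ^ L"])
  also have "\<dots> = avg W B f ^ Suc L" by (simp only: avg_cmult power_Suc2)
  finally show ?case .
qed simp

text \<open>Averages the inequality \<open>2 * \<theta> * N - \<theta>\<^sup>2 * N\<^sup>2 \<le> 1\<close>, which holds for \<open>N \<noteq> 0\<close>, with the optimal \<open>\<theta>\<close>.\<close>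

lemma avg_second_moment:
  assumes "W > 0" and N: "\<And>ws. N ws \<ge> 0" and m: "avg W n N \<ge> m" "m > 0"
    and s: "avg W n (\<lambda>ws. N ws * N ws) \<le> b * m\<^sup>2" and "b > 0"
  shows "avg W n (\<lambda>ws. of_bool (N ws \<noteq> 0)) \<ge> 1 / b"
proof -
  define \<theta> where "\<theta> = 1 / (b * m)"
  have th: "\<theta> > 0" using assms by (simp add: \<theta>_def)
  have "(2 * \<theta>) * N ws - \<theta>\<^sup>2 * (N ws * N ws) \<le> of_bool (N ws \<noteq> 0)" for ws
    using zero_le_power2[of "1 - \<theta> * N ws"] by (auto simp: power2_eq_square algebra_simps)
  then have "avg W n (\<lambda>ws. (2 * \<theta>) * N ws - \<theta>\<^sup>2 * (N ws * N ws)) \<le> avg W n (\<lambda>ws. of_bool (N ws \<noteq> 0))"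
    by (intro avg_mono)
  then have "2 * \<theta> * avg W n N - \<theta>\<^sup>2 * avg W n (\<lambda>ws. N ws * N ws) \<le> avg W n (\<lambda>ws. of_bool (N ws \<noteq> 0))"
    by (simp only: avg_diff avg_cmult)
  moreover have "2 * \<theta> * avg W n N \<ge> 2 * \<theta> * m" using th m by simp
  moreover have "\<theta>\<^sup>2 * avg W n (\<lambda>ws. N ws * N ws) \<le> \<theta>\<^sup>2 * (b * m\<^sup>2)" using s by (intro mult_left_mono) auto
  moreover have "2 * \<theta> * m - \<theta>\<^sup>2 * (b * m\<^sup>2) = 1 / b"
    using assms by (simp add: \<theta>_def field_simps power2_eq_square)
  ultimately show ?thesis by linarith
qed

text \<open>Bridge from the program semantics, which yields a pmf on lists of words, to finite
  averages.\<close>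

lemma expectation_replicate_pmf_of_set:
  assumes "W > 0"
  shows "measure_pmf.expectation (replicate_pmf n (pmf_of_set {0..<W})) f = avg W n f"
proof (induction n arbitrary: f)
  case (Suc n)
  have fin: "finite (set_pmf (replicate_pmf n (pmf_of_set {0..<W})))" for n
    using assms by (auto simp: set_replicate_pmf finite_lists_length_eq
        intro: finite_subset[OF _ finite_lists_length_eq[of "{0..<W}" n]])
  have "measure_pmf.expectation (replicate_pmf (Suc n) (pmf_of_set {0..<W})) f =
    (\<Sum>u\<in>{0..<W}. measure_pmf.expectation (map_pmf ((#) u) (replicate_pmf n (pmf_of_set {0..<W}))) f
       /\<^sub>R real (card {0..<W}))"
    unfolding replicate_pmf.simps map_pmf_def[symmetric]
    using assms fin by (intro pmf_expectation_bind_pmf_of_set) auto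
  then show ?case
    by (simp add: Suc.IH integral_map_pmf lessThan_atLeast0 sum_distrib_left divide_inverse mult.commute)
qed simp

lemma prob_replicate_pmf_of_set:
  assumes "W > 0"
  shows "measure_pmf.prob (replicate_pmf n (pmf_of_set {0..<W})) A = avg W n (\<lambda>ws. of_bool (ws \<in> A))"
proof -
  have "measure_pmf.prob (replicate_pmf n (pmf_of_set {0..<W})) A = avg W n (indicator A)"
    using expectation_replicate_pmf_of_set[OF assms, of n "indicator A"] by simp
  then show ?thesis by (simp only: indicator_def[abs_def])
qed

subsection \<open>Multiply-shift hashing\<close>

lemma sum_lessThan_mult: "(\<Sum>a<n * k. f a) = (\<Sum>m<n. \<Sum>i<k. f (m * k + i :: nat) :: real)"
proof -
  have "(\<Sum>i<k. f (m * k + i)) = sum f {m * k..<m * k + k}" for m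
    using sum.shift_bounds_nat_ivl[of f 0 "m * k" k] by (simp add: lessThan_atLeast0 add.commute)
  then show ?thesis by (simp add: sum.nat_group)
qed

lemma sum_mod_reindex:
  assumes "inj_on (\<lambda>a. g a mod W) {..<W}" "W > (0::nat)"
  shows "(\<Sum>a<W. f (g a mod W)) = (\<Sum>a<W. f a :: real)"
proof -
  have "(\<lambda>a. g a mod W) ` {..<W} = {..<W}"
    using assms by (intro endo_inj_surj) auto
  then show ?thesis using sum.reindex[OF assms(1), of f] by (simp add: o_def)
qed

lemma sum_mod_shift:
  assumes "W > (0::nat)"
  shows "(\<Sum>a<W. f ((a + c) mod W)) = (\<Sum>a<W. f a :: real)"
proof (rule sum_mod_reindex)
  have "a = b" if "(a + c) mod W = (b + c) mod W" "a < W" "b < W" "a \<le> b" for a b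
  proof -
    have "W dvd b - a" using that mod_eq_dvd_iff_nat[of "a + c" "b + c" W] by auto
    then show ?thesis using that by (auto dest: dvd_imp_le)
  qed
  then show "inj_on (\<lambda>a. (a + c) mod W) {..<W}"
    by (intro inj_onI) (metis lessThan_iff nat_le_linear)
qed fact

text \<open>An odd number is a unit modulo 2 ^ w, so multiplication by it permutes the
  residues.\<close>

lemma sum_mod_odd:
  assumes "odd (e :: nat)"
  shows "(\<Sum>a<2 ^ w. f ((a * e) mod 2 ^ w)) = (\<Sum>a<2 ^ w. f a :: real)"
proof (rule sum_mod_reindex)
  have "a = b" if "(a * e) mod 2 ^ w = (b * e) mod 2 ^ w" "a < 2 ^ w" "b < 2 ^ w" "a \<le> b" for a b :: nat
  proof -
    have "2 ^ w dvd b * e - a * e" using that mod_eq_dvd_iff_nat[of "a * e" "b * e" "2 ^ w"] by auto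
    then have "2 ^ w dvd (b - a) * e" by (simp add: diff_mult_distrib)
    moreover have "coprime (2 ^ w) e" using assms by simp
    ultimately have "2 ^ w dvd b - a" by (simp add: coprime_dvd_mult_left_iff)
    then show ?thesis using that by (auto dest: dvd_imp_le)
  qed
  then show "inj_on (\<lambda>a. (a * e) mod 2 ^ w) {..<2 ^ w}"
    by (intro inj_onI) (metis lessThan_iff nat_le_linear)
qed simp

lemma pow2_odd_decompose: "0 < (m::nat) \<Longrightarrow> \<exists>y e. m = 2 ^ y * e \<and> odd e"
proof (induction m rule: less_induct)
  case (less m)
  show ?case
  proof (cases "odd m")
    case True
    then show ?thesis by (intro exI[of _ 0] exI[of _ m]) simp
  next
    case False
    then obtain h where h: "m = 2 * h" by auto
    have "h < m" "0 < h" using h less.prems by auto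
    then obtain y e where "h = 2 ^ y * e" "odd e" using less.IH by blast
    with h show ?thesis by (intro exI[of _ "Suc y"] exI[of _ e]) simp
  qed
qed

text \<open>The top \<open>z\<close> of the \<open>w\<close> bits of an affine map modulo 2 ^ w. On
  keys up to 2 ^ (w - z) it is exactly pairwise independent, and a word RAM evaluates it without a
  prime modulus.\<close>

definition hash :: "nat \<Rightarrow> nat \<Rightarrow> nat \<Rightarrow> nat \<Rightarrow> nat \<Rightarrow> nat" where
  "hash w z a c key = ((a * key + c) mod 2 ^ w) div 2 ^ (w - z)"

lemma sum_div_pow:
  fixes f :: "nat \<Rightarrow> real"
  assumes "z \<le> w"
  shows "(\<Sum>c<2 ^ w. f (c div 2 ^ (w - z))) = 2 ^ (w - z) * (\<Sum>\<alpha><2 ^ z. f \<alpha>)"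
proof -
  have "(2::nat) ^ w = 2 ^ z * 2 ^ (w - z)" using assms by (simp flip: power_add)
  then show ?thesis by (simp add: sum_lessThan_mult sum_distrib_left)
qed

text \<open>Writing \<open>\<delta> = 2 ^ y * e\<close> with \<open>e\<close> odd, the products \<open>a * \<delta>\<close> run evenly through the multiples of
  \<open>2 ^ y\<close>, and \<open>2 ^ y\<close> divides the length \<open>2 ^ (w - z)\<close> of the intervals on which the hash is constant.\<close>

lemma sum_hash_multiples:
  fixes f :: "nat \<Rightarrow> real"
  assumes "0 < \<delta>" "\<delta> * 2 ^ z \<le> 2 ^ w"
  shows "(\<Sum>a<2 ^ w. f (((c + a * \<delta>) mod 2 ^ w) div 2 ^ (w - z))) =
    2 ^ (w - z) * (\<Sum>\<alpha><2 ^ z. f \<alpha>)"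
proof -
  obtain y e where ye: "\<delta> = 2 ^ y * e" "odd e"
    using pow2_odd_decompose[OF assms(1)] by blast
  have "2 ^ y \<le> \<delta>" using ye assms(1) by (cases e) auto
  then have "(2::nat) ^ (y + z) \<le> 2 ^ w" 
    unfolding power_add by (rule le_trans[OF mult_le_mono1 assms(2)])
  \<comment> \<open>The size bound on \<open>\<delta>\<close> enters here: the power of two that
    divides it is at most the length of a hash interval.\<close>
  then have yz: "y + z \<le> w" by (simp add: power_increasing_iff)
  have zw: "z \<le> w" using yz by simp
  define u where "u = w - y"
  have w: "w = u + y" using yz by (simp add: u_def)
  have zu: "z \<le> u" using yz by (simp add: u_def)
  have wz: "2 ^ (w - z) = (2::nat) ^ y * 2 ^ (u - z)"
    using w zu power_add[of "2::nat" y "u - z"] by (simp add: add.commute)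
  have w2: "2 ^ w = (2::nat) ^ y * 2 ^ u" by (simp only: w power_add mult.commute)
  define c0 c1 where "c0 = c mod 2 ^ y" and "c1 = c div 2 ^ y"
  have c: "c = c1 * 2 ^ y + c0" unfolding c0_def c1_def by (rule div_mult_mod_eq[symmetric])
  have c0: "c0 < 2 ^ y" by (simp add: c0_def)
  \<comment> \<open>Adding multiples of 2 ^ y never touches the low \<open>y\<close> bits
    \<open>c0\<close>, and the division discards them; what remains is a hash on
    \<open>u = w - y\<close> bits.\<close>
  have key: "((c + a * 2 ^ y) mod 2 ^ w) div 2 ^ (w - z) = ((c1 + a) mod 2 ^ u) div 2 ^ (u - z)" for a
  proof -
    have 1: "((c1 + a) * 2 ^ y + c0) mod (2 ^ y * 2 ^ u) = 2 ^ y * ((c1 + a) mod 2 ^ u) + c0"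
      unfolding mod_mult2_eq using c0 by simp
    have 2: "(2 ^ y * m + c0) div (2 ^ y * 2 ^ (u - z)) = m div 2 ^ (u - z)" for m
      unfolding div_mult2_eq using c0 by simp
    have 4: "c + a * 2 ^ y = (c1 + a) * 2 ^ y + c0" by (subst c) (simp only: distrib_right add_ac)
    show ?thesis unfolding 4 w2 wz 1 2 ..
  qed
  have "(\<Sum>a<2 ^ w. f (((c + a * \<delta>) mod 2 ^ w) div 2 ^ (w - z))) =
    (\<Sum>a<2 ^ w. f (((c + ((a * e) mod 2 ^ w) * 2 ^ y) mod 2 ^ w) div 2 ^ (w - z)))"
  proof (intro sum.cong refl)
    fix a
    have "(c + ((a * e) mod 2 ^ w) * 2 ^ y) mod 2 ^ w = (c + a * \<delta>) mod 2 ^ w"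
    proof -
      have "(((a * e) mod 2 ^ w) * 2 ^ y) mod 2 ^ w = (a * \<delta>) mod 2 ^ w"
        unfolding mod_mult_left_eq by (simp add: ye(1) mult_ac)
      then show ?thesis by (rule mod_add_cong[OF refl])
    qed
    then show "f (((c + a * \<delta>) mod 2 ^ w) div 2 ^ (w - z)) =
      f (((c + ((a * e) mod 2 ^ w) * 2 ^ y) mod 2 ^ w) div 2 ^ (w - z))" by simp
  qed
  also have "\<dots> = (\<Sum>a<2 ^ w. f (((c + a * 2 ^ y) mod 2 ^ w) div 2 ^ (w - z)))"
    by (rule sum_mod_odd[OF ye(2), of "\<lambda>x. f (((c + x * 2 ^ y) mod 2 ^ w) div 2 ^ (w - z))"])
  also have "\<dots> = (\<Sum>a<2 ^ y * 2 ^ u. f (((c1 + a) mod 2 ^ u) div 2 ^ (u - z)))"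
    unfolding key unfolding w2 ..
  also have "\<dots> = 2 ^ y * (\<Sum>a<2 ^ u. f (((a + c1) mod 2 ^ u) div 2 ^ (u - z)))"
  proof -
    have "(c1 + (m * 2 ^ u + i)) mod 2 ^ u = (i + c1) mod 2 ^ u" for m i
      using mod_mult_self1[of "i + c1" m "2 ^ u"] by (simp only: add_ac)
    then show ?thesis by (simp add: sum_lessThan_mult)
  qed
  also have "\<dots> = 2 ^ y * (\<Sum>a<2 ^ u. f (a div 2 ^ (u - z)))"
    by (subst sum_mod_shift[of "2 ^ u" "\<lambda>x. f (x div 2 ^ (u - z))"]) auto
  also have "\<dots> = 2 ^ y * (2 ^ (u - z) * (\<Sum>\<alpha><2 ^ z. f \<alpha>))"
    using zu by (simp add: sum_div_pow)
  also have "\<dots> = 2 ^ (w - z) * (\<Sum>\<alpha><2 ^ z. f \<alpha>)"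
    using arg_cong[OF wz, of real] by simp
  finally show ?thesis .
qed

lemma hash_less: "z \<le> w \<Longrightarrow> hash w z a c x < 2 ^ z"
  by (simp add: hash_def less_mult_imp_div_less flip: power_add)

text \<open>For fixed \<open>a\<close>, replacing \<open>c\<close> by \<open>c + a * y\<close>
  modulo 2 ^ w permutes the seeds. Afterwards the hash of \<open>y\<close> depends on
  \<open>c\<close> alone, while that of \<open>x\<close> belongs to \<open>c + a * (x - y)\<close>
  and is uniform over \<open>a\<close> for every \<open>c\<close>.\<close>

lemma sum_hash_pair_aux:
  assumes "y < x" "x * 2 ^ z \<le> 2 ^ w" "z \<le> w"
  shows "(\<Sum>a<2 ^ w. \<Sum>c<2 ^ w. f (hash w z a c x) (hash w z a c y)) =
    (2 ^ (w - z))\<^sup>2 * (\<Sum>\<alpha><2 ^ z. \<Sum>\<beta><2 ^ z. f \<alpha> \<beta> :: real)"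
proof -
  define \<delta> where "\<delta> = x - y"
  have x: "x = y + \<delta>" using assms by (simp add: \<delta>_def)
  have d: "0 < \<delta>" "\<delta> * 2 ^ z \<le> 2 ^ w" using assms by (auto simp: \<delta>_def intro: le_trans[rotated])
  have *: "(a * x + c) mod 2 ^ w = ((c + a * y) mod 2 ^ w + a * \<delta>) mod 2 ^ w" for a c
    unfolding x by (simp add: mod_simps algebra_simps)
  have "(\<Sum>a<2 ^ w. \<Sum>c<2 ^ w. f (hash w z a c x) (hash w z a c y)) =
    (\<Sum>a<2 ^ w. \<Sum>c<2 ^ w. f ((((c + a * y) mod 2 ^ w + a * \<delta>) mod 2 ^ w) div 2 ^ (w - z))
      (((c + a * y) mod 2 ^ w) div 2 ^ (w - z)))"
    unfolding hash_def * by (simp add: add.commute)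
  also have "\<dots> = (\<Sum>a<2 ^ w. \<Sum>c<2 ^ w. f (((c + a * \<delta>) mod 2 ^ w) div 2 ^ (w - z)) (c div 2 ^ (w - z)))"
  proof (rule sum.cong[OF refl])
    fix a
    show "(\<Sum>c<2 ^ w. f ((((c + a * y) mod 2 ^ w + a * \<delta>) mod 2 ^ w) div 2 ^ (w - z))
        (((c + a * y) mod 2 ^ w) div 2 ^ (w - z))) =
      (\<Sum>c<2 ^ w. f (((c + a * \<delta>) mod 2 ^ w) div 2 ^ (w - z)) (c div 2 ^ (w - z)))"
      by (rule sum_mod_shift[of "2 ^ w" "\<lambda>u. f (((u + a * \<delta>) mod 2 ^ w) div 2 ^ (w - z)) (u div 2 ^ (w - z))"])
        simp
  qed
  also have "\<dots> = (\<Sum>c<2 ^ w. \<Sum>a<2 ^ w. f (((c + a * \<delta>) mod 2 ^ w) div 2 ^ (w - z)) (c div 2 ^ (w - z)))"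
    by (rule sum.swap)
  also have "\<dots> = (\<Sum>c<2 ^ w. 2 ^ (w - z) * (\<Sum>\<alpha><2 ^ z. f \<alpha> (c div 2 ^ (w - z))))"
    using d by (intro sum.cong refl sum_hash_multiples)
  also have "\<dots> = 2 ^ (w - z) * (2 ^ (w - z) * (\<Sum>\<beta><2 ^ z. \<Sum>\<alpha><2 ^ z. f \<alpha> \<beta>))"
    using assms(3) by (simp add: sum_distrib_left[symmetric] sum_div_pow[of z w "\<lambda>b. \<Sum>\<alpha><2 ^ z. f \<alpha> b"])
  finally show ?thesis by (subst sum.swap) (simp add: power2_eq_square)
qed

lemma avg_2: "avg W 2 f = (\<Sum>a<W. \<Sum>c<W. f [a, c]) / (real W)\<^sup>2"
  by (simp add: numeral_2_eq_2 sum_divide_distrib power2_eq_square)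

lemma avg_hash_pair:
  assumes "x \<noteq> y" "x * 2 ^ z \<le> 2 ^ w" "y * 2 ^ z \<le> 2 ^ w" "z \<le> w"
  shows "avg (2 ^ w) 2 (\<lambda>ws. f (hash w z (ws ! 0) (ws ! 1) x) (hash w z (ws ! 0) (ws ! 1) y)) =
    (\<Sum>\<alpha><2 ^ z. \<Sum>\<beta><2 ^ z. f \<alpha> \<beta>) / (2 ^ z)\<^sup>2"
proof -
  have p: "((2::real) ^ w)\<^sup>2 = (2 ^ (w - z))\<^sup>2 * (2 ^ z)\<^sup>2"
    using assms(4) by (simp flip: power_mult_distrib power_add)
  have "(\<Sum>a<2 ^ w. \<Sum>c<2 ^ w. f (hash w z a c x) (hash w z a c y)) =
    (2 ^ (w - z))\<^sup>2 * (\<Sum>\<alpha><2 ^ z. \<Sum>\<beta><2 ^ z. f \<alpha> \<beta>)"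
  proof (cases "y < x")
    case False
    then have "x < y" using assms(1) by simp
    from sum_hash_pair_aux[OF this assms(3,4), of "\<lambda>a b. f b a"] show ?thesis
      using sum.swap[of f "{..<2 ^ z}" "{..<2 ^ z}"] by simp
  qed (use sum_hash_pair_aux assms in auto)
  then show ?thesis by (simp add: avg_2 p)
qed

text \<open>The additive seed \<open>c\<close> alone makes the value of one key uniform, whatever
  the size of the key; this is why \<open>avg_length_grow\<close> can speak of arbitrary
  lists.\<close>

lemma avg_hash:
  fixes f :: "nat \<Rightarrow> real"
  assumes "z \<le> w"
  shows "avg (2 ^ w) 2 (\<lambda>ws. f (hash w z (ws ! 0) (ws ! 1) x)) = (\<Sum>\<alpha><2 ^ z. f \<alpha>) / 2 ^ z"
proof -
  have "(\<Sum>c<2 ^ w. f (hash w z a c x)) = 2 ^ (w - z) * (\<Sum>\<alpha><2 ^ z. f \<alpha>)" for a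
    using sum_mod_shift[of "2 ^ w" "\<lambda>u. f (u div 2 ^ (w - z))" "a * x"] sum_div_pow[OF assms, of f]
    by (simp add: hash_def add.commute)
  moreover have "((2::real) ^ w) = 2 ^ (w - z) * 2 ^ z" using assms by (simp flip: power_add)
  ultimately show ?thesis by (simp add: avg_2 power2_eq_square)
qed

subsection \<open>The branching process\<close>

text \<open>Levels are lists of identifiers with repetitions, one entry per path, so that expected lengths are
  computed exactly even when identifiers collide; \<open>coll\<close> counts pairs of paths with equal identifiers.\<close>

definition coll :: "nat list \<Rightarrow> nat list \<Rightarrow> real" where
  "coll A B = (\<Sum>x\<leftarrow>A. \<Sum>y\<leftarrow>B. of_bool (x = y))"

text \<open>A path identifier and the element that extends it are packed into one key in base 2 ^ z,
  injectively as long as the elements lie below 2 ^ z.\<close>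

definition keys :: "nat \<Rightarrow> nat list \<Rightarrow> nat list \<Rightarrow> nat list" where
  "keys z vs xs = concat (map (\<lambda>v. map (\<lambda>i. v * 2 ^ z + i) xs) vs)"

definition next_level :: "nat \<Rightarrow> nat \<Rightarrow> nat \<Rightarrow> nat list \<Rightarrow> nat \<Rightarrow> nat \<Rightarrow> nat list \<Rightarrow> nat list" where
  "next_level w z \<tau> xs a c vs = filter (\<lambda>u. u < \<tau>) (map (hash w z a c) (keys z vs xs))"

fun grow :: "nat \<Rightarrow> nat \<Rightarrow> nat \<Rightarrow> nat list \<Rightarrow> nat list \<Rightarrow> nat list \<Rightarrow> nat list" where
  "grow w z \<tau> xs vs (a # c # ws) = grow w z \<tau> xs (next_level w z \<tau> xs a c vs) ws"
| "grow w z \<tau> xs vs _ = vs"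

definition pass :: "nat \<Rightarrow> nat \<Rightarrow> real" where
  "pass z \<tau> = real (min \<tau> (2 ^ z)) / 2 ^ z"

lemma pass_nonneg: "pass z \<tau> \<ge> 0" by (simp add: pass_def)

lemma sum_list_nonneg_real: "(\<And>x. x \<in> set xs \<Longrightarrow> f x \<ge> 0) \<Longrightarrow> (\<Sum>x\<leftarrow>xs. f x :: real) \<ge> 0"
  by (induction xs) auto

lemma coll_nonneg: "coll A B \<ge> 0"
  unfolding coll_def by (intro sum_list_nonneg_real) auto

lemma sum_list_of_bool_eq: "(\<Sum>y\<leftarrow>B. of_bool (x = y) :: real) = real (count_list B x)"
  by (induction B) auto

lemma coll_le: "coll A B \<le> real (length A) * real (length B)"
proof (induction A)
  case (Cons x A)
  have "count_list B x \<le> length B" by (induction B) auto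
  then show ?case using Cons by (simp add: coll_def sum_list_of_bool_eq algebra_simps)
qed (simp add: coll_def)

lemma coll_distinct: "distinct A \<Longrightarrow> distinct B \<Longrightarrow> coll A B = real (card (set A \<inter> set B))"
proof (induction A)
  case (Cons x A)
  have "count_list B x = of_bool (x \<in> set B)"
    using Cons.prems(2) by (induction B) auto
  then show ?case using Cons by (auto simp: coll_def sum_list_of_bool_eq Int_insert_left)
qed (simp add: coll_def)

lemma length_keys [simp]: "length (keys z vs xs) = length vs * length xs"
  by (induction vs) (auto simp: keys_def)

lemma key_eq_iff:
  fixes i i' :: nat
  assumes "i < 2 ^ z" "i' < 2 ^ z"
  shows "v * 2 ^ z + i = v' * 2 ^ z + i' \<longleftrightarrow> v = v' \<and> i = i'"
proof
  assume *: "v * 2 ^ z + i = v' * 2 ^ z + i'"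
  from arg_cong[OF *, of "\<lambda>x. x div 2 ^ z"] arg_cong[OF *, of "\<lambda>x. x mod 2 ^ z"]
  show "v = v' \<and> i = i'" using assms by simp
qed simp

lemma sum_list_concat_map: "(\<Sum>x\<leftarrow>concat xss. f x :: real) = (\<Sum>xs\<leftarrow>xss. \<Sum>x\<leftarrow>xs. f x)"
  by (induction xss) auto

lemma sum_list_keys: "(\<Sum>x\<leftarrow>keys z vs xs. f x :: real) = (\<Sum>v\<leftarrow>vs. \<Sum>i\<leftarrow>xs. f (v * 2 ^ z + i))"
  by (simp add: keys_def sum_list_concat_map o_def)

text \<open>Packing is injective, so two extended paths agree exactly when the identifiers of their
  parents and the appended elements do.\<close>

lemma coll_keys:
  assumes "set xs \<subseteq> {..<2 ^ z}" "set xs' \<subseteq> {..<2 ^ z}"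
  shows "coll (keys z vs xs) (keys z vs' xs') = coll vs vs' * coll xs xs'"
proof -
  have 1: "(\<Sum>i\<leftarrow>xs. \<Sum>i'\<leftarrow>xs'. of_bool (v * 2 ^ z + i = v' * 2 ^ z + i') :: real) =
    of_bool (v = v') * coll xs xs'" for v v'
  proof -
    have "(\<Sum>i\<leftarrow>xs. \<Sum>i'\<leftarrow>xs'. of_bool (v * 2 ^ z + i = v' * 2 ^ z + i') :: real) =
      (\<Sum>i\<leftarrow>xs. \<Sum>i'\<leftarrow>xs'. of_bool (v = v') * of_bool (i = i'))"
      using assms by (intro arg_cong[where f = sum_list] map_cong refl)
        (subst key_eq_iff, auto)
    then show ?thesis by (simp add: coll_def sum_list_const_mult)
  qed
  have swap: "(\<Sum>i\<leftarrow>as. \<Sum>v\<leftarrow>bs. f i v :: real) = (\<Sum>v\<leftarrow>bs. \<Sum>i\<leftarrow>as. f i v)" for as bs :: "nat list" and f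
    by (induction as) (auto simp: sum_list_addf)
  have "coll (keys z vs xs) (keys z vs' xs') =
    (\<Sum>v\<leftarrow>vs. \<Sum>i\<leftarrow>xs. \<Sum>v'\<leftarrow>vs'. \<Sum>i'\<leftarrow>xs'. of_bool (v * 2 ^ z + i = v' * 2 ^ z + i'))"
    by (simp only: coll_def sum_list_keys)
  also have "\<dots> = (\<Sum>v\<leftarrow>vs. \<Sum>v'\<leftarrow>vs'. \<Sum>i\<leftarrow>xs. \<Sum>i'\<leftarrow>xs'. of_bool (v * 2 ^ z + i = v' * 2 ^ z + i'))"
    by (subst swap) simp
  also have "\<dots> = (\<Sum>v\<leftarrow>vs. \<Sum>v'\<leftarrow>vs'. of_bool (v = v') * coll xs xs')"
    by (simp only: 1)
  also have "\<dots> = coll vs vs' * coll xs xs'"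
    by (simp add: coll_def sum_list_mult_const)
  finally show ?thesis .
qed

text \<open>Keys stay below 2 ^ (2 * z), so \<open>3 * z \<le> w\<close> gives the bound that
  pairwise independence asks for.\<close>

lemma set_keys_less:
  assumes "set vs \<subseteq> {..<2 ^ z}" "set xs \<subseteq> {..<2 ^ z}" "3 * z \<le> w" "x \<in> set (keys z vs xs)"
  shows "x * 2 ^ z \<le> 2 ^ w"
proof -
  obtain v i where vi: "v < 2 ^ z" "i < 2 ^ z" "x = v * 2 ^ z + i"
    using assms by (auto simp: keys_def)
  have "x < (v + 1) * 2 ^ z" using vi by simp
  also have "\<dots> \<le> 2 ^ z * 2 ^ z" using vi by (intro mult_right_mono) auto
  finally have "x * 2 ^ z \<le> (2 ^ z * 2 ^ z) * 2 ^ z" by (intro mult_right_mono) auto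
  also have "\<dots> = 2 ^ (3 * z)" by (simp flip: power_add)
  also have "\<dots> \<le> 2 ^ w" using assms(3) by (intro power_increasing) auto
  finally show ?thesis .
qed

section \<open>Moments of a single level\<close>

lemma sum_of_bool_less: "(\<Sum>\<alpha><2 ^ z. of_bool (\<alpha> < \<tau>)) = real (min \<tau> (2 ^ z))"
proof -
  have "{..<2 ^ z} \<inter> {\<alpha>. \<alpha> < \<tau>} = {..<min \<tau> (2 ^ z)}" by auto
  then show ?thesis by (simp add: of_bool_def sum.If_cases)
qed

lemma length_next: "real (length (filter (\<lambda>u. u < \<tau>) (map h A))) = (\<Sum>x\<leftarrow>A. of_bool (h x < \<tau>))"
  by (induction A) auto

lemma coll_next:
  "coll (filter (\<lambda>u. u < \<tau>) (map h A)) (filter (\<lambda>u. u < \<tau>') (map h B)) =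
    (\<Sum>x\<leftarrow>A. \<Sum>y\<leftarrow>B. of_bool (h x = h y \<and> h x < min \<tau> \<tau>'))"
proof -
  have *: "(\<Sum>y\<leftarrow>filter (\<lambda>u. u < \<tau>') (map h B). of_bool (u = y) :: real) =
    (\<Sum>y\<leftarrow>B. of_bool (u = h y \<and> u < \<tau>'))" for u
    by (induction B) auto
  show ?thesis unfolding coll_def *
    by (induction A) (auto simp: of_bool_def)
qed

lemma avg_hash_less:
  assumes "z \<le> w"
  shows "avg (2 ^ w) 2 (\<lambda>ws. of_bool (hash w z (ws ! 0) (ws ! 1) x < \<tau>)) = pass z \<tau>"
  using avg_hash[OF assms, of "\<lambda>\<alpha>. of_bool (\<alpha> < \<tau>)" x] by (simp add: sum_of_bool_less pass_def)

text \<open>Distinct keys behave independently, and equal keys pass both tests when they pass the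
  smaller threshold. The product term is kept for equal keys too, so that a sum over all pairs
  separates into \<open>coll\<close> and lengths.\<close>

lemma avg_hash_both_less:
  assumes "x * 2 ^ z \<le> 2 ^ w" "y * 2 ^ z \<le> 2 ^ w" "z \<le> w"
  shows "avg (2 ^ w) 2 (\<lambda>ws. of_bool (hash w z (ws ! 0) (ws ! 1) x < \<tau>) *
      of_bool (hash w z (ws ! 0) (ws ! 1) y < \<tau>')) \<le>
    of_bool (x = y) * pass z (min \<tau> \<tau>') + pass z \<tau> * pass z \<tau>'"
proof (cases "x = y")
  case True
  have "(\<lambda>ws. of_bool (hash w z (ws ! 0) (ws ! 1) y < \<tau>) * of_bool (hash w z (ws ! 0) (ws ! 1) y < \<tau>')) =
    (\<lambda>ws. of_bool (hash w z (ws ! 0) (ws ! 1) y < min \<tau> \<tau>') :: real)" by auto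
  with True show ?thesis
    using avg_hash_less[OF assms(3), of y "min \<tau> \<tau>'"] pass_nonneg[of z \<tau>] pass_nonneg[of z \<tau>'] by simp
next
  case False
  have "avg (2 ^ w) 2 (\<lambda>ws. of_bool (hash w z (ws ! 0) (ws ! 1) x < \<tau>) *
      of_bool (hash w z (ws ! 0) (ws ! 1) y < \<tau>')) =
    (\<Sum>\<alpha><2 ^ z. \<Sum>\<beta><2 ^ z. of_bool (\<alpha> < \<tau>) * of_bool (\<beta> < \<tau>')) / (2 ^ z)\<^sup>2"
    by (rule avg_hash_pair[OF False assms, of "\<lambda>\<alpha> \<beta>. of_bool (\<alpha> < \<tau>) * of_bool (\<beta> < \<tau>')"])
  also have "\<dots> = pass z \<tau> * pass z \<tau>'"
    by (simp only: sum_product[symmetric] sum_of_bool_less pass_def) (simp add: power2_eq_square)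
  finally show ?thesis using False by simp
qed

text \<open>The term \<open>pass z \<tau> / 2 ^ z\<close> is the price of accidental collisions,
  where distinct keys take a common value below the threshold.\<close>

lemma avg_hash_eq_less:
  assumes "x * 2 ^ z \<le> 2 ^ w" "y * 2 ^ z \<le> 2 ^ w" "z \<le> w"
  shows "avg (2 ^ w) 2 (\<lambda>ws. of_bool (hash w z (ws ! 0) (ws ! 1) x = hash w z (ws ! 0) (ws ! 1) y \<and>
      hash w z (ws ! 0) (ws ! 1) x < \<tau>)) \<le>
    of_bool (x = y) * pass z \<tau> + pass z \<tau> / 2 ^ z"
proof (cases "x = y")
  case True
  then show ?thesis
    using avg_hash_less[OF assms(3), of y \<tau>] pass_nonneg[of z \<tau>] by simp
next
  case False
  have "avg (2 ^ w) 2 (\<lambda>ws. of_bool (hash w z (ws ! 0) (ws ! 1) x = hash w z (ws ! 0) (ws ! 1) y \<and>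
      hash w z (ws ! 0) (ws ! 1) x < \<tau>)) =
    (\<Sum>\<alpha><2 ^ z. \<Sum>\<beta><2 ^ z. of_bool (\<alpha> = \<beta> \<and> \<alpha> < \<tau>)) / (2 ^ z)\<^sup>2"
    by (rule avg_hash_pair[OF False assms, of "\<lambda>\<alpha> \<beta>. of_bool (\<alpha> = \<beta> \<and> \<alpha> < \<tau>)"])
  also have "(\<Sum>\<alpha><2 ^ z. \<Sum>\<beta><2 ^ z. of_bool (\<alpha> = \<beta> \<and> \<alpha> < \<tau>)) = (\<Sum>\<alpha><2 ^ z. of_bool (\<alpha> < \<tau>) :: real)"
  proof (intro sum.cong refl)
    fix \<alpha> :: nat assume "\<alpha> \<in> {..<2 ^ z}"
    have "(\<Sum>\<beta><2 ^ z. of_bool (\<alpha> = \<beta> \<and> \<alpha> < \<tau>) :: real) =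
      (\<Sum>\<beta><2 ^ z. if \<alpha> = \<beta> then of_bool (\<alpha> < \<tau>) else 0)"
      by (intro sum.cong) auto
    with \<open>\<alpha> \<in> {..<2 ^ z}\<close> show "(\<Sum>\<beta><2 ^ z. of_bool (\<alpha> = \<beta> \<and> \<alpha> < \<tau>)) = (of_bool (\<alpha> < \<tau>) :: real)"
      by simp
  qed
  also have "\<dots> / (2 ^ z)\<^sup>2 = pass z \<tau> / 2 ^ z"
    by (simp only: sum_of_bool_less pass_def) (simp add: power2_eq_square)
  finally show ?thesis using False by simp
qed

lemma sum_list_mono2:
  "(\<And>x y. x \<in> set A \<Longrightarrow> y \<in> set B \<Longrightarrow> f x y \<le> g x y) \<Longrightarrow>
    (\<Sum>x\<leftarrow>A. \<Sum>y\<leftarrow>B. f x y :: real) \<le> (\<Sum>x\<leftarrow>A. \<Sum>y\<leftarrow>B. g x y)"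
  by (intro sum_list_mono)

lemma sum_list_pairs: "(\<Sum>x\<leftarrow>A. \<Sum>y\<leftarrow>B. of_bool (x = y) * p + q) = coll A B * p + real (length A) * real (length B) * q"
proof -
  have "(\<Sum>y\<leftarrow>B. of_bool (x = y) * p + q) = (\<Sum>y\<leftarrow>B. of_bool (x = y)) * p + real (length B) * q" for x
    by (induction B) (auto simp: algebra_simps)
  then show ?thesis unfolding coll_def by (induction A) (auto simp: algebra_simps)
qed

lemma avg_length_next:
  assumes "z \<le> w"
  shows "avg (2 ^ w) 2 (\<lambda>ws. real (length (next_level w z \<tau> xs (ws ! 0) (ws ! 1) vs))) =
    real (length xs) * pass z \<tau> * real (length vs)"
proof -
  have "avg (2 ^ w) 2 (\<lambda>ws. real (length (next_level w z \<tau> xs (ws ! 0) (ws ! 1) vs))) =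
    (\<Sum>x\<leftarrow>keys z vs xs. avg (2 ^ w) 2 (\<lambda>ws. of_bool (hash w z (ws ! 0) (ws ! 1) x < \<tau>)))"
    unfolding next_level_def length_next by (subst avg_sum_list) simp_all
  also have "\<dots> = (\<Sum>x\<leftarrow>keys z vs xs. pass z \<tau>)" by (simp only: avg_hash_less[OF assms])
  finally show ?thesis by (simp add: sum_list_triv)
qed

text \<open>A product of lengths is a sum over pairs of keys, to which
  \<open>avg_hash_both_less\<close> applies; the equal pairs are counted by
  \<open>coll_keys\<close>.\<close>

lemma avg_length_next_pair:
  assumes "set vs \<subseteq> {..<2 ^ z}" "set vs' \<subseteq> {..<2 ^ z}" "set xs \<subseteq> {..<2 ^ z}" "set xs' \<subseteq> {..<2 ^ z}"
    and zw: "3 * z \<le> w"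
  shows "avg (2 ^ w) 2 (\<lambda>ws. real (length (next_level w z \<tau> xs (ws ! 0) (ws ! 1) vs)) *
      real (length (next_level w z \<tau>' xs' (ws ! 0) (ws ! 1) vs'))) \<le>
    (real (length xs) * pass z \<tau>) * (real (length xs') * pass z \<tau>') * (real (length vs) * real (length vs')) +
    (coll xs xs' * pass z (min \<tau> \<tau>')) * coll vs vs'"
proof -
  have prod: "(\<Sum>x\<leftarrow>A. f x) * (\<Sum>y\<leftarrow>B. g y) = (\<Sum>x\<leftarrow>A. \<Sum>y\<leftarrow>B. f x * g y :: real)"
    for A B :: "nat list" and f g
    by (simp add: sum_list_const_mult sum_list_mult_const)
  have "avg (2 ^ w) 2 (\<lambda>ws. real (length (next_level w z \<tau> xs (ws ! 0) (ws ! 1) vs)) *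
      real (length (next_level w z \<tau>' xs' (ws ! 0) (ws ! 1) vs'))) =
    (\<Sum>x\<leftarrow>keys z vs xs. \<Sum>y\<leftarrow>keys z vs' xs'. avg (2 ^ w) 2 (\<lambda>ws.
      of_bool (hash w z (ws ! 0) (ws ! 1) x < \<tau>) * of_bool (hash w z (ws ! 0) (ws ! 1) y < \<tau>')))"
    unfolding next_level_def length_next prod by (subst avg_sum_list, simp)+ (rule refl)
  also have "\<dots> \<le> (\<Sum>x\<leftarrow>keys z vs xs. \<Sum>y\<leftarrow>keys z vs' xs'.
      of_bool (x = y) * pass z (min \<tau> \<tau>') + pass z \<tau> * pass z \<tau>')"
    using assms set_keys_less[OF assms(1,3) zw] set_keys_less[OF assms(2,4) zw]
    by (intro sum_list_mono2 avg_hash_both_less) auto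
  also have "\<dots> = coll vs vs' * coll xs xs' * pass z (min \<tau> \<tau>') +
      (real (length vs) * real (length xs)) * (real (length vs') * real (length xs')) * (pass z \<tau> * pass z \<tau>')"
    using assms by (simp add: sum_list_pairs coll_keys)
  finally show ?thesis by (simp add: mult_ac)
qed

text \<open>New coincidences have two sources: equal parents extended by a common element, and
  accidental collisions of distinct keys, which bear the factor 1 / 2 ^ z.\<close>

lemma avg_coll_next:
  assumes "set vs \<subseteq> {..<2 ^ z}" "set vs' \<subseteq> {..<2 ^ z}" "set xs \<subseteq> {..<2 ^ z}" "set xs' \<subseteq> {..<2 ^ z}"
    and zw: "3 * z \<le> w"
  shows "avg (2 ^ w) 2 (\<lambda>ws. coll (next_level w z \<tau> xs (ws ! 0) (ws ! 1) vs)
      (next_level w z \<tau>' xs' (ws ! 0) (ws ! 1) vs')) \<le>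
    (coll xs xs' * pass z (min \<tau> \<tau>')) * coll vs vs' +
    (real (length xs) * real (length xs') * pass z (min \<tau> \<tau>') / 2 ^ z) * (real (length vs) * real (length vs'))"
proof -
  have "avg (2 ^ w) 2 (\<lambda>ws. coll (next_level w z \<tau> xs (ws ! 0) (ws ! 1) vs)
      (next_level w z \<tau>' xs' (ws ! 0) (ws ! 1) vs')) =
    (\<Sum>x\<leftarrow>keys z vs xs. \<Sum>y\<leftarrow>keys z vs' xs'. avg (2 ^ w) 2 (\<lambda>ws.
      of_bool (hash w z (ws ! 0) (ws ! 1) x = hash w z (ws ! 0) (ws ! 1) y \<and>
        hash w z (ws ! 0) (ws ! 1) x < min \<tau> \<tau>')))"
    unfolding next_level_def coll_next by (subst avg_sum_list, simp)+ (rule refl)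
  also have "\<dots> \<le> (\<Sum>x\<leftarrow>keys z vs xs. \<Sum>y\<leftarrow>keys z vs' xs'.
      of_bool (x = y) * pass z (min \<tau> \<tau>') + pass z (min \<tau> \<tau>') / 2 ^ z)"
    using assms set_keys_less[OF assms(1,3) zw] set_keys_less[OF assms(2,4) zw]
    by (intro sum_list_mono2 avg_hash_eq_less) auto
  also have "\<dots> = coll vs vs' * coll xs xs' * pass z (min \<tau> \<tau>') +
      (real (length vs) * real (length xs)) * (real (length vs') * real (length xs')) * (pass z (min \<tau> \<tau>') / 2 ^ z)"
    using assms by (simp only: sum_list_pairs coll_keys) simp
  finally show ?thesis by (simp add: mult_ac)
qed

section \<open>Moments over all levels\<close>

lemma set_next_less: "z \<le> w \<Longrightarrow> set (next_level w z \<tau> xs a c vs) \<subseteq> {..<2 ^ z}"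
  by (auto simp: next_level_def hash_less)

text \<open>Conditions on the seed of the first level. Both trees read the same seeds, and this
  coupling is what creates shared paths.\<close>

lemma avg_grow_Suc:
  "avg W (2 * Suc k) (\<lambda>ws. f (grow w z \<tau> xs vs ws) (grow w z \<tau>' xs' vs' ws)) =
    avg W 2 (\<lambda>h. avg W (2 * k) (\<lambda>ws. f (grow w z \<tau> xs (next_level w z \<tau> xs (h ! 0) (h ! 1) vs) ws)
      (grow w z \<tau>' xs' (next_level w z \<tau>' xs' (h ! 0) (h ! 1) vs') ws)))"
proof -
  have *: "\<exists>a c. h = [a, c]" if "length h = 2" for h :: "nat list"
    using that by (auto simp: length_Suc_conv numeral_2_eq_2)
  have "avg W (2 * Suc k) (\<lambda>ws. f (grow w z \<tau> xs vs ws) (grow w z \<tau>' xs' vs' ws)) =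
    avg W (2 + 2 * k) (\<lambda>ws. f (grow w z \<tau> xs vs ws) (grow w z \<tau>' xs' vs' ws))"
    by simp
  also have "\<dots> = avg W 2 (\<lambda>h. avg W (2 * k) (\<lambda>ws. f (grow w z \<tau> xs vs (h @ ws)) (grow w z \<tau>' xs' vs' (h @ ws))))"
    by (rule avg_append)
  also have "\<dots> = avg W 2 (\<lambda>h. avg W (2 * k) (\<lambda>ws. f (grow w z \<tau> xs (next_level w z \<tau> xs (h ! 0) (h ! 1) vs) ws)
      (grow w z \<tau>' xs' (next_level w z \<tau>' xs' (h ! 0) (h ! 1) vs') ws)))"
    by (intro avg_cong) (auto dest!: *)
  finally show ?thesis .
qed

lemma avg_length_grow:
  assumes "z \<le> w"
  shows "avg (2 ^ w) (2 * k) (\<lambda>ws. real (length (grow w z \<tau> xs vs ws))) =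
    (real (length xs) * pass z \<tau>) ^ k * real (length vs)"
proof (induction k arbitrary: vs)
  case (Suc k)
  show ?case
    unfolding avg_grow_Suc[where f = "\<lambda>a b. real (length a)"] Suc.IH avg_cmult avg_length_next[OF assms]
    by (simp add: mult_ac)
qed simp

lemma avg_square_grow:
  assumes "set vs \<subseteq> {..<2 ^ z}" "set xs \<subseteq> {..<2 ^ z}" "distinct xs" "3 * z \<le> w"
    and mu: "\<mu> = real (length xs) * pass z \<tau>" "\<mu> \<ge> 1"
    and eps: "\<epsilon> \<ge> 0" "real (length xs) * real (length xs) * pass z \<tau> / 2 ^ z \<le> \<mu>\<^sup>2 * \<epsilon>" "\<epsilon> * (real k)\<^sup>2 \<le> 1"
  shows "avg (2 ^ w) (2 * k) (\<lambda>ws. real (length (grow w z \<tau> xs vs ws)) * real (length (grow w z \<tau> xs vs ws))) \<le>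
    \<mu> ^ (2 * k) * ((1 + \<epsilon> * (real k)\<^sup>2) * (real (length vs))\<^sup>2 + 2 * real k * coll vs vs)"
  using assms(1) eps(3)
proof (induction k arbitrary: vs)
  case 0
  then show ?case by (simp add: power2_eq_square)
next
  case (Suc k)
  have zw: "z \<le> w" using assms(4) by simp
  have cx: "coll xs xs = real (length xs)" using assms(3) by (simp add: coll_distinct distinct_card)
  have "\<epsilon> * (real k)\<^sup>2 \<le> \<epsilon> * (real (Suc k))\<^sup>2" using eps(1) by (intro mult_left_mono power_mono) auto
  then have ek: "\<epsilon> * (real k)\<^sup>2 \<le> 1" using Suc.prems by linarith
  define N where "N = (\<lambda>h. real (length (next_level w z \<tau> xs (h ! 0) (h ! 1) vs)))"
  define C where "C = (\<lambda>h. coll (next_level w z \<tau> xs (h ! 0) (h ! 1) vs) (next_level w z \<tau> xs (h ! 0) (h ! 1) vs))"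
  define N0 C0 where "N0 = (real (length vs))\<^sup>2" and "C0 = coll vs vs"
  have nn: "N0 \<ge> 0" "C0 \<ge> 0" by (auto simp: N0_def C0_def coll_nonneg)
  have EN: "avg (2 ^ w) 2 (\<lambda>h. N h * N h) \<le> \<mu>\<^sup>2 * N0 + \<mu> * C0"
    using avg_length_next_pair[OF Suc.prems(1,1) assms(2,2,4), of \<tau> \<tau>]
    by (simp add: N_def N0_def C0_def mu(1) cx power2_eq_square mult_ac)
  have EC: "avg (2 ^ w) 2 C \<le> \<mu> * C0 + \<mu>\<^sup>2 * \<epsilon> * N0"
  proof -
    have "avg (2 ^ w) 2 C \<le> \<mu> * C0 + (real (length xs) * real (length xs) * pass z \<tau> / 2 ^ z) * N0"
      using avg_coll_next[OF Suc.prems(1,1) assms(2,2,4), of \<tau> \<tau>]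
      by (simp add: C_def N0_def C0_def mu(1) cx power2_eq_square)
    also have "\<dots> \<le> \<mu> * C0 + \<mu>\<^sup>2 * \<epsilon> * N0" using eps(2) nn by (intro add_left_mono mult_right_mono)
    finally show ?thesis .
  qed
  have "avg (2 ^ w) (2 * Suc k) (\<lambda>ws. real (length (grow w z \<tau> xs vs ws)) * real (length (grow w z \<tau> xs vs ws))) \<le>
    avg (2 ^ w) 2 (\<lambda>h. \<mu> ^ (2 * k) * ((1 + \<epsilon> * (real k)\<^sup>2) * (N h)\<^sup>2 + 2 * real k * C h))"
    unfolding avg_grow_Suc[where f = "\<lambda>a b. real (length a) * real (length b)"] N_def C_def
    by (intro avg_mono Suc.IH set_next_less zw ek)
  also have "\<dots> = \<mu> ^ (2 * k) * ((1 + \<epsilon> * (real k)\<^sup>2) * avg (2 ^ w) 2 (\<lambda>h. N h * N h) + 2 * real k * avg (2 ^ w) 2 C)"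
    by (simp only: avg_cmult avg_add power2_eq_square)
  also have "\<dots> \<le> \<mu> ^ (2 * k) * ((1 + \<epsilon> * (real k)\<^sup>2) * (\<mu>\<^sup>2 * N0 + \<mu> * C0) + 2 * real k * (\<mu> * C0 + \<mu>\<^sup>2 * \<epsilon> * N0))"
    using EN EC mu(2) eps(1) by (intro mult_left_mono add_mono) auto
  \<comment> \<open>Since \<open>\<mu>\<close> is at least 1, \<open>\<mu> * C0\<close> is replaced
    by its multiple with the square, so that one common power of \<open>\<mu>\<close> factors
    out.\<close>
  also have "\<dots> \<le> \<mu> ^ (2 * k) * ((1 + \<epsilon> * (real k)\<^sup>2) * (\<mu>\<^sup>2 * N0 + \<mu>\<^sup>2 * C0) + 2 * real k * (\<mu>\<^sup>2 * C0 + \<mu>\<^sup>2 * \<epsilon> * N0))"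
  proof -
    have "\<mu> * C0 \<le> \<mu>\<^sup>2 * C0" using mu(2) nn by (intro mult_right_mono) (auto simp: power2_eq_square)
    then show ?thesis using mu(2) eps(1) by (intro mult_left_mono add_mono) auto
  qed
  also have "\<dots> = \<mu> ^ (2 * Suc k) * ((1 + \<epsilon> * (real k)\<^sup>2 + 2 * real k * \<epsilon>) * N0 + (1 + \<epsilon> * (real k)\<^sup>2 + 2 * real k) * C0)"
    by (simp add: algebra_simps power2_eq_square)
  also have "\<dots> \<le> \<mu> ^ (2 * Suc k) * ((1 + \<epsilon> * (real (Suc k))\<^sup>2) * N0 + 2 * real (Suc k) * C0)"
  proof -
    have "1 + \<epsilon> * (real k)\<^sup>2 + 2 * real k * \<epsilon> \<le> 1 + \<epsilon> * (real (Suc k))\<^sup>2"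
      using eps(1) by (simp add: power2_eq_square algebra_simps)
    moreover have "1 + \<epsilon> * (real k)\<^sup>2 + 2 * real k \<le> 2 * real (Suc k)" using ek by simp
    ultimately show ?thesis using mu(2) nn
      by (intro mult_left_mono[OF add_mono[OF mult_right_mono mult_right_mono]]) auto
  qed
  finally show ?case by (simp only: N0_def C0_def)
qed

text \<open>From a single root the second moment is at most 2 k + 2 times the squared mean, which
  \<open>avg_second_moment\<close> turns into a survival probability. Branching factor exactly 1 is
  enough.\<close>

lemma grow_survives:
  assumes "set xs \<subseteq> {..<2 ^ z}" "distinct xs" "3 * z \<le> w"
    and mu: "real (length xs) * pass z \<tau> \<ge> 1"
    and eps: "\<epsilon> \<ge> 0" "1 \<le> pass z \<tau> * 2 ^ z * \<epsilon>" "\<epsilon> * (real k)\<^sup>2 \<le> 1"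
  shows "avg (2 ^ w) (2 * k) (\<lambda>ws. of_bool (grow w z \<tau> xs [0] ws \<noteq> [])) \<ge> 1 / (2 * real k + 2)"
proof -
  define \<mu> where "\<mu> = real (length xs) * pass z \<tau>"
  have zw: "z \<le> w" using assms by simp
  have c: "coll [0] [0] = 1" by (simp add: coll_def)
  have "(real (length xs))\<^sup>2 * pass z \<tau> * 1 / 2 ^ z \<le> (real (length xs))\<^sup>2 * pass z \<tau> * (pass z \<tau> * 2 ^ z * \<epsilon>) / 2 ^ z"
    using eps pass_nonneg[of z \<tau>] by (intro divide_right_mono mult_left_mono) auto
  then have e2: "real (length xs) * real (length xs) * pass z \<tau> / 2 ^ z \<le> \<mu>\<^sup>2 * \<epsilon>"
    by (simp add: \<mu>_def power2_eq_square mult_ac)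
  have "avg (2 ^ w) (2 * k) (\<lambda>ws. real (length (grow w z \<tau> xs [0] ws)) * real (length (grow w z \<tau> xs [0] ws))) \<le>
    \<mu> ^ (2 * k) * ((1 + \<epsilon> * (real k)\<^sup>2) * (real (length [0::nat]))\<^sup>2 + 2 * real k * coll [0] [0])"
    using assms e2 by (intro avg_square_grow) (auto simp: \<mu>_def)
  also have "\<dots> \<le> \<mu> ^ (2 * k) * (2 * real k + 2)"
    using eps mu by (intro mult_left_mono) (auto simp: c \<mu>_def)
  finally have 1: "avg (2 ^ w) (2 * k) (\<lambda>ws. real (length (grow w z \<tau> xs [0] ws)) * real (length (grow w z \<tau> xs [0] ws)))
    \<le> (2 * real k + 2) * (\<mu> ^ k)\<^sup>2" by (simp add: power_mult power2_eq_square mult_ac power_mult_distrib)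
  have "avg (2 ^ w) (2 * k) (\<lambda>ws. of_bool (real (length (grow w z \<tau> xs [0] ws)) \<noteq> 0)) \<ge> 1 / (2 * real k + 2)"
    using mu 1 by (intro avg_second_moment[where m = "\<mu> ^ k"]) (auto simp: avg_length_grow[OF zw] \<mu>_def)
  then show ?thesis by simp
qed

text \<open>Genuine common paths grow by \<open>\<eta>\<close> per level. Every level adds
  accidental collisions, at most \<open>D\<close> per pair of paths on average; the number of pairs
  and the offspring of a collision both grow by at most \<open>\<Gamma>\<close>, which over
  \<open>k\<close> levels gives the second term.\<close>

lemma avg_coll_grow:
  assumes "set vs \<subseteq> {..<2 ^ z}" "set vs' \<subseteq> {..<2 ^ z}" "set xs \<subseteq> {..<2 ^ z}" "set xs' \<subseteq> {..<2 ^ z}"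
    and zw: "3 * z \<le> w"
    and lam: "coll xs xs' * pass z (min \<tau> \<tau>') \<le> \<eta>"
    and D: "real (length xs) * real (length xs') * pass z (min \<tau> \<tau>') / 2 ^ z \<le> D"
    and G: "(real (length xs) * pass z \<tau>) * (real (length xs') * pass z \<tau>') + \<eta> \<le> \<Gamma>" "1 \<le> \<Gamma>" "\<eta> \<le> \<Gamma>"
  shows "avg (2 ^ w) (2 * k) (\<lambda>ws. coll (grow w z \<tau> xs vs ws) (grow w z \<tau>' xs' vs' ws)) \<le>
    \<eta> ^ k * coll vs vs' + real k * \<Gamma> ^ k * D * (real (length vs) * real (length vs'))"
  using assms(1,2)
proof (induction k arbitrary: vs vs')
  case (Suc k)
  have zw': "z \<le> w" using zw by simp
  have lam0: "\<eta> \<ge> 0" using lam mult_nonneg_nonneg[OF coll_nonneg pass_nonneg] by (meson order_trans)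
  have D0: "D \<ge> 0" using D pass_nonneg[of z "min \<tau> \<tau>'"] order_trans[OF _ D] by simp
  define N where "N = (\<lambda>h. real (length (next_level w z \<tau> xs (h ! 0) (h ! 1) vs)) *
    real (length (next_level w z \<tau>' xs' (h ! 0) (h ! 1) vs')))"
  define C where "C = (\<lambda>h. coll (next_level w z \<tau> xs (h ! 0) (h ! 1) vs) (next_level w z \<tau>' xs' (h ! 0) (h ! 1) vs'))"
  define N0 C0 where "N0 = real (length vs) * real (length vs')" and "C0 = coll vs vs'"
  have nn: "N0 \<ge> 0" "C0 \<ge> 0" "C0 \<le> N0" by (auto simp: N0_def C0_def coll_nonneg coll_le)
  have EN: "avg (2 ^ w) 2 N \<le> \<Gamma> * N0"
  proof -
    have "avg (2 ^ w) 2 N \<le> (real (length xs) * pass z \<tau>) * (real (length xs') * pass z \<tau>') * N0 +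
      (coll xs xs' * pass z (min \<tau> \<tau>')) * C0"
      unfolding N_def N0_def C0_def by (intro avg_length_next_pair Suc.prems assms)
    also have "\<dots> \<le> (real (length xs) * pass z \<tau>) * (real (length xs') * pass z \<tau>') * N0 + \<eta> * N0"
      using lam nn lam0 by (intro add_left_mono mult_mono) auto
    also have "\<dots> \<le> \<Gamma> * N0" using G nn by (simp only: distrib_right[symmetric]) (intro mult_right_mono, auto)
    finally show ?thesis .
  qed
  have EC: "avg (2 ^ w) 2 C \<le> \<eta> * C0 + D * N0"
  proof -
    have "avg (2 ^ w) 2 C \<le> (coll xs xs' * pass z (min \<tau> \<tau>')) * C0 +
      (real (length xs) * real (length xs') * pass z (min \<tau> \<tau>') / 2 ^ z) * N0"
      unfolding C_def N0_def C0_def by (intro avg_coll_next Suc.prems assms)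
    also have "\<dots> \<le> \<eta> * C0 + D * N0" using lam D nn by (intro add_mono mult_right_mono)
    finally show ?thesis .
  qed
  have "avg (2 ^ w) (2 * Suc k) (\<lambda>ws. coll (grow w z \<tau> xs vs ws) (grow w z \<tau>' xs' vs' ws)) \<le>
    avg (2 ^ w) 2 (\<lambda>h. \<eta> ^ k * C h + real k * \<Gamma> ^ k * D * N h)"
    unfolding avg_grow_Suc[where f = coll] N_def C_def
    by (intro avg_mono Suc.IH set_next_less zw')
  also have "\<dots> = \<eta> ^ k * avg (2 ^ w) 2 C + real k * \<Gamma> ^ k * D * avg (2 ^ w) 2 N"
    by (simp only: avg_cmult avg_add)
  also have "\<dots> \<le> \<eta> ^ k * (\<eta> * C0 + D * N0) + real k * \<Gamma> ^ k * D * (\<Gamma> * N0)"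
    using EN EC lam0 D0 G by (intro add_mono mult_left_mono) auto
  also have "\<dots> = \<eta> ^ Suc k * C0 + (\<eta> ^ k * D * N0 + real k * \<Gamma> ^ Suc k * D * N0)"
    by (simp add: algebra_simps)
  \<comment> \<open>The coincidences created at the first level become the additional summand that
    turns \<open>k\<close> into \<open>Suc k\<close>.\<close>
  also have "\<eta> ^ k * D * N0 \<le> \<Gamma> ^ Suc k * D * N0"
  proof -
    have "\<eta> ^ k \<le> \<Gamma> ^ k" using lam0 G by (intro power_mono) auto
    also have "\<dots> \<le> \<Gamma> ^ Suc k" using G by (intro power_increasing) auto
    finally show ?thesis using D0 nn by (intro mult_right_mono)
  qed
  finally show ?case by (simp add: N0_def C0_def algebra_simps)
qed simp

text \<open>Applied to the intersection of two sets and the smaller of their thresholds, this places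
  every survivor of the shared process in both trees.\<close>

lemma set_grow_mono:
  assumes "set xs \<subseteq> set xs'" "\<tau> \<le> \<tau>'" "set vs \<subseteq> set vs'"
  shows "set (grow w z \<tau> xs vs ws) \<subseteq> set (grow w z \<tau>' xs' vs' ws)"
  using assms
proof (induction w z \<tau> xs vs ws arbitrary: vs' rule: grow.induct)
  case (1 w z \<tau> xs vs a c ws)
  have "set (next_level w z \<tau> xs a c vs) \<subseteq> set (next_level w z \<tau>' xs' a c vs')"
    using 1(2-4) by (fastforce simp: next_level_def keys_def)
  then show ?case using 1 by simp
qed auto

subsection \<open>A program logic with running times\<close>

text \<open>Meant for commands without randomness: the outcome is a point distribution, reached
  after exactly \<open>t\<close> steps. Quantifying over the remaining stack \<open>k\<close> makes
  it compositional.\<close>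

definition exec :: "nat \<Rightarrow> nat list \<Rightarrow> com \<Rightarrow> store \<Rightarrow> nat \<Rightarrow> store \<Rightarrow> bool" where
  "exec w inp c s t s' \<longleftrightarrow> (\<forall>k. run w inp t (c # k, s) = return_pmf (k, s'))"

definition wp :: "nat \<Rightarrow> nat list \<Rightarrow> com \<Rightarrow> (nat \<Rightarrow> store \<Rightarrow> bool) \<Rightarrow> store \<Rightarrow> bool" where
  "wp w inp c Q s \<longleftrightarrow> (\<exists>t s'. exec w inp c s t s' \<and> Q t s')"

lemma run_add: "run w inp (t + t') cfg = bind_pmf (run w inp t cfg) (run w inp t')"
proof (induction t arbitrary: cfg)
  case (Suc t)
  have "run w inp (t + t') = (\<lambda>x. bind_pmf (run w inp t x) (run w inp t'))"
    using Suc by blast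
  then show ?case by (simp add: bind_assoc_pmf)
qed (simp add: bind_return_pmf)

lemma run_halted: "run w inp t ([], s) = return_pmf ([], s)"
  by (induction t) (simp_all add: bind_return_pmf)

lemma wp_conseq:
  assumes "wp w inp c Q s" "\<And>t s'. Q t s' \<Longrightarrow> Q' t s'"
  shows "wp w inp c Q' s"
  using assms unfolding wp_def by blast

lemma wp_assign: "Q 1 (s\<lparr>regs := (regs s)(r := eval w inp s e)\<rparr>) \<Longrightarrow> wp w inp (Assign r e) Q s"
  unfolding wp_def exec_def by (intro exI conjI, rule allI) (auto simp: bind_return_pmf)

lemma wp_store: "Q 1 (s\<lparr>mem := (mem s)(eval w inp s e1 := eval w inp s e2)\<rparr>) \<Longrightarrow> wp w inp (Store e1 e2) Q s"
  unfolding wp_def exec_def by (intro exI conjI, rule allI) (auto simp: bind_return_pmf)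

lemma exec_Suc:
  assumes "\<And>k. step w inp (c # k, s) = return_pmf (c1 # k, s)" "exec w inp c1 s t s'"
  shows "exec w inp c s (Suc t) s'"
  using assms by (simp add: exec_def bind_return_pmf)

lemma wp_seq:
  assumes "wp w inp c1 (\<lambda>t1 s1. wp w inp c2 (\<lambda>t2 s2. Q (Suc (t1 + t2)) s2) s1) s"
  shows "wp w inp (Seq c1 c2) Q s"
proof -
  obtain t1 s1 t2 s2 where 1: "exec w inp c1 s t1 s1" "exec w inp c2 s1 t2 s2" "Q (Suc (t1 + t2)) s2"
    using assms unfolding wp_def by blast
  then have "exec w inp (Seq c1 c2) s (Suc (t1 + t2)) s2"
    by (simp add: exec_def bind_return_pmf run_add)
  with 1 show ?thesis unfolding wp_def by blast
qed

lemma wp_if: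
  assumes "eval w inp s e \<noteq> 0 \<Longrightarrow> wp w inp c1 (\<lambda>t. Q (Suc t)) s"
    and "eval w inp s e = 0 \<Longrightarrow> wp w inp c2 (\<lambda>t. Q (Suc t)) s"
  shows "wp w inp (If e c1 c2) Q s"
proof (cases "eval w inp s e = 0")
  case True
  then obtain t s' where "exec w inp c2 s t s'" "Q (Suc t) s'" using assms unfolding wp_def by blast
  moreover from this True have "exec w inp (If e c1 c2) s (Suc t) s'" by (intro exec_Suc) auto
  ultimately show ?thesis unfolding wp_def by blast
next
  case False
  then obtain t s' where "exec w inp c1 s t s'" "Q (Suc t) s'" using assms unfolding wp_def by blast
  moreover from this False have "exec w inp (If e c1 c2) s (Suc t) s'" by (intro exec_Suc) auto
  ultimately show ?thesis unfolding wp_def by blast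
qed

text \<open>The variant \<open>V\<close> is a potential: it pays for the running time of the remaining iterations.\<close>

lemma wp_while:
  fixes V :: "store \<Rightarrow> nat"
  assumes "I s"
    and step: "\<And>s. I s \<Longrightarrow> eval w inp s e \<noteq> 0 \<Longrightarrow> wp w inp c (\<lambda>t s'. I s' \<and> Suc t + V s' \<le> V s) s"
    and post: "\<And>t s'. I s' \<Longrightarrow> eval w inp s' e = 0 \<Longrightarrow> t + V s' \<le> Suc (V s) \<Longrightarrow> Q t s'"
  shows "wp w inp (While e c) Q s"
proof -
  have "\<exists>t s'. exec w inp (While e c) s t s' \<and> I s' \<and> eval w inp s' e = 0 \<and> t + V s' \<le> Suc (V s)"
    using assms(1)
  proof (induction "V s" arbitrary: s rule: less_induct)
    case (less s)
    show ?case
    proof (cases "eval w inp s e = 0")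
      case True
      then have "exec w inp (While e c) s (Suc 0) s" by (simp add: exec_def bind_return_pmf)
      then show ?thesis using True less.prems by (intro exI[of _ "Suc 0"] exI[of _ s]) simp
    next
      case False
      obtain t1 s1 where 1: "exec w inp c s t1 s1" "I s1" "Suc t1 + V s1 \<le> V s"
        using step[OF less.prems False] unfolding wp_def by blast
      obtain t2 s2 where 2: "exec w inp (While e c) s1 t2 s2" "I s2" "eval w inp s2 e = 0" "t2 + V s2 \<le> Suc (V s1)"
        using less.hyps[of s1] 1 by auto
      have "exec w inp (While e c) s (Suc (t1 + t2)) s2"
        using 1(1) 2(1) False by (simp add: exec_def bind_return_pmf run_add)
      moreover have "Suc (t1 + t2) + V s2 \<le> Suc (V s)" using 1(3) 2(4) by simp
      ultimately show ?thesis using 2 by blast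
    qed
  qed
  then show ?thesis using post unfolding wp_def by blast
qed

text \<open>Termination without a step count, enough for the preprocessing: only the query has a
  prescribed time.\<close>

lemma wp_while_measure:
  fixes V :: "store \<Rightarrow> nat"
  assumes "I s"
    and step: "\<And>s. I s \<Longrightarrow> eval w inp s e \<noteq> 0 \<Longrightarrow> wp w inp c (\<lambda>t s'. I s' \<and> V s' < V s) s"
    and post: "\<And>t s'. I s' \<Longrightarrow> eval w inp s' e = 0 \<Longrightarrow> Q t s'"
  shows "wp w inp (While e c) Q s"
proof -
  have "\<exists>t s'. exec w inp (While e c) s t s' \<and> I s' \<and> eval w inp s' e = 0"
    using assms(1)
  proof (induction "V s" arbitrary: s rule: less_induct)
    case (less s)
    show ?case
    proof (cases "eval w inp s e = 0")
      case True
      then have "exec w inp (While e c) s (Suc 0) s" by (simp add: exec_def bind_return_pmf)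
      then show ?thesis using True less.prems by auto
    next
      case False
      obtain t1 s1 where 1: "exec w inp c s t1 s1" "I s1" "V s1 < V s"
        using step[OF less.prems False] unfolding wp_def by blast
      obtain t2 s2 where 2: "exec w inp (While e c) s1 t2 s2" "I s2" "eval w inp s2 e = 0"
        using less.hyps[of s1] 1 by auto
      have "exec w inp (While e c) s (Suc (t1 + t2)) s2"
        using 1(1) 2(1) False by (simp add: exec_def bind_return_pmf run_add)
      then show ?thesis using 2 by blast
    qed
  qed
  then show ?thesis using post unfolding wp_def by blast
qed

lemma wp_run:
  assumes "wp w inp c (\<lambda>t s'. t \<le> T \<and> Q s') s"
  shows "\<exists>s'. run w inp T ([c], s) = return_pmf ([], s') \<and> Q s'"
proof -
  obtain t s' where 1: "run w inp t ([c], s) = return_pmf ([], s')" "t \<le> T" "Q s'"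
    using assms unfolding wp_def exec_def by blast
  have "run w inp (t + (T - t)) ([c], s) = return_pmf ([], s')"
    unfolding run_add 1(1) by (simp add: bind_return_pmf run_halted)
  then show ?thesis using 1 by auto
qed

section \<open>Concrete syntax and the drawing of the random words\<close>

notation Seq (infixr ";;" 55)
notation Assign ("_ ::= _" [61, 61] 60)

abbreviation plus_exp (infixl "+\<^sub>e" 65) where "a +\<^sub>e b \<equiv> Bin Plus a b"
abbreviation minus_exp (infixl "-\<^sub>e" 65) where "a -\<^sub>e b \<equiv> Bin Minus a b"
abbreviation times_exp (infixl "*\<^sub>e" 70) where "a *\<^sub>e b \<equiv> Bin Times a b"
abbreviation div_exp (infixl "div\<^sub>e" 70) where "a div\<^sub>e b \<equiv> Bin Div a b"
abbreviation mod_exp (infixl "mod\<^sub>e" 70) where "a mod\<^sub>e b \<equiv> Bin Mod a b"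
abbreviation less_exp (infix "<\<^sub>e" 50) where "a <\<^sub>e b \<equiv> Bin Less a b"
abbreviation eq_exp (infix "=\<^sub>e" 50) where "a =\<^sub>e b \<equiv> Bin Equal a b"
abbreviation and_exp (infixr "\<and>\<^sub>e" 35) where "a \<and>\<^sub>e b \<equiv> Bin And a b"

text \<open>All randomness is drawn here and kept in memory, so that sets and queries are later
  hashed with the same seeds.\<close>

definition draw_words :: com where
  "draw_words = While (Reg 14 <\<^sub>e Reg 10) (Rand 15 ;; Store (Reg 14) (Reg 15) ;; 14 ::= Reg 14 +\<^sub>e Const 1)"

fun mem_put :: "(nat \<Rightarrow> nat) \<Rightarrow> nat \<Rightarrow> nat list \<Rightarrow> (nat \<Rightarrow> nat)" where
  "mem_put m a [] = m"
| "mem_put m a (u # us) = mem_put (m(a := u)) (Suc a) us"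

lemma mem_put_outside: "b < a \<or> a + length us \<le> b \<Longrightarrow> mem_put m a us b = m b"
  by (induction m a us rule: mem_put.induct) auto

lemma mem_put_inside: "i < length us \<Longrightarrow> mem_put m a us (a + i) = us ! i"
proof (induction us arbitrary: m a i)
  case (Cons u us)
  then show ?case by (cases i) (use Cons.IH[of _ _ "Suc a"] in \<open>auto simp: mem_put_outside\<close>)
qed simp

text \<open>Each word costs six steps: loop test, two sequencing steps, draw, store and increment;
  one more test ends the loop. \<open>f\<close> hides what is left in the scratch registers 14 and
  15.\<close>

lemma run_draw_words:
  assumes "regs s 14 + N = regs s 10" "regs s 10 < 2 ^ w"
  shows "\<exists>f. (\<forall>ws r. r \<noteq> 14 \<and> r \<noteq> 15 \<longrightarrow> f ws r = regs s r) \<and>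
    (\<forall>k. run w inp (6 * N + 1) (draw_words # k, s) =
      map_pmf (\<lambda>ws. (k, \<lparr>regs = f ws, mem = mem_put (mem s) (regs s 14) ws\<rparr>))
        (replicate_pmf N (pmf_of_set {0..<2 ^ w})))"
  using assms
proof (induction N arbitrary: s)
  case 0
  then have "run w inp (Suc 0) (draw_words # k, s) = return_pmf (k, s)" for k
    by (simp add: draw_words_def bind_return_pmf)
  then show ?case by (intro exI[of _ "\<lambda>_. regs s"]) auto
next
  case (Suc N)
  define U where "U = pmf_of_set {0..<(2::nat) ^ w}"
  define s1 where "s1 = (\<lambda>u. s\<lparr>mem := (mem s)(regs s 14 := u), regs := (regs s)(15 := u, 14 := regs s 14 + 1)\<rparr>)"
  have w0: "w > 0" using Suc.prems by (cases w) auto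
  have "Suc (regs s 14) < 2 ^ w" using Suc.prems by simp
  then have step: "run w inp (Suc (Suc (Suc (Suc (Suc (Suc 0)))))) (draw_words # k, s) = map_pmf (\<lambda>u. (draw_words # k, s1 u)) U" for k
    using Suc.prems w0
    by (simp add: draw_words_def bind_return_pmf map_pmf_def bind_assoc_pmf s1_def U_def)
  have "\<exists>f. (\<forall>ws r. r \<noteq> 14 \<and> r \<noteq> 15 \<longrightarrow> f ws r = regs (s1 u) r) \<and>
    (\<forall>k. run w inp (6 * N + 1) (draw_words # k, s1 u) =
      map_pmf (\<lambda>ws. (k, \<lparr>regs = f ws, mem = mem_put (mem (s1 u)) (regs (s1 u) 14) ws\<rparr>))
        (replicate_pmf N U))" for u
    using Suc.prems unfolding U_def by (intro Suc.IH) (auto simp: s1_def)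
  then have "\<exists>f. \<forall>u. (\<forall>ws r. r \<noteq> 14 \<and> r \<noteq> 15 \<longrightarrow> f u ws r = regs (s1 u) r) \<and>
    (\<forall>k. run w inp (6 * N + 1) (draw_words # k, s1 u) =
      map_pmf (\<lambda>ws. (k, \<lparr>regs = f u ws, mem = mem_put (mem (s1 u)) (regs (s1 u) 14) ws\<rparr>))
        (replicate_pmf N U))"
    by (intro choice allI)
  then obtain f where f: "\<And>u ws r. r \<noteq> 14 \<Longrightarrow> r \<noteq> 15 \<Longrightarrow> f u ws r = regs (s1 u) r"
    "\<And>u k. run w inp (6 * N + 1) (draw_words # k, s1 u) =
      map_pmf (\<lambda>ws. (k, \<lparr>regs = f u ws, mem = mem_put (mem (s1 u)) (regs (s1 u) 14) ws\<rparr>))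
        (replicate_pmf N U)" by blast
  define g where "g = (\<lambda>ws. case ws of [] \<Rightarrow> regs s | u # us \<Rightarrow> f u us)"
  have "run w inp (6 * Suc N + 1) (draw_words # k, s) =
      map_pmf (\<lambda>ws. (k, \<lparr>regs = g ws, mem = mem_put (mem s) (regs s 14) ws\<rparr>)) (replicate_pmf (Suc N) U)" for k
  proof -
    have "run w inp (Suc (Suc (Suc (Suc (Suc (Suc 0))))) + (6 * N + 1)) (draw_words # k, s) =
      bind_pmf U (\<lambda>u. run w inp (6 * N + 1) (draw_words # k, s1 u))"
      unfolding run_add step by (simp only: bind_map_pmf)
    also have "\<dots> = map_pmf (\<lambda>ws. (k, \<lparr>regs = g ws, mem = mem_put (mem s) (regs s 14) ws\<rparr>)) (replicate_pmf (Suc N) U)"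
      unfolding f(2) by (simp add: map_pmf_def bind_assoc_pmf bind_return_pmf g_def s1_def)
    moreover have "Suc (Suc (Suc (Suc (Suc (Suc 0))))) + (6 * N + 1) = 6 * Suc N + 1" by simp
    ultimately show ?thesis by (simp only:)
  qed
  moreover have "g ws r = regs s r" if "r \<noteq> 14" "r \<noteq> 15" for ws r
    using f(1) that by (auto simp: g_def s1_def split: list.split)
  ultimately show ?case unfolding U_def by (intro exI[of _ g]) blast
qed

subsection \<open>Growing the tree of paths\<close>

text \<open>
  Registers 1 to 13 hold the parameters listed in \<open>params\<close> below, which the data structure also stores at the
  memory addresses 1 to 13. Registers 20, 21, 22 hold the size of the current set, the input position of its
  first element and its threshold; 23 and 24 are the length of the queue and the current position in it; 25 and
  26 are the current node. The memory consists of the random words (from address 32; the last two are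
  the seed of the bucket hash), the queue (\<open>QB\<close>), the heads of the bucket chains (\<open>HD\<close>), the chain entries
  (\<open>EN\<close>) and the sets (\<open>SB\<close>).
\<close>

lemma and_of_bool_nat [simp]: "semiring_bit_operations_class.and (of_bool a) (of_bool b :: nat) = of_bool (a \<and> b)"
  by (cases a; cases b) simp_all

definition hash_of :: "exp \<Rightarrow> exp \<Rightarrow> exp \<Rightarrow> exp" where
  "hash_of A B K = (Mem A *\<^sub>e K +\<^sub>e Mem B) div\<^sub>e Reg 2"

lemma eval_hash_of:
  "regs s 2 = 2 ^ (w - z) \<Longrightarrow> eval w inp s (hash_of A B K) =
    hash w z (mem s (eval w inp s A)) (mem s (eval w inp s B)) (eval w inp s K)"
  by (simp add: hash_of_def hash_def mod_add_left_eq)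

text \<open>The language has no empty command; register 29 is scratch wherever this occurs.\<close>

definition skip :: com where "skip = (29 ::= Const 0)"

text \<open>The second half of the inner test truncates the queue at \<open>cap\<close>, which
  register 6 holds.\<close>

definition expand_node :: com where
  "expand_node =
    (27 ::= Const 0) ;;
    While (Reg 27 <\<^sub>e Reg 20)
      ((28 ::= hash_of (Const 32 +\<^sub>e Const 2 *\<^sub>e Reg 25) (Const 33 +\<^sub>e Const 2 *\<^sub>e Reg 25)
          (Reg 26 *\<^sub>e Reg 1 +\<^sub>e Inp (Reg 21 +\<^sub>e Reg 27))) ;;
       If (Reg 28 <\<^sub>e Reg 22 \<and>\<^sub>e Reg 23 <\<^sub>e Reg 6)
         (Store (Reg 10 +\<^sub>e Const 2 *\<^sub>e Reg 23) (Reg 25 +\<^sub>e Const 1) ;;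
          Store (Reg 10 +\<^sub>e Const 2 *\<^sub>e Reg 23 +\<^sub>e Const 1) (Reg 28) ;;
          (23 ::= Reg 23 +\<^sub>e Const 1))
         skip ;;
       (27 ::= Reg 27 +\<^sub>e Const 1))"

definition push_roots :: com where
  "push_roots =
    (23 ::= Const 0) ;;
    While (Reg 23 <\<^sub>e Reg 8)
      (Store (Reg 10 +\<^sub>e Const 2 *\<^sub>e Reg 23) (Reg 23 *\<^sub>e (Reg 5 +\<^sub>e Const 1)) ;;
       Store (Reg 10 +\<^sub>e Const 2 *\<^sub>e Reg 23 +\<^sub>e Const 1) (Const 0) ;;
       (23 ::= Reg 23 +\<^sub>e Const 1))"

definition load_node :: com where
  "load_node =
    (25 ::= Mem (Reg 10 +\<^sub>e Const 2 *\<^sub>e Reg 24)) ;;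
    (26 ::= Mem (Reg 10 +\<^sub>e Const 2 *\<^sub>e Reg 24 +\<^sub>e Const 1))"

definition generate :: com where
  "generate =
    (22 ::= Reg 1 *\<^sub>e Reg 1 div\<^sub>e (Reg 3 *\<^sub>e Reg 20) +\<^sub>e Const 1) ;;
    push_roots ;;
    (24 ::= Const 0) ;;
    While (Reg 24 <\<^sub>e Reg 23)
      (load_node ;;
       If (Reg 25 mod\<^sub>e (Reg 5 +\<^sub>e Const 1) <\<^sub>e Reg 5) expand_node skip ;;
       (24 ::= Reg 24 +\<^sub>e Const 1))"

text \<open>A node \<open>(t, v)\<close> is a path with identifier \<open>v\<close> on level \<open>t mod Suc k\<close> of repetition \<open>t div Suc k\<close>; level
  \<open>t\<close> has its own seed, the words \<open>2 * t\<close> and \<open>2 * t + 1\<close>.\<close>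

type_synonym node = "nat \<times> nat"

section \<open>The queue of paths and its truncation\<close>

definition queue_in :: "(nat \<Rightarrow> nat) \<Rightarrow> nat \<Rightarrow> node list \<Rightarrow> bool" where
  "queue_in m a Q \<longleftrightarrow> (\<forall>i<length Q. m (a + 2 * i) = fst (Q ! i) \<and> m (a + 2 * i + 1) = snd (Q ! i))"

lemma queue_in_push:
  assumes "queue_in m a Q"
  shows "queue_in (m(a + 2 * length Q := t, Suc (a + 2 * length Q) := v)) a (Q @ [(t, v)])"
  using assms by (auto simp: queue_in_def nth_append less_Suc_eq)

lemma queue_in_cong: "queue_in m a Q \<Longrightarrow> (\<And>b. a \<le> b \<Longrightarrow> b < a + 2 * length Q \<Longrightarrow> m' b = m b) \<Longrightarrow> queue_in m' a Q"
  by (auto simp: queue_in_def)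

definition kids :: "nat \<Rightarrow> nat \<Rightarrow> nat \<Rightarrow> nat list \<Rightarrow> nat list \<Rightarrow> node \<Rightarrow> node list" where
  "kids w z \<tau> sd xs p = map (Pair (Suc (fst p))) (filter (\<lambda>u. u < \<tau>)
    (map (\<lambda>i. hash w z (sd ! (2 * fst p)) (sd ! (2 * fst p + 1)) (snd p * 2 ^ z + i)) xs))"

text \<open>The truncated queue after its first \<open>h\<close> nodes have been expanded.\<close>

fun bfs :: "nat \<Rightarrow> (node \<Rightarrow> node list) \<Rightarrow> node list \<Rightarrow> nat \<Rightarrow> node list" where
  "bfs cap ch roots 0 = roots"
| "bfs cap ch roots (Suc h) =
    (let Q = bfs cap ch roots h in if h < length Q then take cap (Q @ ch (Q ! h)) else Q)"

text \<open>Once the reading position reaches the end, nothing is appended any more. As the length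
  never exceeds \<open>cap\<close>, \<open>cap\<close> rounds always reach this state.\<close>

lemma bfs_stable: "h \<le> h' \<Longrightarrow> length (bfs cap ch roots h) \<le> h \<Longrightarrow> bfs cap ch roots h' = bfs cap ch roots h"
  by (induction h' rule: dec_induct) (auto simp: Let_def)

lemma length_bfs: "length roots \<le> cap \<Longrightarrow> length (bfs cap ch roots h) \<le> cap"
  by (induction h) (auto simp: Let_def)

lemma bfs_invariant:
  assumes "\<And>p. p \<in> set roots \<Longrightarrow> P p" "\<And>p p'. P p \<Longrightarrow> p' \<in> set (ch p) \<Longrightarrow> P p'"
  shows "p \<in> set (bfs cap ch roots h) \<Longrightarrow> P p"
proof (induction h arbitrary: p)
  case (Suc h)
  show ?case
  proof (cases "h < length (bfs cap ch roots h)")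
    case True
    then have "p \<in> set (bfs cap ch roots h) \<or> p \<in> set (ch (bfs cap ch roots h ! h))"
      using Suc.prems by (auto simp: Let_def dest!: in_set_takeD)
    then show ?thesis using Suc.IH assms(2)[OF Suc.IH[OF nth_mem[OF True]]] by blast
  next
    case False
    then show ?thesis using Suc by (simp add: Let_def)
  qed
qed (use assms in auto)

text \<open>\<open>zw\<close> leaves room in a word for products of several numbers below 2 ^ z.
  \<open>fit\<close> places the whole memory, sets included, below 2 ^ z, and likewise the budget of
  \<open>40 * cap\<close> candidates that a query may inspect; 36 collects the fixed cells.\<close>

locale layout =
  fixes w z B1 B2 k L cap n N :: nat
  assumes zw: "8 * z \<le> w"
    and B1: "0 < B1" "B1 \<le> 2 ^ z" and B2: "0 < B2" "B2 \<le> 2 ^ z"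
    and L: "0 < L" "L \<le> cap" and n: "0 < n"
    and fit: "36 + 2 * (L * Suc k) + 2 * cap + 3 * (n * cap) + N \<le> 2 ^ z" "40 * cap \<le> 2 ^ z"
begin

text \<open>The scale \<open>Z\<close> is at once the range of the hash functions, the precision of \<open>b1\<close> and \<open>b2\<close>
  (\<open>B1 / Z\<close> and \<open>B2 / Z\<close> approximate them) and a bound on all addresses.\<close>

definition "Z = (2::nat) ^ z"
definition "QB = 34 + 2 * (L * Suc k)"
definition "HD = QB + 2 * cap"
text \<open>Both the number of buckets and a bound on the number of chain entries, so a bucket holds
  at most one entry on average.\<close>

definition "Mb = n * cap"
definition "EN = HD + Mb"
text \<open>The two extra cells are due to the numbering of entries from 1: entry number
  \<open>Mb\<close> ends at \<open>EN + 2 * Mb + 1\<close>.\<close>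

definition "SB = EN + 2 * Mb + 2"
text \<open>The threshold Z / (b1 * m), with b1 approximated by \<open>B1 / Z\<close>. Rounding it
  upwards by \<open>+ 1\<close> keeps the shared process of a close pair from falling below
  branching factor 1; the excess reappears as \<open>d / Z\<close> in the upper bounds.\<close>

definition "tau m = Z * Z div (B1 * m) + 1"

definition params :: "(nat \<Rightarrow> nat) \<Rightarrow> bool" where
  "params f \<longleftrightarrow> f 1 = Z \<and> f 2 = 2 ^ (w - z) \<and> f 3 = B1 \<and> f 4 = B2 \<and> f 5 = k \<and> f 6 = cap \<and> f 7 = Mb \<and>
    f 8 = L \<and> f 9 = n \<and> f 10 = QB \<and> f 11 = HD \<and> f 12 = EN \<and> f 13 = SB"

lemma params_cong: "params f \<Longrightarrow> (\<And>r. 1 \<le> r \<Longrightarrow> r \<le> 13 \<Longrightarrow> g r = f r) \<Longrightarrow> params g"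
  by (auto simp: params_def)

lemma bounds: "QB + 2 * cap = HD" "HD + Mb = EN" "EN + 2 * Mb + 2 = SB" "SB + N \<le> Z"
  "34 + 2 * (L * Suc k) = QB" "40 * cap \<le> Z" "L \<le> L * Suc k" "k \<le> L * Suc k" "cap \<le> Mb" "n \<le> Mb"
proof -
  show "QB + 2 * cap = HD" "HD + Mb = EN" "EN + 2 * Mb + 2 = SB" "34 + 2 * (L * Suc k) = QB" "40 * cap \<le> Z"
    using fit by (auto simp: HD_def EN_def SB_def QB_def Z_def)
  show "SB + N \<le> Z" using fit by (simp add: HD_def EN_def SB_def QB_def Z_def Mb_def mult.commute[of cap])
  show "L \<le> L * Suc k" "cap \<le> Mb" using L n by (auto simp: Mb_def)
  have "1 * k \<le> L * Suc k" using L by (intro mult_mono) auto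
  then show "k \<le> L * Suc k" by simp
  show "n \<le> Mb" using L by (auto simp: Mb_def)
qed

lemma z_ge: "z \<ge> 5"
proof (rule ccontr)
  assume "\<not> 5 \<le> z"
  then have "(2::nat) ^ z \<le> 2 ^ 4" by (intro power_increasing) auto
  then show False using fit by simp
qed

lemma Z4: "Z * Z * Z * Z < 2 ^ w"
proof -
  have "Z * Z * Z * Z = 2 ^ (4 * z)" by (simp add: Z_def flip: power_add)
  also have "\<dots> < 2 ^ w" using z_ge zw by (intro power_strict_increasing) auto
  finally show ?thesis .
qed

lemma Z_ge: "Z \<ge> 32"
proof -
  have "(2::nat) ^ 5 \<le> Z" unfolding Z_def using z_ge by (intro power_increasing) auto
  then show ?thesis by simp
qed

lemma Z2: "1000 * Z \<le> Z * Z * Z" "Z * Z * Z < 2 ^ w" "Z * Z \<le> Z * Z * Z" "1000 * Z < 2 ^ w" "2 * (Z * Z) < 2 ^ w"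
proof -
  have "1000 \<le> 32 * (32::nat)" by simp
  also have "\<dots> \<le> Z * Z" using Z_ge by (intro mult_mono) auto
  finally show 1: "1000 * Z \<le> Z * Z * Z" by (intro mult_right_mono) auto
  have "Z * Z * Z * 1 \<le> Z * Z * Z * Z" using Z_ge by (intro mult_left_mono) auto
  then show 2: "Z * Z * Z < 2 ^ w" using Z4 by linarith
  show "Z * Z \<le> Z * Z * Z" using Z_ge by simp
  show "1000 * Z < 2 ^ w" using 1 2 by linarith
  have "2 * (Z * Z) \<le> Z * (Z * Z)" using Z_ge by (intro mult_right_mono) auto
  also have "\<dots> = Z * Z * Z" by simp
  finally show "2 * (Z * Z) < 2 ^ w" using 2 by linarith
qed

lemma w_pos: "w \<ge> 40" using z_ge zw by simp

lemma const_mod: "c \<le> 1000 * Z \<Longrightarrow> c mod 2 ^ w = c"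
  using Z2 by simp

definition seeds_in :: "(nat \<Rightarrow> nat) \<Rightarrow> nat list \<Rightarrow> bool" where
  "seeds_in m sd \<longleftrightarrow> length sd = 2 * (L * Suc k) \<and> (\<forall>i<length sd. m (32 + i) = sd ! i)"

definition reads :: "nat list \<Rightarrow> nat \<Rightarrow> nat list \<Rightarrow> bool" where
  "reads inp b xs \<longleftrightarrow> set xs \<subseteq> {..<Z} \<and> b + length xs \<le> Z \<and> b + length xs \<le> length inp \<and>
    (\<forall>j<length xs. inp ! (b + j) = xs ! j)"

lemma wp_expand_node:
  assumes p: "params (regs s)" and sd: "seeds_in (mem s) sd" and rd: "reads inp (regs s 21) xs" "regs s 20 = length xs"
    and tv: "regs s 25 < L * Suc k" "regs s 26 < Z"
    and Q: "queue_in (mem s) QB Q" "regs s 23 = length Q" "length Q \<le> cap"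
  shows "wp w inp expand_node (\<lambda>T s'. T \<le> 20 * length xs + 10 \<and>
      (\<forall>r. r \<notin> {23, 27, 28, 29} \<longrightarrow> regs s' r = regs s r) \<and>
      (\<forall>a. a < QB \<or> HD \<le> a \<longrightarrow> mem s' a = mem s a) \<and>
      queue_in (mem s') QB (take cap (Q @ kids w z (regs s 22) sd xs (regs s 25, regs s 26))) \<and>
      regs s' 23 = length (take cap (Q @ kids w z (regs s 22) sd xs (regs s 25, regs s 26)))) s"
proof -
  define QQ where "QQ = (\<lambda>j. take cap (Q @ kids w z (regs s 22) sd (take j xs) (regs s 25, regs s 26)))"
  define I where "I = (\<lambda>s' :: store. regs s' 27 \<le> length xs \<and>
      (\<forall>r. r \<notin> {23, 27, 28, 29} \<longrightarrow> regs s' r = regs s r) \<and>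
      (\<forall>a. a < QB \<or> HD \<le> a \<longrightarrow> mem s' a = mem s a) \<and>
      queue_in (mem s') QB (QQ (regs s' 27)) \<and>
      regs s' 23 = length (QQ (regs s' 27)))"
  have w1: "w > 0" using w_pos by simp
  note ps = p[unfolded params_def]
  show ?thesis unfolding expand_node_def
  proof (intro wp_seq wp_assign, rule wp_while[where I = I and V = "\<lambda>s'. 20 * (length xs - regs s' 27)"], goal_cases)
    case 1
    show ?case using Q by (auto simp: I_def QQ_def kids_def)
  next
    case (2 s1)
    have I1: "regs s1 27 \<le> length xs" "\<And>r. r \<notin> {23, 27, 28, 29} \<Longrightarrow> regs s1 r = regs s r"
      "\<And>a. a < QB \<or> HD \<le> a \<Longrightarrow> mem s1 a = mem s a"
      "queue_in (mem s1) QB (QQ (regs s1 27))" "regs s1 23 = length (QQ (regs s1 27))"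
      using 2(1) by (auto simp: I_def)
    define j where "j = regs s1 27"
    have j: "j < length xs" using 2(2) I1 rd by (simp add: j_def)
    define t v where "t = regs s 25" and "v = regs s 26"
    define u where "u = hash w z (sd ! (2 * t)) (sd ! (2 * t + 1)) (v * 2 ^ z + xs ! j)"
    have kj: "kids w z (regs s 22) sd (take (Suc j) xs) (t, v) = kids w z (regs s 22) sd (take j xs) (t, v) @
      (if u < regs s 22 then [(Suc t, u)] else [])"
      using j by (simp add: kids_def u_def take_Suc_conv_app_nth)
    \<comment> \<open>Cutting off at \<open>cap\<close> after every element agrees with cutting off
      once at the end.\<close>
    have QS: "QQ (Suc j) = (if u < regs s 22 \<and> length (QQ j) < cap then QQ j @ [(Suc t, u)] else QQ j)"
      unfolding QQ_def kj[folded t_def v_def, unfolded t_def v_def] by (auto simp: t_def)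
    have lq: "length (QQ j) \<le> cap" by (simp add: QQ_def)
    have t2: "2 * t + 1 < 2 * (L * Suc k)" using tv by (simp add: t_def)
    have a1: "eval w inp s1 (Const 32 +\<^sub>e Const 2 *\<^sub>e Reg 25) = 32 + 2 * t"
      "eval w inp s1 (Const 33 +\<^sub>e Const 2 *\<^sub>e Reg 25) = 32 + (2 * t + 1)"
      using I1(2) t2 bounds Z2 by (simp_all add: t_def const_mod)
    have a2: "mem s1 (32 + 2 * t) = sd ! (2 * t)" "mem s1 (32 + (2 * t + 1)) = sd ! (2 * t + 1)"
      using sd t2 I1(3)[of "32 + 2 * t"] I1(3)[of "32 + (2 * t + 1)"] bounds
      by (auto simp: seeds_in_def)
    have "xs ! j < Z" using rd(1) nth_mem[OF j] unfolding reads_def by blast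
    moreover have "v * Z + Z \<le> Z * Z" using tv mult_right_mono[of "Suc v" Z Z] by (simp add: v_def)
    moreover have "v * Z \<le> Z * Z" using tv by (simp add: v_def)
    ultimately have a3: "eval w inp s1 (Reg 26 *\<^sub>e Reg 1 +\<^sub>e Inp (Reg 21 +\<^sub>e Reg 27)) = v * 2 ^ z + xs ! j"
      using I1(2) ps rd j Z2 by (simp add: v_def[symmetric] j_def[symmetric] reads_def Let_def Z_def[symmetric])
    have u: "eval w inp s1 (hash_of (Const 32 +\<^sub>e Const 2 *\<^sub>e Reg 25) (Const 33 +\<^sub>e Const 2 *\<^sub>e Reg 25)
          (Reg 26 *\<^sub>e Reg 1 +\<^sub>e Inp (Reg 21 +\<^sub>e Reg 27))) = u"
      using ps I1(2) by (subst eval_hash_of[where z = z]) (simp_all only: a1 a2 a3 u_def, simp)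
    have r: "regs s1 22 = regs s 22" "regs s1 6 = cap" "regs s1 10 = QB" "regs s1 25 = t" "regs s1 27 = j"
      "regs s1 23 = length (QQ j)"
      using I1 ps by (auto simp: t_def j_def)
    have ar: "QB + 2 * length (QQ j) + 1 < 2 ^ w" "t + 1 < 2 ^ w" "j + 1 < 2 ^ w" "length (QQ j) + 1 < 2 ^ w"
      using lq bounds Z2 t2 j rd(1) by (auto simp: reads_def)
    show ?case unfolding skip_def
    proof (intro wp_seq wp_assign wp_if wp_store, goal_cases)
      case 1
      then have c: "u < regs s 22" "length (QQ j) < cap" using u r by auto
      have "queue_in ((mem s1)(QB + 2 * length (QQ j) := Suc t, Suc (QB + 2 * length (QQ j)) := u)) QB (QQ (Suc j))"
        using queue_in_push[OF I1(4)[folded j_def]] c by (simp add: QS)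
      then show ?case using u r ar c I1 w1 j bounds by (auto simp: I_def QS)
    next
      case 2
      then have c: "\<not> (u < regs s 22 \<and> length (QQ j) < cap)" using u r by auto
      then show ?case using u r ar I1 w1 j bounds by (auto simp: I_def QS)
    qed
  next
    case (3 T s')
    then have "regs s' 27 = length xs" using rd by (simp add: I_def)
    then show ?case using 3 by (auto simp: I_def QQ_def)
  qed
qed


definition roots :: "node list" where
  "roots = map (\<lambda>r. (r * Suc k, 0)) [0..<L]"

definition is_leaf :: "node \<Rightarrow> bool" where
  "is_leaf p \<longleftrightarrow> \<not> fst p mod Suc k < k"

definition children :: "nat list \<Rightarrow> nat list \<Rightarrow> node \<Rightarrow> node list" where
  "children sd xs p = (if is_leaf p then [] else kids w z (tau (length xs)) sd xs p)"

definition queue :: "nat list \<Rightarrow> nat list \<Rightarrow> node list" where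
  "queue sd xs = bfs cap (children sd xs) roots cap"

definition good_node :: "node \<Rightarrow> bool" where
  "good_node p \<longleftrightarrow> fst p < L * Suc k \<and> snd p < Z"

lemma good_roots: "p \<in> set roots \<Longrightarrow> good_node p"
proof -
  have "Suc r * Suc k \<le> L * Suc k" if "r < L" for r using that by (intro mult_right_mono) auto
  then have "r * Suc k < L * Suc k" if "r < L" for r using that by fastforce
  then show "p \<in> set roots \<Longrightarrow> good_node p" using Z_ge by (auto simp: roots_def good_node_def)
qed

text \<open>The successor of an inner level lies in the same block of \<open>Suc k\<close> levels,
  so a path never leaves its repetition and its seed index stays in range.\<close>

lemma Suc_not_leaf:
  assumes "t < L * Suc k" "t mod Suc k < k"
  shows "Suc t < L * Suc k"
proof -
  have "t div Suc k < L" using assms(1) by (simp add: less_mult_imp_div_less)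
  then have "Suc (t div Suc k) * Suc k \<le> L * Suc k" by (intro mult_right_mono) auto
  moreover have "t = (t div Suc k) * Suc k + t mod Suc k" by (metis div_mult_mod_eq)
  ultimately show ?thesis using assms(2) by simp
qed

lemma good_children: "good_node p \<Longrightarrow> p' \<in> set (children sd xs p) \<Longrightarrow> good_node p'"
  using Suc_not_leaf[of "fst p"] hash_less[of z w] zw
  by (auto simp: children_def is_leaf_def kids_def good_node_def Z_def split: if_splits)

lemma good_queue: "p \<in> set (bfs cap (children sd xs) roots h) \<Longrightarrow> good_node p"
  by (rule bfs_invariant[where P = good_node]) (auto intro: good_roots good_children)

lemma length_roots: "length roots = L" by (simp add: roots_def)

lemma length_queue: "length (queue sd xs) \<le> cap"
  unfolding queue_def by (rule length_bfs) (simp add: length_roots L)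

lemma w1: "w > 0" using w_pos by simp

lemma wp_push_roots:
  assumes p: "params (regs s)"
  shows "wp w inp push_roots (\<lambda>T s'. T \<le> 20 * cap + 10 \<and>
      (\<forall>r. r \<noteq> 23 \<longrightarrow> regs s' r = regs s r) \<and>
      (\<forall>a. a < QB \<or> HD \<le> a \<longrightarrow> mem s' a = mem s a) \<and>
      queue_in (mem s') QB roots \<and> regs s' 23 = L) s"
proof -
  define I where "I = (\<lambda>s' :: store. regs s' 23 \<le> L \<and>
      (\<forall>r. r \<noteq> 23 \<longrightarrow> regs s' r = regs s r) \<and>
      (\<forall>a. a < QB \<or> HD \<le> a \<longrightarrow> mem s' a = mem s a) \<and>
      queue_in (mem s') QB (take (regs s' 23) roots))"
  note ps = p[unfolded params_def]
  show ?thesis unfolding push_roots_def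
  proof (intro wp_seq wp_assign, rule wp_while[where I = I and V = "\<lambda>s'. 10 * (L - regs s' 23)"], goal_cases)
    case 1
    show ?case by (simp add: I_def queue_in_def)
  next
    case (2 s1)
    define j where "j = regs s1 23"
    have r: "regs s1 10 = QB" "regs s1 5 = k" "regs s1 8 = L" "regs s1 23 = j"
      using 2(1) ps by (auto simp: I_def j_def)
    have j: "j < L" using 2(2) r by simp
    have "j * Suc k \<le> L * Suc k" using j by (intro mult_right_mono) auto
    then have ar: "QB + 2 * j + 1 < 2 ^ w" "j * Suc k < 2 ^ w" "j + 1 < 2 ^ w" "k + 1 < 2 ^ w"
      using j bounds Z2 L by auto
    have q: "take (Suc j) roots = take j roots @ [(j * Suc k, 0)]" "length (take j roots) = j"
      using j by (auto simp: roots_def take_map take_Suc_conv_app_nth)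
    have q1: "queue_in (mem s1) QB (take j roots)" using 2(1) by (simp add: I_def j_def)
    have "queue_in ((mem s1)(QB + 2 * j := j * Suc k, Suc (QB + 2 * j) := 0)) QB (take (Suc j) roots)"
      using queue_in_push[OF q1, of "j * Suc k" 0] q by simp
    then show ?case
      by (intro wp_seq wp_store wp_assign) (use 2(1) r ar j w1 bounds L in \<open>auto simp: I_def\<close>)
  next
    case (3 T s')
    then show ?case using ps L by (auto simp: I_def length_roots)
  qed
qed

lemma wp_load_node:
  assumes "params (regs s)" "queue_in (mem s) QB Q" "regs s 24 < length Q" "length Q \<le> cap"
    and post: "\<And>s'. mem s' = mem s \<Longrightarrow> (\<And>r. r \<noteq> 25 \<Longrightarrow> r \<noteq> 26 \<Longrightarrow> regs s' r = regs s r) \<Longrightarrow>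
      regs s' 25 = fst (Q ! regs s 24) \<Longrightarrow> regs s' 26 = snd (Q ! regs s 24) \<Longrightarrow> P (Suc (1 + 1)) s'"
  shows "wp w inp load_node P s"
proof -
  have ar: "QB + 2 * regs s 24 + 1 < 2 ^ w" "2 * regs s 24 < 2 ^ w" "2 < (2::nat) ^ w"
    using assms(3,4) bounds Z2 Z_ge by auto
  have r: "regs s 10 = QB" using assms(1) by (simp add: params_def)
  show ?thesis unfolding load_node_def
    by (intro wp_seq wp_assign post) (use ar r assms(2,3) w1 in \<open>auto simp: queue_in_def\<close>)
qed

lemma eval_not_leaf:
  assumes "regs s 5 = k"
  shows "eval w inp s (Reg 25 mod\<^sub>e (Reg 5 +\<^sub>e Const 1) <\<^sub>e Reg 5) = of_bool (regs s 25 mod Suc k < k)"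
proof -
  have "k + 1 < 2 ^ w" using bounds Z2 by auto
  then show ?thesis using w1 assms by simp
qed

lemma wp_generate:
  assumes p: "params (regs s)" and sd: "seeds_in (mem s) sd"
    and rd: "reads inp (regs s 21) xs" "regs s 20 = length xs"
  shows "wp w inp generate (\<lambda>T s'. T \<le> cap * (20 * length xs + 100) + 100 \<and>
      (\<forall>r. r < 22 \<or> 29 < r \<longrightarrow> regs s' r = regs s r) \<and>
      (\<forall>a. a < QB \<or> HD \<le> a \<longrightarrow> mem s' a = mem s a) \<and>
      queue_in (mem s') QB (queue sd xs) \<and> regs s' 23 = length (queue sd xs)) s"
proof -
  define BQ where "BQ = bfs cap (children sd xs) roots"
  have lBQ: "length (BQ h) \<le> cap" for h unfolding BQ_def by (rule length_bfs) (simp add: length_roots L)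
  note ps = p[unfolded params_def]
  define I where "I = (\<lambda>s' :: store. regs s' 24 \<le> length (BQ (regs s' 24)) \<and>
      (\<forall>r. r < 22 \<or> 29 < r \<longrightarrow> regs s' r = regs s r) \<and> regs s' 22 = tau (length xs) \<and>
      (\<forall>a. a < QB \<or> HD \<le> a \<longrightarrow> mem s' a = mem s a) \<and>
      queue_in (mem s') QB (BQ (regs s' 24)) \<and> regs s' 23 = length (BQ (regs s' 24)))"
  have lx: "length xs \<le> Z" using rd by (auto simp: reads_def)
  have "B1 * length xs \<le> Z * Z" using B1 lx by (intro mult_mono) (auto simp: Z_def)
  moreover have "Suc (Z * Z div (B1 * length xs)) < 2 ^ w"
    using div_le_dividend[of "Z * Z" "B1 * length xs"] Z2 Z_ge by linarith
  ultimately have tau: "eval w inp s (Reg 1 *\<^sub>e Reg 1 div\<^sub>e (Reg 3 *\<^sub>e Reg 20) +\<^sub>e Const 1) = tau (length xs)"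
    using ps rd(2) Z2 w1 Z_ge by (simp add: tau_def)
  define s0 where "s0 = s\<lparr>regs := (regs s)(22 := tau (length xs))\<rparr>"
  have p0: "params (regs s0)" using p by (rule params_cong) (auto simp: s0_def)
  show ?thesis unfolding generate_def
  proof (rule wp_seq, rule wp_assign, unfold tau, fold s0_def, rule wp_seq, rule wp_conseq[OF wp_push_roots[OF p0]],
      elim conjE, goal_cases)
    case (1 T1 s1)
    show ?case
    \<comment> \<open>The potential counts positions up to \<open>cap\<close>, not up to the end of
      the queue, because the queue still grows during the loop.\<close>
    proof (rule wp_seq, rule wp_assign, rule wp_while[where I = I and V = "\<lambda>s'. (cap - regs s' 24) * (20 * length xs + 40)"], goal_cases)
      case 1
      then show ?case using \<open>\<forall>r. r \<noteq> 23 \<longrightarrow> regs s1 r = regs s0 r\<close> \<open>\<forall>a. a < QB \<or> HD \<le> a \<longrightarrow> mem s1 a = mem s0 a\<close>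
          \<open>queue_in (mem s1) QB roots\<close> \<open>regs s1 23 = L\<close>
        by (auto simp: I_def BQ_def s0_def length_roots)
    next
      case (2 s2)
      define h where "h = regs s2 24"
      have I2: "h \<le> length (BQ h)" "\<And>r. r < 22 \<or> 29 < r \<Longrightarrow> regs s2 r = regs s r" "regs s2 22 = tau (length xs)"
        "\<And>a. a < QB \<or> HD \<le> a \<Longrightarrow> mem s2 a = mem s a" "queue_in (mem s2) QB (BQ h)" "regs s2 23 = length (BQ h)"
        using 2(1) by (auto simp: I_def h_def)
      have h: "h < length (BQ h)" using 2(2) I2 by (simp add: h_def)
      have p2: "params (regs s2)" using p by (rule params_cong) (auto simp: I2)
      have hc: "h < cap" using h lBQ[of h] by simp
      then have Vh: "(cap - h) * (20 * length xs + 40) = (cap - Suc h) * (20 * length xs + 40) + (20 * length xs + 40)"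
        by (simp add: Suc_diff_Suc[symmetric] del: Suc_diff_Suc)
      define q where "q = BQ h ! h"
      have gq: "good_node q" unfolding q_def using good_queue nth_mem[OF h] unfolding BQ_def by blast
      have BS: "BQ (Suc h) = (if is_leaf q then BQ h else take cap (BQ h @ kids w z (tau (length xs)) sd xs q))"
        using h lBQ[of h] by (simp add: BQ_def q_def children_def Let_def)
      have lS: "Suc h \<le> length (BQ (Suc h))" using h hc by (auto simp: BS)
      have h1: "h + 1 < 2 ^ w" using hc bounds Z2 by auto
      show ?case
      proof (rule wp_seq, rule wp_load_node[OF p2 I2(5)], fold h_def, goal_cases)
        case (3 s3)
        have r3: "\<And>r. r < 22 \<or> 29 < r \<Longrightarrow> regs s3 r = regs s r" "regs s3 22 = tau (length xs)" "regs s3 24 = h"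
          "regs s3 23 = length (BQ h)" "mem s3 = mem s2" "regs s3 25 = fst q" "regs s3 26 = snd q"
          using 3 I2 by (auto simp: q_def h_def)
        have p3: "params (regs s3)" using p by (rule params_cong) (auto simp: r3)
        have k3: "regs s3 5 = k" using p3 by (simp add: params_def)
        show ?case
        proof (rule wp_seq, rule wp_if, unfold eval_not_leaf[OF k3], goal_cases)
          case 1
          then have nl: "\<not> is_leaf q" by (simp add: is_leaf_def r3)
          have s3: "seeds_in (mem s3) sd" using sd I2(4) bounds unfolding seeds_in_def by (auto simp: r3)
          have f: "reads inp (regs s3 21) xs" "regs s3 20 = length xs" "regs s3 25 < L * Suc k" "regs s3 26 < Z"
            "queue_in (mem s3) QB (BQ h)"
            using rd r3 gq I2 by (auto simp: good_node_def h_def)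
          show ?case
          proof (rule wp_conseq[OF wp_expand_node[OF p3 s3 f r3(4) lBQ]], goal_cases)
            case (1 T4 s4)
            have r4: "\<And>r. r \<notin> {23, 27, 28, 29} \<Longrightarrow> regs s4 r = regs s3 r"
              "\<And>a. a < QB \<or> HD \<le> a \<Longrightarrow> mem s4 a = mem s a"
              "queue_in (mem s4) QB (BQ (Suc h))" "regs s4 23 = length (BQ (Suc h))" "T4 \<le> 20 * length xs + 10"
              using 1 r3 I2 BS nl by auto
            show ?case
              by (intro wp_assign) (use r3 r4 lS h1 w1 Vh in \<open>auto simp: I_def h_def[symmetric]\<close>)
          qed
        next
          case 2
          then have lf: "is_leaf q" by (simp add: is_leaf_def r3)
          show ?case unfolding skip_def
            by (intro wp_assign) (use r3 lS h1 w1 Vh I2 BS lf in \<open>auto simp: I_def h_def[symmetric]\<close>)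
        qed
      qed (use h lBQ in auto)
    next
      case (3 T s')
      have h: "length (BQ (regs s' 24)) \<le> regs s' 24" "regs s' 24 \<le> cap" using 3 lBQ[of "regs s' 24"] by (auto simp: I_def)
      then have "BQ cap = BQ (regs s' 24)" unfolding BQ_def by (intro bfs_stable)
      then have "queue sd xs = BQ (regs s' 24)" by (simp add: queue_def BQ_def)
      then show ?case using 3 \<open>T1 \<le> 20 * cap + 10\<close> by (auto simp: I_def algebra_simps)
    qed
  qed
qed

section \<open>Buckets and their chains\<close>

definition bucket :: "nat \<Rightarrow> nat \<Rightarrow> node \<Rightarrow> nat" where
  "bucket fa fc p = hash w z fa fc (snd p * Z + fst p) mod Mb"

text \<open>Entries are numbered from 1, and 0 ends a chain: \<open>prev es b e\<close> is the last entry of bucket \<open>b\<close> among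
  the first \<open>e\<close>.\<close>

fun prev :: "(nat \<times> nat) list \<Rightarrow> nat \<Rightarrow> nat \<Rightarrow> nat" where
  "prev es b 0 = 0"
| "prev es b (Suc e) = (if fst (es ! e) = b then Suc e else prev es b e)"

definition table_in :: "(nat \<Rightarrow> nat) \<Rightarrow> (nat \<Rightarrow> nat) \<Rightarrow> (nat \<times> nat) list \<Rightarrow> bool" where
  "table_in m ad es \<longleftrightarrow> (\<forall>e<length es. m (EN + 2 * Suc e) = ad (snd (es ! e)) \<and>
      m (EN + 2 * Suc e + 1) = prev es (fst (es ! e)) e) \<and>
    (\<forall>b<Mb. m (HD + b) = prev es b (length es))"

lemma prev_append: "e \<le> length es \<Longrightarrow> prev (es @ es') b e = prev es b e"
  by (induction e) (auto simp: nth_append)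

text \<open>A new entry goes to the front of its chain: its link is the former head, which is
  \<open>prev\<close> at the time of insertion and is not affected by later entries.\<close>

lemma table_in_push:
  assumes "table_in m ad es" "b < Mb"
  shows "table_in (m(EN + 2 * Suc (length es) := ad i, EN + 2 * Suc (length es) + 1 := m (HD + b), HD + b := Suc (length es)))
    ad (es @ [(b, i)])"
proof -
  have *: "HD + b' < EN" if "b' < Mb" for b' using that bounds by linarith
  show ?thesis using assms *
    by (auto simp: table_in_def nth_append less_Suc_eq prev_append dest: *)
qed

lemma table_in_cong:
  "table_in m ad es \<Longrightarrow> length es \<le> Mb \<Longrightarrow> (\<And>a. HD \<le> a \<Longrightarrow> a < SB \<Longrightarrow> m' a = m a) \<Longrightarrow> table_in m' ad es"
  using bounds(2,3) by (auto simp: table_in_def)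

end

definition bucket_of :: exp where
  "bucket_of = hash_of (Reg 10 -\<^sub>e Const 2) (Reg 10 -\<^sub>e Const 1) (Reg 26 *\<^sub>e Reg 1 +\<^sub>e Reg 25) mod\<^sub>e Reg 7"

definition insert_leaves :: com where
  "insert_leaves =
    (24 ::= Const 0) ;;
    While (Reg 24 <\<^sub>e Reg 23)
      (load_node ;;
       If (Reg 25 mod\<^sub>e (Reg 5 +\<^sub>e Const 1) <\<^sub>e Reg 5) skip
         ((28 ::= bucket_of) ;;
          (18 ::= Reg 18 +\<^sub>e Const 1) ;;
          Store (Reg 12 +\<^sub>e Const 2 *\<^sub>e Reg 18) (Reg 13 +\<^sub>e Reg 16) ;;
          Store (Reg 12 +\<^sub>e Const 2 *\<^sub>e Reg 18 +\<^sub>e Const 1) (Mem (Reg 11 +\<^sub>e Reg 28)) ;;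
          Store (Reg 11 +\<^sub>e Reg 28) (Reg 18)) ;;
       (24 ::= Reg 24 +\<^sub>e Const 1))"

context layout
begin

lemma Mb_pos: "Mb > 0" using n L by (simp add: Mb_def)

lemma bucket_less: "bucket fa fc p < Mb"
  using Mb_pos by (simp add: bucket_def)

lemma eval_bucket_of:
  assumes "params (regs s)" "good_node (regs s 25, regs s 26)"
  shows "eval w inp s bucket_of = bucket (mem s (QB - 2)) (mem s (QB - 1)) (regs s 25, regs s 26)"
proof -
  have "QB \<ge> 34" "QB < 2 ^ w" using bounds Z2 by auto
  then have 1: "eval w inp s (Reg 10 -\<^sub>e Const 2) = QB - 2" "eval w inp s (Reg 10 -\<^sub>e Const 1) = QB - 1"
    using assms(1) w1 Z2 Z_ge by (simp_all add: params_def mod_if)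
  have a: "regs s 26 < Z" "regs s 25 < Z" using assms(2) bounds by (auto simp: good_node_def)
  have "regs s 26 * Z + Z \<le> Z * Z" using a mult_right_mono[of "Suc (regs s 26)" Z Z] by simp
  then have 2: "eval w inp s (Reg 26 *\<^sub>e Reg 1 +\<^sub>e Reg 25) = regs s 26 * Z + regs s 25"
    using assms(1) Z2 a by (simp add: params_def)
  show ?thesis unfolding bucket_of_def using assms(1)
    by (simp only: eval.simps binop_val.simps) (subst eval_hash_of[where z = z], simp_all only: 1 2 params_def bucket_def fst_conv snd_conv)
qed

end

subsection \<open>Inserting the sets\<close>

text \<open>Input position \<open>p\<close> goes to address \<open>SB + p\<close>, so the pointer
  stored with a leaf is \<open>SB\<close> plus the position of the set. The extra word is the
  cardinality in front of the elements.\<close>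

definition copy_set :: com where
  "copy_set =
    (27 ::= Const 0) ;;
    While (Reg 27 <\<^sub>e Reg 20 +\<^sub>e Const 1)
      (Store (Reg 13 +\<^sub>e (Reg 16 +\<^sub>e Reg 27)) (Inp (Reg 16 +\<^sub>e Reg 27)) ;;
       (27 ::= Reg 27 +\<^sub>e Const 1))"

definition process_sets :: com where
  "process_sets =
    (16 ::= Const 4) ;; (17 ::= Const 0) ;; (18 ::= Const 0) ;;
    While (Reg 17 <\<^sub>e Reg 9)
      ((20 ::= Inp (Reg 16)) ;;
       (21 ::= Reg 16 +\<^sub>e Const 1) ;;
       copy_set ;; generate ;; insert_leaves ;;
       (16 ::= Reg 16 +\<^sub>e (Reg 20 +\<^sub>e Const 1)) ;;
       (17 ::= Reg 17 +\<^sub>e Const 1))"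

text \<open>Four header words precede the sets, and each set is preceded by its cardinality.\<close>

fun set_pos :: "nat list list \<Rightarrow> nat \<Rightarrow> nat" where
  "set_pos xss 0 = 4"
| "set_pos xss (Suc i) = set_pos xss i + Suc (length (xss ! i))"

context layout
begin

definition leaf_entries :: "nat \<Rightarrow> nat \<Rightarrow> nat \<Rightarrow> node list \<Rightarrow> (nat \<times> nat) list" where
  "leaf_entries fa fc i Q = map (\<lambda>p. (bucket fa fc p, i)) (filter is_leaf Q)"

lemma wp_insert_leaves:
  assumes p: "params (regs s)" and Q: "queue_in (mem s) QB Q" "regs s 23 = length Q" "length Q \<le> cap" "\<forall>q\<in>set Q. good_node q"
    and es: "table_in (mem s) ad es" "regs s 18 = length es" "length es + length Q \<le> Mb"
    and ad: "SB + regs s 16 = ad i" "regs s 16 \<le> N"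
    and f: "mem s (QB - 2) = fa" "mem s (QB - 1) = fc"
  shows "wp w inp insert_leaves (\<lambda>T s'.
      (\<forall>r. r \<notin> {18, 24, 25, 26, 28, 29} \<longrightarrow> regs s' r = regs s r) \<and>
      (\<forall>a. a < HD \<or> SB \<le> a \<longrightarrow> mem s' a = mem s a) \<and>
      table_in (mem s') ad (es @ leaf_entries fa fc i Q) \<and> regs s' 18 = length (es @ leaf_entries fa fc i Q)) s"
proof -
  define E where "E = (\<lambda>h. es @ leaf_entries fa fc i (take h Q))"
  note ps = p[unfolded params_def]
  define I where "I = (\<lambda>s' :: store. regs s' 24 \<le> length Q \<and>
      (\<forall>r. r \<notin> {18, 24, 25, 26, 28, 29} \<longrightarrow> regs s' r = regs s r) \<and>
      (\<forall>a. a < HD \<or> SB \<le> a \<longrightarrow> mem s' a = mem s a) \<and>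
      table_in (mem s') ad (E (regs s' 24)) \<and> regs s' 18 = length (E (regs s' 24)))"
  show ?thesis unfolding insert_leaves_def
  proof (rule wp_seq, rule wp_assign, rule wp_while_measure[where I = I and V = "\<lambda>s'. length Q - regs s' 24"], goal_cases)
    case 1
    then show ?case using es by (auto simp: I_def E_def leaf_entries_def)
  next
    case (2 s1)
    define h where "h = regs s1 24"
    have I1: "\<And>r. r \<notin> {18, 24, 25, 26, 28, 29} \<Longrightarrow> regs s1 r = regs s r"
      "\<And>a. a < HD \<or> SB \<le> a \<Longrightarrow> mem s1 a = mem s a" "table_in (mem s1) ad (E h)" "regs s1 18 = length (E h)"
      using 2(1) by (auto simp: I_def h_def)
    have h: "h < length Q" using 2(2) I1 Q by (simp add: h_def)
    have p1: "params (regs s1)" using p by (rule params_cong) (auto simp: I1)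
    have q1: "queue_in (mem s1) QB Q" using Q(1) by (rule queue_in_cong) (use I1 bounds Q in auto)
    have h1: "h + 1 < 2 ^ w" using h Q bounds Z2 by auto
    define q where "q = Q ! h"
    have gq: "good_node q" using Q h by (simp add: q_def)
    have ES: "E (Suc h) = (if is_leaf q then E h @ [(bucket fa fc q, i)] else E h)"
      using h by (simp add: E_def leaf_entries_def take_Suc_conv_app_nth q_def)
    have "length (filter is_leaf (take h Q)) \<le> h" using length_filter_le[of is_leaf "take h Q"] h by simp
    then have lE: "length (E h) < Mb" using es h by (simp add: E_def leaf_entries_def)
    show ?case
    proof (rule wp_seq, rule wp_load_node[OF p1 q1], fold h_def, goal_cases)
      case (3 s3)
      have r3: "\<And>r. r \<notin> {18, 24, 25, 26, 28, 29} \<Longrightarrow> regs s3 r = regs s r" "regs s3 24 = h"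
        "regs s3 18 = length (E h)" "mem s3 = mem s1" "regs s3 25 = fst q" "regs s3 26 = snd q"
        using 3 I1 by (auto simp: q_def h_def)
      have p3: "params (regs s3)" using p by (rule params_cong) (auto simp: r3)
      have k3: "regs s3 5 = k" using p3 by (simp add: params_def)
      show ?case
      proof (rule wp_seq, rule wp_if, unfold eval_not_leaf[OF k3], goal_cases)
        case 1
        then have nl: "\<not> is_leaf q" by (simp add: is_leaf_def r3)
        show ?case unfolding skip_def
          by (intro wp_assign) (use r3 h h1 w1 I1 ES nl in \<open>auto simp: I_def h_def[symmetric]\<close>)
      next
        case 2
        then have lf: "is_leaf q" by (simp add: is_leaf_def r3)
        define b where "b = bucket fa fc q"
        have bl: "b < Mb" by (simp add: b_def bucket_less)
        have "QB \<ge> 34" "QB \<le> HD" using bounds by auto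
        then have "QB - 2 < HD" "QB - 1 < HD" by auto
        then have "mem s1 (QB - 2) = fa" "mem s1 (QB - 1) = fc" using f I1(2) by blast+
        then have eb: "eval w inp s3 bucket_of = b"
          using eval_bucket_of[OF p3] gq r3 by (simp add: b_def)
        have ar: "EN + 2 * Suc (length (E h)) + 1 < SB" "SB < 2 ^ w" "SB + regs s 16 < 2 ^ w" "HD + b < EN" "2 < (2::nat) ^ w"
          "EN + (2 + 2 * length (E h)) < 2 ^ w" "length (E h) + 1 < 2 ^ w"  "2 * length (E h) + 2 < 2 ^ w" "HD + b < 2 ^ w"
          using lE bounds bl Z2 Z_ge ad by auto
        have r: "regs s3 12 = EN" "regs s3 13 = SB" "regs s3 11 = HD" "regs s3 16 = regs s 16" using r3(1) ps by auto
        have "table_in ((mem s1)(EN + 2 * Suc (length (E h)) := ad i, EN + 2 * Suc (length (E h)) + 1 := mem s1 (HD + b),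
            HD + b := Suc (length (E h)))) ad (E (Suc h))"
          using table_in_push[OF I1(3) bl, of i] lf by (simp add: ES b_def)
        then show ?case
          apply (intro wp_seq wp_assign wp_store)
          using r3 h h1 w1 I1 ES lf ar r ad eb bl bounds(2) by (auto simp: I_def h_def[symmetric] b_def[symmetric])
      qed
    qed (use h Q in auto)
  next
    case (3 T s')
    then show ?case using Q by (auto simp: I_def E_def)
  qed
qed

lemma wp_copy_set:
  assumes p: "params (regs s)" and b: "regs s 16 + regs s 20 < N" "length inp = N"
  shows "wp w inp copy_set (\<lambda>T s'.
      (\<forall>r. r \<noteq> 27 \<longrightarrow> regs s' r = regs s r) \<and>
      (\<forall>a. a < SB + regs s 16 \<or> SB + regs s 16 + regs s 20 < a \<longrightarrow> mem s' a = mem s a) \<and>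
      (\<forall>j. j \<le> regs s 20 \<longrightarrow> mem s' (SB + regs s 16 + j) = inp ! (regs s 16 + j))) s"
proof -
  define I where "I = (\<lambda>s' :: store. regs s' 27 \<le> Suc (regs s 20) \<and>
      (\<forall>r. r \<noteq> 27 \<longrightarrow> regs s' r = regs s r) \<and>
      (\<forall>a. a < SB + regs s 16 \<or> SB + regs s 16 + regs s 20 < a \<longrightarrow> mem s' a = mem s a) \<and>
      (\<forall>j < regs s' 27. mem s' (SB + regs s 16 + j) = inp ! (regs s 16 + j)))"
  have ar: "SB + N < 2 ^ w" "regs s 20 + 1 < 2 ^ w" "1 < (2::nat) ^ w" using bounds Z2 b Z_ge by auto
  show ?thesis unfolding copy_set_def
  proof (rule wp_seq, rule wp_assign, rule wp_while_measure[where I = I and V = "\<lambda>s'. Suc (regs s 20) - regs s' 27"], goal_cases)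
    case 1
    show ?case by (simp add: I_def)
  next
    case (2 s1)
    then show ?case
      apply (intro wp_seq wp_assign wp_store)
      using ar p b by (auto simp: I_def params_def Let_def less_Suc_eq)
  next
    case (3 T s')
    then show ?case using ar w1 by (auto simp: I_def less_Suc_eq_le)
  qed
qed

definition sets_in :: "nat list \<Rightarrow> nat list list \<Rightarrow> bool" where
  "sets_in inp xss \<longleftrightarrow> length xss = n \<and> length inp = N \<and> set_pos xss n = N \<and>
    (\<forall>i<n. inp ! set_pos xss i = length (xss ! i) \<and> reads inp (set_pos xss i + 1) (xss ! i))"

definition entries :: "nat list \<Rightarrow> nat \<Rightarrow> nat \<Rightarrow> nat list list \<Rightarrow> nat \<Rightarrow> (nat \<times> nat) list" where
  "entries sd fa fc xss i = concat (map (\<lambda>j. leaf_entries fa fc j (queue sd (xss ! j))) [0..<i])"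

lemma entries_Suc: "entries sd fa fc xss (Suc i) = entries sd fa fc xss i @ leaf_entries fa fc i (queue sd (xss ! i))"
  by (simp add: entries_def)

lemma length_entries: "length (entries sd fa fc xss i) \<le> i * cap"
proof (induction i)
  case (Suc i)
  have "length (leaf_entries fa fc i (queue sd (xss ! i))) \<le> cap"
    using le_trans[OF length_filter_le length_queue] by (simp add: leaf_entries_def)
  then show ?case using Suc by (simp add: entries_Suc)
qed (simp add: entries_def)

lemma set_pos_mono: "i \<le> j \<Longrightarrow> set_pos xss i \<le> set_pos xss j"
  by (induction j rule: dec_induct) auto

text \<open>Nothing is claimed about the queue region, which every later tree overwrites. The last
  conjunct becomes the space bound.\<close>

definition structure_in :: "(nat \<Rightarrow> nat) \<Rightarrow> nat list \<Rightarrow> nat \<Rightarrow> nat \<Rightarrow> nat list \<Rightarrow> nat list list \<Rightarrow> nat \<Rightarrow> bool" where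
  "structure_in m sd fa fc inp xss i \<longleftrightarrow> params m \<and> seeds_in m sd \<and> m (QB - 2) = fa \<and> m (QB - 1) = fc \<and>
    table_in m (\<lambda>j. SB + set_pos xss j) (entries sd fa fc xss i) \<and>
    (\<forall>p. 4 \<le> p \<and> p < set_pos xss i \<longrightarrow> m (SB + p) = inp ! p) \<and>
    (\<forall>a. SB + set_pos xss i \<le> a \<longrightarrow> m a = 0)"

lemma wp_process_sets:
  assumes p: "params (regs s)" "params (mem s)" and sd: "seeds_in (mem s) sd"
    and f: "mem s (QB - 2) = fa" "mem s (QB - 1) = fc"
    and zero: "\<forall>a\<ge>QB. mem s a = 0"
    and xss: "sets_in inp xss"
  shows "wp w inp process_sets (\<lambda>T s'. structure_in (mem s') sd fa fc inp xss n) s"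
proof -
  define ad where "ad = (\<lambda>j. SB + set_pos xss j)"
  define I where "I = (\<lambda>s' :: store. regs s' 17 \<le> n \<and> params (regs s') \<and> regs s' 16 = set_pos xss (regs s' 17) \<and>
      regs s' 18 = length (entries sd fa fc xss (regs s' 17)) \<and>
      structure_in (mem s') sd fa fc inp xss (regs s' 17))"
  have QB34: "QB \<ge> 34" "QB \<le> HD" "HD \<le> EN" "EN \<le> SB" "cap \<le> HD" using bounds by auto
  have c4: "4 < (2::nat) ^ w" "1 < (2::nat) ^ w" using Z2 Z_ge by auto
  show ?thesis unfolding process_sets_def
  proof (rule wp_seq, rule wp_assign, rule wp_seq, rule wp_assign, rule wp_seq, rule wp_assign,
      rule wp_while_measure[where I = I and V = "\<lambda>s'. n - regs s' 17"], goal_cases)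
    case 1
    have "table_in (mem s) (\<lambda>j. SB + set_pos xss j) []" using zero QB34 by (auto simp: table_in_def)
    moreover have "mem s a = 0" if "SB + 4 \<le> a" for a using zero that QB34 by auto
    moreover have "params ((regs s)(16 := 4, 17 := 0, 18 := 0))" using p(1) by (rule params_cong) auto
    ultimately show ?case using p sd f c4 by (auto simp: I_def structure_in_def entries_def)
  next
    case (2 s1)
    define i where "i = regs s1 17"
    have I1: "params (regs s1)" "regs s1 16 = set_pos xss i" "regs s1 18 = length (entries sd fa fc xss i)"
      "structure_in (mem s1) sd fa fc inp xss i"
      using 2(1) by (auto simp: I_def i_def)
    have i: "i < n" using 2(2) I1 by (simp add: i_def params_def)
    define xs where "xs = xss ! i"
    have px: "inp ! set_pos xss i = length xs" "reads inp (set_pos xss i + 1) xs" "length inp = N"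
      using xss i by (auto simp: sets_in_def xs_def)
    have pN: "set_pos xss i + Suc (length xs) \<le> N"
      using set_pos_mono[of "Suc i" n xss] i xss by (simp add: sets_in_def xs_def)
    have ar: "set_pos xss i + Suc (length xs) < 2 ^ w" "Suc (length xs) < 2 ^ w" "i + 1 < 2 ^ w" using pN bounds Z2 i by auto
    define s2 where "s2 = s1\<lparr>regs := (regs s1)(20 := length xs, 21 := set_pos xss i + 1)\<rparr>"
    have p2: "params (regs s2)" using I1(1) by (rule params_cong) (auto simp: s2_def)
    have e1: "eval w inp s1 (Inp (Reg 16)) = length xs" using I1 px pN by simp
    have e2: "eval w inp (s1\<lparr>regs := (regs s1)(20 := length xs)\<rparr>) (Reg 16 +\<^sub>e Const 1) = set_pos xss i + 1"
      using I1 ar c4 w1 by simp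
    have s2: "s1\<lparr>regs := (regs s1)(20 := length xs)\<rparr>\<lparr>regs := (regs (s1\<lparr>regs := (regs s1)(20 := length xs)\<rparr>))(21 := set_pos xss i + 1)\<rparr> = s2"
      by (simp add: s2_def)
    have lq: "length (entries sd fa fc xss i) + cap \<le> Mb"
      using length_entries[of sd fa fc xss i] mult_right_mono[of "Suc i" n cap] i by (simp add: Mb_def)
    have st1: "params (mem s1)" "seeds_in (mem s1) sd" "mem s1 (QB - 2) = fa" "mem s1 (QB - 1) = fc"
      "table_in (mem s1) ad (entries sd fa fc xss i)"
      "\<And>p. 4 \<le> p \<Longrightarrow> p < set_pos xss i \<Longrightarrow> mem s1 (SB + p) = inp ! p"
      "\<And>a. SB + set_pos xss i \<le> a \<Longrightarrow> mem s1 a = 0"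
      using I1(4) by (auto simp: structure_in_def ad_def)
    show ?case
    proof (rule wp_seq, rule wp_assign, unfold e1, rule wp_seq, rule wp_assign, unfold e2, unfold s2, rule wp_seq,
        rule wp_conseq[OF wp_copy_set[OF p2]], goal_cases)
      case (3 T3 s3)
      have r3: "\<And>r. r \<noteq> 27 \<Longrightarrow> regs s3 r = regs s2 r"
        "\<And>a. a < SB + set_pos xss i \<or> SB + set_pos xss i + length xs < a \<Longrightarrow> mem s3 a = mem s1 a"
        "\<And>j. j \<le> length xs \<Longrightarrow> mem s3 (SB + set_pos xss i + j) = inp ! (set_pos xss i + j)"
        using 3 I1 by (auto simp: s2_def)
      have p3: "params (regs s3)" using p2 by (rule params_cong) (auto simp: r3)
      have sd3: "seeds_in (mem s3) sd" using st1(2) bounds r3(2) by (auto simp: seeds_in_def)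
      have rd3: "reads inp (regs s3 21) xs" "regs s3 20 = length xs" using px by (auto simp: r3 s2_def)
      show ?case
      proof (rule wp_seq, rule wp_conseq[OF wp_generate[OF p3 sd3 rd3]], elim conjE, goal_cases)
        case (1 T4 s4)
        have r4: "\<And>r. r < 22 \<or> 29 < r \<Longrightarrow> regs s4 r = regs s3 r"
          "\<And>a. a < QB \<or> HD \<le> a \<Longrightarrow> mem s4 a = mem s3 a"
          "queue_in (mem s4) QB (queue sd xs)" "regs s4 23 = length (queue sd xs)"
          using 1 by auto
        have p4: "params (regs s4)" using p3 by (rule params_cong) (auto simp: r4)
        have t4: "table_in (mem s4) ad (entries sd fa fc xss i)"
          using st1(5) by (rule table_in_cong) (use lq r3 r4 in auto)
        have g4: "\<forall>q\<in>set (queue sd xs). good_node q" using good_queue by (auto simp: queue_def)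
        have m4: "mem s4 a = mem s1 a" if "a < QB" for a using that QB34 r4 r3 by auto
        have "mem s4 (QB - 2) = fa" "mem s4 (QB - 1) = fc" using m4 QB34 st1 by auto
        then have x4: "regs s4 18 = length (entries sd fa fc xss i)" "SB + regs s4 16 = ad i" "regs s4 16 \<le> N"
            "mem s4 (QB - 2) = fa" "mem s4 (QB - 1) = fc" "length (entries sd fa fc xss i) + length (queue sd xs) \<le> Mb"
          using I1 pN lq length_queue[of sd xs] by (auto simp: r4(1) r3(1) s2_def ad_def)
        show ?case
        proof (rule wp_seq, rule wp_conseq[OF wp_insert_leaves[OF p4 r4(3,4) length_queue g4 t4 x4(1) x4(6) x4(2-5)]], elim conjE, goal_cases)
          case (1 T5 s5)
          have r5: "\<And>r. r \<notin> {18, 24, 25, 26, 28, 29} \<Longrightarrow> regs s5 r = regs s4 r"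
            "\<And>a. a < HD \<or> SB \<le> a \<Longrightarrow> mem s5 a = mem s4 a"
            "table_in (mem s5) ad (entries sd fa fc xss (Suc i))" "regs s5 18 = length (entries sd fa fc xss (Suc i))"
            using 1 by (auto simp: entries_Suc xs_def)
          have m5: "mem s5 a = mem s1 a" if "a < QB" for a using that QB34 r5 r4 r3 by auto
          have "params (mem s5)" using st1(1) by (rule params_cong) (use m5 QB34 in auto)
          moreover have "seeds_in (mem s5) sd" using st1(2) bounds by (auto simp: seeds_in_def m5)
          moreover have "mem s5 (SB + p) = inp ! p" if "4 \<le> p" "p < set_pos xss (Suc i)" for p
          proof (cases "p < set_pos xss i")
            case True
            then show ?thesis using that st1 r5 r4 r3 QB34 by auto
          next
            case False
            define j where "j = p - set_pos xss i"
            have j: "p = set_pos xss i + j" "j \<le> length xs" using False that by (auto simp: j_def xs_def)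
            have "mem s5 (SB + p) = mem s3 (SB + set_pos xss i + j)" using r5(2) r4(2) QB34 j by (simp add: add.assoc)
            then show ?thesis using r3(3)[OF j(2)] j by simp
          qed
          moreover have "mem s5 a = 0" if "SB + set_pos xss (Suc i) \<le> a" for a
            using that r5 r4 r3 st1 QB34 by (auto simp: xs_def)
          moreover have "mem s5 (QB - 2) = fa" "mem s5 (QB - 1) = fc" using m5 QB34 st1 by auto
          moreover note r5(3)[unfolded ad_def]
          ultimately have st5: "structure_in (mem s5) sd fa fc inp xss (Suc i)"
            by (simp only: structure_in_def) blast
          have r: "regs s5 16 = set_pos xss i" "regs s5 20 = length xs" "regs s5 17 = i"
            using r5 r4 r3 I1 by (auto simp: s2_def i_def)
          have "params (regs s5)" using p4 by (rule params_cong) (auto simp: r5)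
          then have "params ((regs s5)(16 := set_pos xss (Suc i), 17 := Suc i))" by (rule params_cong) auto
          then show ?case
            by (intro wp_seq wp_assign)
              (use ar i c4 w1 r r5(4) st5 in \<open>simp add: I_def i_def[symmetric] xs_def[symmetric]\<close>)
        qed
      qed
    qed (use I1 pN px in \<open>auto simp: s2_def\<close>)
  next
    case (3 T s')
    then have "regs s' 17 = n" by (auto simp: I_def params_def)
    then show ?case using 3 by (simp add: I_def)
  qed
qed

end

subsection \<open>The query\<close>

text \<open>A merge step without branching: a pointer advances unless its element is the larger of
  the two.\<close>

definition merge_count :: com where
  "merge_count =
    (27 ::= Const 0) ;; (28 ::= Const 0) ;; (29 ::= Const 0) ;;
    While (Reg 27 <\<^sub>e Reg 19 \<and>\<^sub>e Reg 28 <\<^sub>e Reg 20)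
      ((30 ::= Mem (Reg 17 +\<^sub>e Const 1 +\<^sub>e Reg 27)) ;;
       (31 ::= Inp (Const 1 +\<^sub>e Reg 28)) ;;
       (29 ::= Reg 29 +\<^sub>e (Reg 30 =\<^sub>e Reg 31)) ;;
       (27 ::= Reg 27 +\<^sub>e Const 1 -\<^sub>e (Reg 31 <\<^sub>e Reg 30)) ;;
       (28 ::= Reg 28 +\<^sub>e Const 1 -\<^sub>e (Reg 30 <\<^sub>e Reg 31)))"

text \<open>When the budget of \<open>40 * cap\<close> candidates is spent, an empty chain (register
  18) and an empty queue (register 23) end the two enclosing loops.\<close>

definition advance :: com where
  "advance = If (Reg 16 <\<^sub>e Const 40 *\<^sub>e Reg 6)
     (18 ::= Mem (Reg 12 +\<^sub>e Const 2 *\<^sub>e Reg 18 +\<^sub>e Const 1))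
     ((18 ::= Const 0) ;; (23 ::= Const 0))"

text \<open>The first test rejects sets much larger than the query before the merge, which keeps the merge linear in
  the size of the query.\<close>

definition check_candidate :: com where
  "check_candidate =
    (16 ::= Reg 16 +\<^sub>e Const 1) ;;
    (17 ::= Mem (Reg 12 +\<^sub>e Const 2 *\<^sub>e Reg 18)) ;;
    (19 ::= Mem (Reg 17)) ;;
    If (Reg 4 *\<^sub>e Reg 19 <\<^sub>e Reg 20 *\<^sub>e Reg 1)
      (merge_count ;;
       If (Reg 4 *\<^sub>e Reg 19 <\<^sub>e Reg 29 *\<^sub>e Reg 1 \<and>\<^sub>e Reg 4 *\<^sub>e Reg 20 <\<^sub>e Reg 29 *\<^sub>e Reg 1)
         ((0 ::= Reg 17) ;; (23 ::= Const 0) ;; (18 ::= Const 0))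
         advance)
      advance"

definition scan_leaves :: com where
  "scan_leaves =
    (24 ::= Const 0) ;; (16 ::= Const 0) ;;
    While (Reg 24 <\<^sub>e Reg 23)
      (load_node ;;
       If (Reg 25 mod\<^sub>e (Reg 5 +\<^sub>e Const 1) <\<^sub>e Reg 5) skip
         ((28 ::= bucket_of) ;;
          (18 ::= Mem (Reg 11 +\<^sub>e Reg 28)) ;;
          While (Reg 18) check_candidate) ;;
       (24 ::= Reg 24 +\<^sub>e Const 1))"

lemma wp_seq_assign:
  assumes "eval w inp s e = v" "s' = s\<lparr>regs := (regs s)(r := v)\<rparr>" "wp w inp c (\<lambda>T. Q (Suc (1 + T))) s'"
  shows "wp w inp ((r ::= e) ;; c) Q s"
  using assms by (intro wp_seq wp_assign) simp

text \<open>The smaller of two heads of strictly sorted lists cannot occur in the other list, so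
  dropping it preserves the intersection.\<close>

lemma card_inter_merge:
  fixes x y :: nat
  assumes "sorted_wrt (<) (x # A)" "sorted_wrt (<) (y # B)"
  shows "card (set (x # A) \<inter> set (y # B)) =
    of_bool (x = y) + card (set (if y < x then x # A else A) \<inter> set (if x < y then y # B else B))"
proof (cases x y rule: linorder_cases)
  case less
  then have "x \<notin> set (y # B)" using assms by auto
  then show ?thesis using less by (simp add: Int_insert_left)
next
  case equal
  then have "set (x # A) \<inter> set (y # B) = insert x (set A \<inter> set B)" "x \<notin> set A" using assms by auto
  then show ?thesis using equal by simp
next
  case greater
  then have "y \<notin> set (x # A)" using assms by auto
  then show ?thesis using greater by (simp add: Int_insert_right)
qed

context layout
begin

lemma wp_merge_count:
  assumes rd: "reads inp 1 ys" "regs s 20 = length ys" and xs: "regs s 19 = length xs" "regs s 17 + Suc (length xs) \<le> Z"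
    "\<And>j. j < length xs \<Longrightarrow> mem s (regs s 17 + 1 + j) = xs ! j" and so: "sorted_wrt (<) xs" "sorted_wrt (<) ys"
  shows "wp w inp merge_count (\<lambda>T s'. T \<le> 20 * (length xs + length ys) + 20 \<and> mem s' = mem s \<and>
      (\<forall>r. r \<notin> {27, 28, 29, 30, 31} \<longrightarrow> regs s' r = regs s r) \<and>
      regs s' 29 = card (set xs \<inter> set ys)) s"
proof -
  \<comment> \<open>Matches counted so far plus matches still ahead stay constant.\<close>
  define I where "I = (\<lambda>s' :: store. mem s' = mem s \<and> regs s' 27 \<le> length xs \<and> regs s' 28 \<le> length ys \<and>
      (\<forall>r. r \<notin> {27, 28, 29, 30, 31} \<longrightarrow> regs s' r = regs s r) \<and>
      regs s' 29 + card (set (drop (regs s' 27) xs) \<inter> set (drop (regs s' 28) ys)) = card (set xs \<inter> set ys))"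
  have ly: "Suc (length ys) \<le> Z" "Suc (length ys) \<le> length inp" using rd by (auto simp: reads_def)
  have "card (set xs \<inter> set ys) \<le> card (set xs)" by (intro card_mono) auto
  also have "\<dots> \<le> length xs" by (rule card_length)
  finally have cx: "card (set xs \<inter> set ys) \<le> Z" using xs by simp
  show ?thesis unfolding merge_count_def
  proof (rule wp_seq, rule wp_assign, rule wp_seq, rule wp_assign, rule wp_seq, rule wp_assign,
      rule wp_while[where I = I and V = "\<lambda>s'. 20 * ((length xs - regs s' 27) + (length ys - regs s' 28))"], goal_cases)
    case 1
    show ?case by (simp add: I_def)
  next
    case (2 s1)
    define a b where "a = regs s1 27" and "b = regs s1 28"
    have I1: "mem s1 = mem s" "\<And>r. r \<notin> {27, 28, 29, 30, 31} \<Longrightarrow> regs s1 r = regs s r"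
      "regs s1 29 + card (set (drop a xs) \<inter> set (drop b ys)) = card (set xs \<inter> set ys)"
      using 2(1) by (auto simp: I_def a_def b_def)
    have ab: "a < length xs" "b < length ys" using 2(2) I1 rd xs by (auto simp: a_def b_def)
    have dx: "drop a xs = xs ! a # drop (Suc a) xs" "drop b ys = ys ! b # drop (Suc b) ys"
      using ab by (simp_all add: Cons_nth_drop_Suc)
    have "sorted_wrt (<) (drop a xs)" "sorted_wrt (<) (drop b ys)" using so by (simp_all add: sorted_wrt_drop)
    then have C: "card (set (drop a xs) \<inter> set (drop b ys)) = of_bool (xs ! a = ys ! b) +
        card (set (if ys ! b < xs ! a then drop a xs else drop (Suc a) xs) \<inter>
          set (if xs ! a < ys ! b then drop b ys else drop (Suc b) ys))"
      unfolding dx by (rule card_inter_merge)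
    have r: "regs s1 27 = a" "regs s1 28 = b" "regs s1 17 = regs s 17" using I1 by (auto simp: a_def b_def)
    have e: "inp ! (Suc b) = ys ! b" "Suc b < length inp" using rd ab ly by (auto simp: reads_def)
    have ex: "mem s (Suc (regs s 17 + a)) = xs ! a" using xs(3)[OF ab(1)] by simp
    have ar: "regs s 17 + 1 + a < 2 ^ w" "1 + b < 2 ^ w" "a + 1 < 2 ^ w" "b + 1 < 2 ^ w" "regs s 17 + 1 < 2 ^ w"
       using ab xs ly Z2 by auto
    have ar2: "regs s1 29 + 1 < 2 ^ w" using I1(3) cx Z2 Z_ge by auto
    show ?case
      apply (intro wp_seq wp_assign)
      using I1 r e ex ar ar2 w1 ab C
      by (cases "xs ! a" "ys ! b" rule: linorder_cases) (auto simp: I_def mod_if)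
  next
    case (3 T s')
    then have "drop (regs s' 27) xs = [] \<or> drop (regs s' 28) ys = []" using rd xs by (auto simp: I_def)
    then show ?case using 3 by (auto simp: I_def)
  qed
qed

section \<open>Walking along the chains of candidates\<close>

fun chain :: "(nat \<times> nat) list \<Rightarrow> nat \<Rightarrow> nat \<Rightarrow> nat list" where
  "chain es b 0 = []"
| "chain es b (Suc e) = (if fst (es ! e) = b then snd (es ! e) # chain es b e else chain es b e)"

text \<open>Following a link skips only entries of other buckets.\<close>

lemma chain_prev: "chain es b (prev es b e) = chain es b e"
  by (induction e) auto

lemma prev_le: "prev es b e \<le> e"
  by (induction e) (auto simp: le_SucI)

lemma prev_bucket: "prev es b e = Suc e' \<Longrightarrow> fst (es ! e') = b"
  by (induction e) (auto split: if_splits)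

lemma mset_chain: "e \<le> length es \<Longrightarrow> mset (chain es b e) = mset (map snd (filter (\<lambda>p. fst p = b) (take e es)))"
  by (induction e) (auto simp: take_Suc_conv_app_nth)

text \<open>Integer form of similarity above \<open>B2 / Z\<close>; the maximum in the denominator
  becomes two inequalities.\<close>

definition accept :: "nat list \<Rightarrow> nat list \<Rightarrow> bool" where
  "accept ys xs \<longleftrightarrow> B2 * length xs < card (set xs \<inter> set ys) * Z \<and> B2 * length ys < card (set xs \<inter> set ys) * Z"

definition ds_in :: "(nat \<Rightarrow> nat) \<Rightarrow> (nat \<Rightarrow> nat) \<Rightarrow> (nat \<times> nat) list \<Rightarrow> nat list list \<Rightarrow> bool" where
  "ds_in m ad es xss \<longleftrightarrow> table_in m ad es \<and> length es \<le> Mb \<and> (\<forall>e<length es. snd (es ! e) < n) \<and>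
    (\<forall>i<n. m (ad i) = length (xss ! i) \<and> (\<forall>j<length (xss ! i). m (ad i + 1 + j) = xss ! i ! j) \<and>
      ad i + Suc (length (xss ! i)) \<le> Z \<and> sorted_wrt (<) (xss ! i))"

text \<open>\<open>cB\<close> stands for a constant of at least \<open>Z / B2\<close>, about 1 / b2.
  A set that passes the size test has at most \<open>cB\<close> times as many elements as the query,
  which makes the merge linear in the latter.\<close>

lemma wp_check_candidate:
  assumes p: "params (regs s)" and ds: "ds_in (mem s) ad es xss"
    and rd: "reads inp 1 ys" "regs s 20 = length ys" "sorted_wrt (<) ys"
    and e: "regs s 18 = Suc e" "e < length es" and c: "regs s 16 < 40 * cap"
    and cB: "Z \<le> cB * B2"
  shows "wp w inp check_candidate (\<lambda>T s'. T \<le> 20 * (cB + 1) * length ys + 60 \<and> mem s' = mem s \<and>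
      (\<forall>r. r \<notin> {0, 16, 17, 18, 19, 23, 27, 28, 29, 30, 31} \<longrightarrow> regs s' r = regs s r) \<and>
      regs s' 16 = Suc (regs s 16) \<and>
      (if accept ys (xss ! snd (es ! e)) then regs s' 0 = ad (snd (es ! e)) \<and> regs s' 23 = 0 \<and> regs s' 18 = 0
       else if Suc (regs s 16) < 40 * cap then regs s' 18 = prev es (fst (es ! e)) e \<and> regs s' 23 = regs s 23
       else regs s' 18 = 0 \<and> regs s' 23 = 0)) s"
proof -
  define i where "i = snd (es ! e)"
  define xs where "xs = xss ! i"
  note ps = p[unfolded params_def]
  have i: "i < n" using ds e by (simp add: ds_in_def i_def)
  have ad: "mem s (ad i) = length xs" "\<And>j. j < length xs \<Longrightarrow> mem s (ad i + 1 + j) = xs ! j"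
    "ad i + Suc (length xs) \<le> Z" "sorted_wrt (<) xs"
    using ds i by (auto simp: ds_in_def xs_def)
  have me: "mem s (EN + 2 * Suc e) = ad i" "mem s (EN + 2 * Suc e + 1) = prev es (fst (es ! e)) e"
    using ds e by (auto simp: ds_in_def table_in_def i_def)
  have eM: "e < Mb" using ds e by (simp add: ds_in_def)
  have ar: "EN + 2 * Suc e + 1 < 2 ^ w" "2 * Suc e < 2 ^ w" "2 < (2::nat) ^ w" "1 < (2::nat) ^ w" "40 < (2::nat) ^ w" "40 * cap < 2 ^ w"
    "regs s 16 + 1 < 2 ^ w"
    using eM bounds Z2 Z_ge c by auto
  have ly: "length ys \<le> Z" using rd by (auto simp: reads_def)
  have lx: "length xs \<le> Z" using ad by simp
  have cy: "card (set xs \<inter> set ys) \<le> length ys"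
    using card_mono[of "set ys" "set xs \<inter> set ys"] card_length[of ys] by auto
  have pr: "B2 * length xs < 2 ^ w" "B2 * length ys < 2 ^ w" "length ys * Z < 2 ^ w" "card (set xs \<inter> set ys) * Z < 2 ^ w"
  proof -
    have "Z * Z < 2 ^ w" using Z2 by linarith
    moreover have "B2 * length xs \<le> Z * Z" "B2 * length ys \<le> Z * Z" using B2 lx ly by (auto intro!: mult_mono simp: Z_def)
    moreover have "length ys * Z \<le> Z * Z" "card (set xs \<inter> set ys) * Z \<le> Z * Z" using ly cy by auto
    ultimately show "B2 * length xs < 2 ^ w" "B2 * length ys < 2 ^ w" "length ys * Z < 2 ^ w" "card (set xs \<inter> set ys) * Z < 2 ^ w"
      by linarith+
  qed
  define s1 where "s1 = s\<lparr>regs := (regs s)(16 := Suc (regs s 16), 17 := ad i, 19 := length xs)\<rparr>"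
  define Post where "Post = (\<lambda>T (s' :: store). T \<le> 20 * (cB + 1) * length ys + 60 \<and> mem s' = mem s \<and>
      (\<forall>r. r \<notin> {0, 16, 17, 18, 19, 23, 27, 28, 29, 30, 31} \<longrightarrow> regs s' r = regs s r) \<and>
      regs s' 16 = Suc (regs s 16) \<and>
      (if accept ys xs then regs s' 0 = ad i \<and> regs s' 23 = 0 \<and> regs s' 18 = 0
       else if Suc (regs s 16) < 40 * cap then regs s' 18 = prev es (fst (es ! e)) e \<and> regs s' 23 = regs s 23
       else regs s' 18 = 0 \<and> regs s' 23 = 0))"
  have adv: "wp w inp advance (\<lambda>T s'. Post (T + T0) s') s2"
    if s2: "mem s2 = mem s" "\<And>r. r \<notin> {27, 28, 29, 30, 31} \<Longrightarrow> regs s2 r = regs s1 r"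
      and na: "\<not> accept ys xs" and T0: "T0 \<le> 20 * (cB + 1) * length ys + 50" for s2 T0
  proof -
    have r: "regs s2 16 = Suc (regs s 16)" "regs s2 6 = cap" "regs s2 12 = EN" "regs s2 18 = Suc e" "regs s2 23 = regs s 23"
      using s2 ps e by (auto simp: s1_def)
    have fr: "regs s2 r = regs s r" if "r \<notin> {0, 16, 17, 18, 19, 23, 27, 28, 29, 30, 31}" for r
      using s2 that by (auto simp: s1_def)
    show ?thesis unfolding advance_def
      by (intro wp_if wp_seq wp_assign)
        (use r fr me ar w1 na T0 s2 in \<open>auto simp: Post_def\<close>)
  qed
  have acc: "accept ys xs \<Longrightarrow> B2 * length xs < length ys * Z"
    unfolding accept_def using mult_right_mono[OF cy, of Z] by linarith
  have "wp w inp check_candidate Post s" unfolding check_candidate_def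
  proof -
    define sa where "sa = s\<lparr>regs := (regs s)(16 := Suc (regs s 16))\<rparr>"
    define sb where "sb = sa\<lparr>regs := (regs sa)(17 := ad i)\<rparr>"
    have ea: "eval w inp s (Reg 16 +\<^sub>e Const 1) = Suc (regs s 16)" using ar w1 by simp
    have eb: "eval w inp sa (Mem (Reg 12 +\<^sub>e Const 2 *\<^sub>e Reg 18)) = ad i" using ar ps e me by (simp add: sa_def)
    have ec: "eval w inp sb (Mem (Reg 17)) = length xs" using ad by (simp add: sa_def sb_def)
    have s1: "s1 = sb\<lparr>regs := (regs sb)(19 := length xs)\<rparr>" by (simp add: s1_def sa_def sb_def)
    have r1: "regs s1 4 = B2" "regs s1 20 = length ys" "regs s1 1 = Z" "regs s1 19 = length xs" "regs s1 17 = ad i"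
      using ps rd by (auto simp: s1_def)
    have main: "wp w inp (If (Reg 4 *\<^sub>e Reg 19 <\<^sub>e Reg 20 *\<^sub>e Reg 1)
      (merge_count ;;
       If (Reg 4 *\<^sub>e Reg 19 <\<^sub>e Reg 29 *\<^sub>e Reg 1 \<and>\<^sub>e Reg 4 *\<^sub>e Reg 20 <\<^sub>e Reg 29 *\<^sub>e Reg 1)
         ((0 ::= Reg 17) ;; (23 ::= Const 0) ;; (18 ::= Const 0))
         advance)
      advance) (\<lambda>T s'. Post (Suc (1 + Suc (1 + Suc (1 + T)))) s') s1"
    proof (rule wp_if, goal_cases)
      case 1
      then have lt: "B2 * length xs < length ys * Z" using r1 pr by simp
      have "B2 * length xs < length ys * (cB * B2)"
        using lt mult_left_mono[OF cB, of "length ys"] by linarith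
      also have "\<dots> = B2 * (cB * length ys)" by simp
      finally have "B2 * length xs < B2 * (cB * length ys)" .
      then have lxy: "length xs \<le> cB * length ys" by simp
      have f: "regs s1 17 + Suc (length xs) \<le> Z" "\<And>j. j < length xs \<Longrightarrow> mem s1 (regs s1 17 + 1 + j) = xs ! j"
        using ad r1 by (auto simp: s1_def)
      show ?case
      proof (rule wp_seq, rule wp_conseq[OF wp_merge_count[OF rd(1) r1(2,4) f ad(4) rd(3)]], goal_cases)
        case (2 T2 s2)
        have r2: "mem s2 = mem s" "\<And>r. r \<notin> {27, 28, 29, 30, 31} \<Longrightarrow> regs s2 r = regs s1 r"
          "regs s2 29 = card (set xs \<inter> set ys)" "T2 \<le> 20 * (length xs + length ys) + 20"
          using 2 by (auto simp: s1_def)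
        have T2: "T2 \<le> 20 * (cB + 1) * length ys + 20" using r2(4) lxy by (simp add: algebra_simps)
        have ev: "eval w inp s2 (Reg 4 *\<^sub>e Reg 19 <\<^sub>e Reg 29 *\<^sub>e Reg 1 \<and>\<^sub>e Reg 4 *\<^sub>e Reg 20 <\<^sub>e Reg 29 *\<^sub>e Reg 1) =
          of_bool (accept ys xs)"
          using r2 r1 pr by (simp add: accept_def)
        show ?case
        proof (rule wp_if, unfold ev, goal_cases)
          case 1
          then have "accept ys xs" by simp
          moreover have "regs s2 r = regs s r" if "r \<notin> {0, 16, 17, 18, 19, 23, 27, 28, 29, 30, 31}" for r
            using r2 that by (auto simp: s1_def)
          moreover have "regs s2 16 = Suc (regs s 16)" "regs s2 17 = ad i" using r2 by (auto simp: s1_def)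
          ultimately show ?case
            by (intro wp_seq wp_assign) (use r2 T2 in \<open>auto simp: Post_def\<close>)
        next
          case 2
          then have na: "\<not> accept ys xs" by simp
          have T3: "T2 + 9 \<le> 20 * (cB + 1) * length ys + 50" using T2 by simp
          show ?case
            by (rule wp_conseq[OF adv[OF r2(1,2) na T3]]) (auto elim!: back_subst[where P = "\<lambda>x. Post x _"])
        qed
      qed (simp add: s1_def)
    next
      case 2
      then have "\<not> B2 * length xs < length ys * Z" using r1 pr by simp
      then have na: "\<not> accept ys xs" using acc by blast
      have m1: "mem s1 = mem s" by (simp add: s1_def)
      have T7: "7 \<le> 20 * (cB + 1) * length ys + 50" by simp
      show ?case
        by (rule wp_conseq[OF adv[OF m1 refl na T7]]) (auto elim!: back_subst[where P = "\<lambda>x. Post x _"])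
    qed
    show "wp w inp ((16 ::= Reg 16 +\<^sub>e Const 1) ;; (17 ::= Mem (Reg 12 +\<^sub>e Const 2 *\<^sub>e Reg 18)) ;; (19 ::= Mem (Reg 17)) ;;
        If (Reg 4 *\<^sub>e Reg 19 <\<^sub>e Reg 20 *\<^sub>e Reg 1)
          (merge_count ;;
           If (Reg 4 *\<^sub>e Reg 19 <\<^sub>e Reg 29 *\<^sub>e Reg 1 \<and>\<^sub>e Reg 4 *\<^sub>e Reg 20 <\<^sub>e Reg 29 *\<^sub>e Reg 1)
             ((0 ::= Reg 17) ;; (23 ::= Const 0) ;; (18 ::= Const 0))
             advance)
          advance) Post s"
      by (rule wp_seq_assign[OF ea sa_def], rule wp_seq_assign[OF eb sb_def], rule wp_seq_assign[OF ec s1], rule main)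
  qed
  then show ?thesis unfolding Post_def xs_def i_def .
qed

abbreviation (input) "candidate_regs \<equiv> {0, 16, 17, 18, 19, 23, 27, 28, 29, 30, 31 :: nat}"

text \<open>Checks are paid from the budget \<open>40 * cap - regs s 16\<close> of the whole query
  rather than per chain, so chains of any length add up. The three outcomes are a chain exhausted
  without success, a hit, and a budget spent on rejected candidates only.\<close>

lemma wp_scan_chain:
  assumes p: "params (regs s)" and ds: "ds_in (mem s) ad es xss"
    and rd: "reads inp 1 ys" "regs s 20 = length ys" "sorted_wrt (<) ys"
    and e: "regs s 18 = prev es b (length es)" and c: "regs s 16 < 40 * cap"
    and cB: "Z \<le> cB * B2" and ct: "ct = 20 * (cB + 1) * length ys + 61"
    and cs: "cs = chain es b (length es)"
  shows "wp w inp (While (Reg 18) check_candidate) (\<lambda>T s'. T + ct * (40 * cap - regs s' 16) \<le> ct * (40 * cap - regs s 16) + 1 \<and>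
      mem s' = mem s \<and> (\<forall>r. r \<notin> candidate_regs \<longrightarrow> regs s' r = regs s r) \<and>
      ((regs s' 23 = regs s 23 \<and> regs s' 16 = regs s 16 + length cs \<and> regs s' 16 < 40 * cap \<and> (\<forall>i\<in>set cs. \<not> accept ys (xss ! i))) \<or>
       (regs s' 23 = 0 \<and> (\<exists>i\<in>set cs. accept ys (xss ! i) \<and> regs s' 0 = ad i)) \<or>
       (regs s' 23 = 0 \<and> (\<forall>i\<in>set (take (40 * cap - regs s 16) cs). \<not> accept ys (xss ! i)) \<and> 40 * cap \<le> regs s 16 + length cs))) s"
proof -
  define dead where "dead = (\<lambda>s' :: store. regs s' 23 = 0 \<and> regs s' 18 = 0 \<and> ((\<exists>i\<in>set cs. accept ys (xss ! i) \<and> regs s' 0 = ad i) \<or>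
      ((\<forall>i\<in>set (take (40 * cap - regs s 16) cs). \<not> accept ys (xss ! i)) \<and> 40 * cap \<le> regs s 16 + length cs)))"
  define alive where "alive = (\<lambda>s' :: store. regs s' 23 = regs s 23 \<and> regs s' 18 \<le> length es \<and>
      (\<forall>e'. regs s' 18 = Suc e' \<longrightarrow> fst (es ! e') = b) \<and>
      (\<exists>done. cs = done @ chain es b (regs s' 18) \<and> regs s' 16 = regs s 16 + length done \<and>
        (\<forall>i\<in>set done. \<not> accept ys (xss ! i))) \<and> regs s' 16 < 40 * cap)"
  define I where "I = (\<lambda>s' :: store. mem s' = mem s \<and> (\<forall>r. r \<notin> candidate_regs \<longrightarrow> regs s' r = regs s r) \<and>
      regs s 16 \<le> regs s' 16 \<and> (alive s' \<or> dead s'))"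
  have alive_s: "alive s"
    using e c prev_le[of es b "length es"] prev_bucket[of es b "length es"]
    by (auto simp: alive_def cs chain_prev intro!: exI[of _ "[]"])
  have inv: "wp w inp (While (Reg 18) check_candidate) (\<lambda>T s'. I s' \<and> regs s' 18 = 0 \<and>
      T + ct * (40 * cap - regs s' 16) \<le> ct * (40 * cap - regs s 16) + 1) s"
  proof -
    have stp: "wp w inp check_candidate (\<lambda>T s'. I s' \<and> Suc T + ct * (40 * cap - regs s' 16) \<le> ct * (40 * cap - regs s1 16)) s1"
      if I1: "I s1" and nz: "regs s1 18 \<noteq> 0" for s1
    proof -
      have al: "alive s1" using I1 nz by (auto simp: I_def dead_def)
      obtain e where e1: "regs s1 18 = Suc e" using nz by (cases "regs s1 18") auto
      have eb: "fst (es ! e) = b" "e < length es" using al e1 by (auto simp: alive_def)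
      obtain don where don: "cs = don @ chain es b (Suc e)" "regs s1 16 = regs s 16 + length don"
          "\<forall>i\<in>set don. \<not> accept ys (xss ! i)" "regs s1 16 < 40 * cap" "regs s1 23 = regs s 23"
        using al e1 by (auto simp: alive_def)
      define i where "i = snd (es ! e)"
      have cs1: "cs = don @ i # chain es b (prev es b e)" using don(1) eb by (simp add: i_def chain_prev)
      have fr: "mem s1 = mem s" "\<And>r. r \<notin> candidate_regs \<Longrightarrow> regs s1 r = regs s r" using I1 by (auto simp: I_def)
      have p1: "params (regs s1)" using p by (rule params_cong) (auto simp: fr)
      have ds1: "ds_in (mem s1) ad es xss" using ds fr by simp
      have y1: "regs s1 20 = length ys" using rd fr by simp
      have V: "ct * (40 * cap - regs s1 16) = ct * (40 * cap - Suc (regs s1 16)) + ct"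
        using don(4) by (simp add: Suc_diff_Suc[symmetric] del: Suc_diff_Suc)
      show ?thesis
      proof (rule wp_conseq[OF wp_check_candidate[OF p1 ds1 rd(1) y1 rd(3) e1 eb(2) don(4) cB]], elim conjE, goal_cases)
        case (1 T s2)
        have fr2: "mem s2 = mem s" "\<And>r. r \<notin> candidate_regs \<Longrightarrow> regs s2 r = regs s r" "regs s2 16 = Suc (regs s1 16)"
          using 1 fr by auto
        have "alive s2 \<or> dead s2"
        proof (cases "accept ys (xss ! i)")
          case True
          then have "dead s2" using 1 cs1 by (auto simp: dead_def i_def)
          then show ?thesis ..
        next
          case na: False
          show ?thesis
          proof (cases "Suc (regs s1 16) < 40 * cap")
            case True
            have "regs s2 18 = prev es b e" "regs s2 23 = regs s 23" using 1 na True eb don by (auto simp: i_def)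
            moreover have "cs = (don @ [i]) @ chain es b (prev es b e)" using cs1 by simp
            ultimately have "alive s2" unfolding alive_def
              using True fr2 don na prev_le[of es b e] prev_bucket[of es b e] eb
              by (auto intro!: exI[of _ "don @ [i]"])
            then show ?thesis ..
          next
            case False
            \<comment> \<open>The budget ends with this candidate, so what has been checked is
              exactly the truncated list.\<close>
            then have "40 * cap - regs s 16 = Suc (length don)" using don by simp
            then have "take (40 * cap - regs s 16) cs = don @ [i]" using cs1 by simp
            then have "dead s2" using 1 na False don cs1 by (auto simp: dead_def i_def)
            then show ?thesis ..
          qed
        qed
        then show ?case using fr2 don 1 V by (auto simp: I_def ct)
      qed
    qed
    show ?thesis
      by (rule wp_while[where I = I and V = "\<lambda>s'. ct * (40 * cap - regs s' 16)"])
        (use alive_s stp in \<open>auto simp: I_def\<close>)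
  qed
  show ?thesis
    by (rule wp_conseq[OF inv]) (auto simp: I_def alive_def dead_def)
qed

end

fun load_upto :: "nat \<Rightarrow> com" where
  "load_upto 0 = skip"
| "load_upto (Suc r) = load_upto r ;; (Suc r ::= Mem (Const (Suc r)))"

fun store_upto :: "nat \<Rightarrow> com" where
  "store_upto 0 = skip"
| "store_upto (Suc r) = store_upto r ;; Store (Const (Suc r)) (Reg (Suc r))"

definition query_prog :: com where
  "query_prog = load_upto 13 ;; (20 ::= Inp (Const 0)) ;; (21 ::= Const 1) ;; generate ;; scan_leaves"

lemma wp_load_upto:
  "r < 2 ^ w \<Longrightarrow> wp w inp (load_upto r) (\<lambda>T s'. T \<le> 2 * r + 1 \<and> mem s' = mem s \<and>
    (\<forall>j. 1 \<le> j \<and> j \<le> r \<longrightarrow> regs s' j = mem s j)) s"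
proof (induction r)
  case 0
  show ?case by (auto simp: skip_def intro!: wp_assign)
next
  case (Suc r)
  show ?case unfolding load_upto.simps
    by (rule wp_seq, rule wp_conseq[OF Suc.IH])
      (use Suc.prems in \<open>auto intro!: wp_assign simp: le_Suc_eq\<close>)
qed

lemma wp_store_upto:
  "r < 2 ^ w \<Longrightarrow> r < 29 \<Longrightarrow> wp w inp (store_upto r) (\<lambda>T s'.
    (\<forall>j. j \<noteq> 29 \<longrightarrow> regs s' j = regs s j) \<and>
    (\<forall>j. mem s' j = (if 1 \<le> j \<and> j \<le> r then regs s j else mem s j))) s"
proof (induction r)
  case 0
  show ?case by (auto simp: skip_def intro!: wp_assign)
next
  case (Suc r)
  show ?case unfolding store_upto.simps
    by (rule wp_seq, rule wp_conseq[OF Suc.IH])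
      (use Suc.prems in \<open>auto intro!: wp_store simp: le_Suc_eq\<close>)
qed

context layout
begin

definition candidates :: "(nat \<times> nat) list \<Rightarrow> nat \<Rightarrow> nat \<Rightarrow> node list \<Rightarrow> nat list" where
  "candidates es fa fc Q = concat (map (\<lambda>p. if is_leaf p then chain es (bucket fa fc p) (length es) else []) Q)"

lemma candidates_append: "candidates es fa fc (A @ B) = candidates es fa fc A @ candidates es fa fc B"
  by (simp add: candidates_def)

text \<open>A scan without a hit has rejected at least the first \<open>40 * cap\<close> candidates.
  An acceptable one among these therefore guarantees success, and this event is recorded by
  \<open>finds\<close>.\<close>

lemma wp_scan_leaves:
  assumes p: "params (regs s)" and ds: "ds_in (mem s) ad es xss"
    and rd: "reads inp 1 ys" "regs s 20 = length ys" "sorted_wrt (<) ys"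
    and Q: "queue_in (mem s) QB Q" "regs s 23 = length Q" "length Q \<le> cap" "\<forall>q\<in>set Q. good_node q"
    and f: "mem s (QB - 2) = fa" "mem s (QB - 1) = fc"
    and cB: "Z \<le> cB * B2" and ct: "ct = 20 * (cB + 1) * length ys + 61"
    and C: "C = candidates es fa fc Q"
  shows "wp w inp scan_leaves (\<lambda>T s'. T \<le> ct * (40 * cap) + 40 * cap + 10 \<and> mem s' = mem s \<and>
      ((\<exists>i\<in>set C. accept ys (xss ! i) \<and> regs s' 0 = ad i) \<or> (\<forall>i\<in>set (take (40 * cap) C). \<not> accept ys (xss ! i)))) s"
proof -
  note ps = p[unfolded params_def]
  define CL where "CL = (\<lambda>h. candidates es fa fc (take h Q))"
  define fin where "fin = (\<lambda>s' :: store. (\<exists>i\<in>set C. accept ys (xss ! i) \<and> regs s' 0 = ad i) \<or>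
    (\<forall>i\<in>set (take (40 * cap) C). \<not> accept ys (xss ! i)))"
  define alive where "alive = (\<lambda>s' :: store. regs s' 23 = length Q \<and> regs s' 16 = length (CL (regs s' 24)) \<and>
    regs s' 16 < 40 * cap \<and> (\<forall>i\<in>set (CL (regs s' 24)). \<not> accept ys (xss ! i)))"
  define frame where "frame = {0, 16, 17, 18, 19, 23, 24, 25, 26, 27, 28, 29, 30, 31 :: nat}"
  define I where "I = (\<lambda>s' :: store. mem s' = mem s \<and> (\<forall>r. r \<notin> frame \<longrightarrow> regs s' r = regs s r) \<and>
    regs s' 24 \<le> length Q \<and> (alive s' \<or> (regs s' 23 = 0 \<and> fin s')))"
  have capp: "0 < cap" using L by simp
  show ?thesis unfolding scan_leaves_def
  proof (rule wp_seq, rule wp_assign, rule wp_seq, rule wp_assign,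
      rule wp_while[where I = I and V = "\<lambda>s'. ct * (40 * cap - regs s' 16) + 40 * (length Q - regs s' 24)"], goal_cases)
    case 1
    show ?case using Q capp by (auto simp: I_def alive_def CL_def candidates_def frame_def)
  next
    case (2 s1)
    define h where "h = regs s1 24"
    have fr1: "mem s1 = mem s" "\<And>r. r \<notin> frame \<Longrightarrow> regs s1 r = regs s r" using 2(1) by (auto simp: I_def)
    have al: "alive s1" using 2 by (auto simp: I_def)
    have h: "h < length Q" using al 2(2) by (simp add: alive_def h_def)
    have p1: "params (regs s1)" using p by (rule params_cong) (auto simp: fr1 frame_def)
    have q1: "queue_in (mem s1) QB Q" using Q fr1 by simp
    have h1: "h + 1 < 2 ^ w" using h Q bounds Z2 by auto
    define q where "q = Q ! h"
    define cs where "cs = (if is_leaf q then chain es (bucket fa fc q) (length es) else [])"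
    have CS: "CL (Suc h) = CL h @ cs" using h by (simp add: CL_def candidates_def take_Suc_conv_app_nth q_def cs_def)
    have "C = CL (Suc h) @ candidates es fa fc (drop (Suc h) Q)"
      unfolding CL_def C candidates_append[symmetric] by simp
    then have CC: "C = (CL h @ cs) @ candidates es fa fc (drop (Suc h) Q)" by (simp only: CS)
    have gq: "good_node q" using Q h by (simp add: q_def)
    have al1: "regs s1 16 = length (CL h)" "regs s1 16 < 40 * cap" "\<forall>i\<in>set (CL h). \<not> accept ys (xss ! i)" "regs s1 23 = length Q"
      using al by (auto simp: alive_def h_def)
    have Vh: "40 * (length Q - h) = 40 * (length Q - Suc h) + 40" using h by simp
    show ?case
    proof (rule wp_seq, rule wp_load_node[OF p1 q1], fold h_def, goal_cases)
      case (3 s3)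
      have r3: "\<And>r. r \<noteq> 25 \<Longrightarrow> r \<noteq> 26 \<Longrightarrow> regs s3 r = regs s1 r" "mem s3 = mem s" "regs s3 25 = fst q" "regs s3 26 = snd q"
        using 3 fr1 by (auto simp: q_def h_def)
      have p3: "params (regs s3)" using p1 by (rule params_cong) (auto simp: r3)
      have k3: "regs s3 5 = k" using p3 by (simp add: params_def)
      show ?case
      proof (rule wp_seq, rule wp_if, unfold eval_not_leaf[OF k3], goal_cases)
        case 1
        then have "\<not> is_leaf q" by (simp add: is_leaf_def r3)
        then have "CL (Suc h) = CL h" using CS by (simp add: cs_def)
        then show ?case unfolding skip_def
          by (intro wp_assign) (use r3 fr1 al1 h h1 w1 Vh in \<open>auto simp: I_def alive_def h_def[symmetric] frame_def\<close>)
      next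
        case 2
        then have lf: "is_leaf q" by (simp add: is_leaf_def r3)
        define b where "b = bucket fa fc q"
        have bl: "b < Mb" by (simp add: b_def bucket_less)
        have cs: "cs = chain es b (length es)" using lf by (simp add: cs_def b_def)
        have eb: "eval w inp s3 bucket_of = b"
          using eval_bucket_of[OF p3] gq r3 f by (simp add: b_def)
        define s4 where "s4 = s3\<lparr>regs := (regs s3)(28 := b)\<rparr>"
        define s5 where "s5 = s4\<lparr>regs := (regs s4)(18 := prev es b (length es))\<rparr>"
        have "HD + b < 2 ^ w" using bl bounds Z2 by auto
        then have e5: "eval w inp s4 (Mem (Reg 11 +\<^sub>e Reg 28)) = prev es b (length es)"
          using p3 ds bl r3 by (simp add: s4_def params_def ds_in_def table_in_def)
        have p5: "params (regs s5)" using p3 by (rule params_cong) (auto simp: s4_def s5_def)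
        have r5: "mem s5 = mem s" "\<And>r. r \<notin> {18, 25, 26, 28} \<Longrightarrow> regs s5 r = regs s1 r" "regs s5 18 = prev es b (length es)"
          by (auto simp: s4_def s5_def r3)
        have x5: "ds_in (mem s5) ad es xss" "regs s5 20 = length ys" "regs s5 16 < 40 * cap"
          using ds rd al1 fr1 by (auto simp: r5 frame_def)
        show ?case
        proof (rule wp_seq_assign[OF eb s4_def], rule wp_seq_assign[OF e5 s5_def],
            rule wp_conseq[OF wp_scan_chain[OF p5 x5(1) rd(1) x5(2) rd(3) r5(3) x5(3) cB ct cs]], elim conjE, goal_cases)
          case (1 T6 s6)
          have r6: "mem s6 = mem s" "\<And>r. r \<notin> frame \<Longrightarrow> regs s6 r = regs s r" "regs s6 24 = h"
            using 1 fr1 r5 by (auto simp: frame_def h_def)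
          have T6: "T6 + ct * (40 * cap - regs s6 16) \<le> ct * (40 * cap - regs s1 16) + 1" using 1 r5 by auto
          define s7 where "s7 = s6\<lparr>regs := (regs s6)(24 := Suc h)\<rparr>"
          have "alive s7 \<or> (regs s7 23 = 0 \<and> fin s7)"
            using 1(4)
          proof (elim disjE conjE, goal_cases)
            case 1
            then have "alive s7" using al1 r5 CS by (auto simp: alive_def s7_def)
            then show ?thesis ..
          next
            case 2
            then have "fin s7" by (auto simp: fin_def s7_def CC)
            then show ?thesis using 2 by (simp add: s7_def)
          next
            case 3
            have "40 * cap - regs s5 16 = 40 * cap - length (CL h)" using al1 r5 by simp
            moreover have "40 * cap \<le> length (CL h @ cs)" using 3 al1 r5 by simp
            ultimately have "take (40 * cap) C = CL h @ take (40 * cap - regs s5 16) cs"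
              using al1 unfolding CC by simp
            then have "fin s7" using 3 al1 by (auto simp: fin_def)
            then show ?thesis using 3 by (simp add: s7_def)
          qed
          then have "I s7" using r6 h by (auto simp: I_def s7_def frame_def)
          moreover have "eval w inp s6 (Reg 24 +\<^sub>e Const 1) = Suc h" using r6 h1 w1 by simp
          ultimately show ?case
            by (intro wp_assign) (use T6 Vh r6 in \<open>auto simp: s7_def h_def[symmetric]\<close>)
        qed
      qed
    qed (use h Q in auto)
  next
    case (3 T s')
    have "T \<le> Suc (ct * (40 * cap) + 40 * length Q)" using 3(3) by simp
    then have "T \<le> ct * (40 * cap) + 40 * cap + 1" using Q by simp
    moreover have "fin s'"
    proof -
      have "fin s' \<or> alive s'" using 3(1) unfolding I_def by blast
      moreover have "fin s'" if al: "alive s'"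
      proof -
        have "regs s' 24 = length Q" using 3(1,2) al by (simp add: I_def alive_def)
        then have "\<forall>i\<in>set C. \<not> accept ys (xss ! i)" using al by (simp add: alive_def CL_def C)
        then show ?thesis unfolding fin_def using in_set_takeD by fast
      qed
      ultimately show ?thesis by blast
    qed
    ultimately show ?case using 3(1) unfolding I_def fin_def by (intro conjI) simp_all
  qed
qed

lemma snd_entries_less: "q \<in> set (entries sd fa fc xss i) \<Longrightarrow> snd q < i"
  by (auto simp: entries_def leaf_entries_def)

lemma set_pos_ge: "4 \<le> set_pos xss i"
  using set_pos_mono[of 0 i xss] by simp

text \<open>The query grows its own tree in the queue area below \<open>HD\<close>; the table and
  the sets lie above and survive.\<close>

lemma structure_ds_in:
  assumes st: "structure_in m sd fa fc binp xss n" and xss: "sets_in binp xss" and so: "\<forall>i<n. sorted_wrt (<) (xss ! i)"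
    and m': "\<And>a. HD \<le> a \<Longrightarrow> m' a = m a"
  shows "ds_in m' (\<lambda>j. SB + set_pos xss j) (entries sd fa fc xss n) xss"
proof -
  have le: "length (entries sd fa fc xss n) \<le> Mb" using length_entries[of sd fa fc xss n] by (simp add: Mb_def)
  have t: "table_in m' (\<lambda>j. SB + set_pos xss j) (entries sd fa fc xss n)"
    using st le m' unfolding structure_in_def by (blast intro: table_in_cong)
  have HDSB: "HD \<le> SB" using bounds by linarith
  have "m' (SB + set_pos xss i) = length (xss ! i) \<and> (\<forall>j<length (xss ! i). m' (SB + set_pos xss i + 1 + j) = xss ! i ! j) \<and>
      SB + set_pos xss i + Suc (length (xss ! i)) \<le> Z" if i: "i < n" for i
  proof -
    have pn: "set_pos xss i + Suc (length (xss ! i)) \<le> set_pos xss n" using set_pos_mono[of "Suc i" n xss] i by simp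
    have cp: "m' (SB + q) = binp ! q" if "4 \<le> q" "q < set_pos xss n" for q
      using st that m'[of "SB + q"] HDSB by (auto simp: structure_in_def)
    have "m' (SB + set_pos xss i) = length (xss ! i)" using cp[of "set_pos xss i"] set_pos_ge[of xss i] pn xss i
      by (simp add: sets_in_def)
    moreover have "m' (SB + set_pos xss i + 1 + j) = xss ! i ! j" if j: "j < length (xss ! i)" for j
    proof -
      have "m' (SB + (set_pos xss i + 1 + j)) = binp ! (set_pos xss i + 1 + j)"
        using cp[of "set_pos xss i + 1 + j"] set_pos_ge[of xss i] pn j by simp
      also have "\<dots> = xss ! i ! j" using xss i j by (simp add: sets_in_def reads_def)
      finally show ?thesis by (simp add: add.assoc)
    qed
    moreover have "SB + set_pos xss i + Suc (length (xss ! i)) \<le> Z" using pn xss bounds by (simp add: sets_in_def)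
    ultimately show ?thesis by blast
  qed
  then show ?thesis using t le so snd_entries_less[OF nth_mem] by (simp add: ds_in_def)
qed

lemma wp_query:
  assumes st: "structure_in m sd fa fc binp xss n" and xss: "sets_in binp xss" and so: "\<forall>i<n. sorted_wrt (<) (xss ! i)"
    and rd: "reads inp 1 ys" "inp ! 0 = length ys" "sorted_wrt (<) ys"
    and cB: "Z \<le> cB * B2" and C: "C = candidates (entries sd fa fc xss n) fa fc (queue sd ys)"
  shows "wp w inp query_prog (\<lambda>T s'. T \<le> cap * (40 * (20 * (cB + 1) * length ys + 61) + 20 * length ys + 140) + 200 \<and>
    (\<forall>a. HD \<le> a \<longrightarrow> mem s' a = m a) \<and>
    ((\<exists>i\<in>set C. accept ys (xss ! i) \<and> regs s' 0 = SB + set_pos xss i) \<or>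
      (\<forall>i\<in>set (take (40 * cap) C). \<not> accept ys (xss ! i)))) (init m)"
proof -
  have st1: "params m" "seeds_in m sd" "m (QB - 2) = fa" "m (QB - 1) = fc" using st by (auto simp: structure_in_def)
  have c: "13 < (2::nat) ^ w" "1 < (2::nat) ^ w" using Z2 Z_ge by auto
  have li: "0 < length inp" using rd by (auto simp: reads_def)
  show ?thesis unfolding query_prog_def
  proof (rule wp_seq, rule wp_conseq[OF wp_load_upto[OF c(1)]], elim conjE, goal_cases)
    case (1 T1 s1)
    have p1: "params (regs s1)" using st1(1) by (rule params_cong) (use 1 in \<open>auto simp: init_def\<close>)
    have m1: "mem s1 = m" using 1 by (simp add: init_def)
    define s2 where "s2 = s1\<lparr>regs := (regs s1)(20 := length ys)\<rparr>"
    define s3 where "s3 = s2\<lparr>regs := (regs s2)(21 := 1)\<rparr>"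
    have e2: "eval w inp s1 (Inp (Const 0)) = length ys" using li rd by simp
    have e3: "eval w inp s2 (Const 1) = 1" using w1 by simp
    have p3: "params (regs s3)" using p1 by (rule params_cong) (auto simp: s2_def s3_def)
    have x3: "seeds_in (mem s3) sd" "reads inp (regs s3 21) ys" "regs s3 20 = length ys"
      using st1 rd m1 by (auto simp: s2_def s3_def)
    show ?case
    proof (rule wp_seq_assign[OF e2 s2_def], rule wp_seq_assign[OF e3 s3_def], rule wp_seq,
        rule wp_conseq[OF wp_generate[OF p3 x3]], elim conjE, goal_cases)
      case (1 T4 s4)
      have r4: "\<And>r. r < 22 \<or> 29 < r \<Longrightarrow> regs s4 r = regs s3 r"
        "\<And>a. a < QB \<or> HD \<le> a \<Longrightarrow> mem s4 a = m a"
        "queue_in (mem s4) QB (queue sd ys)" "regs s4 23 = length (queue sd ys)"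
        using 1 m1 by (auto simp: s2_def s3_def)
      have p4: "params (regs s4)" using p3 by (rule params_cong) (auto simp: r4)
      have g4: "\<forall>q\<in>set (queue sd ys). good_node q" using good_queue by (auto simp: queue_def)
      have ds: "ds_in (mem s4) (\<lambda>j. SB + set_pos xss j) (entries sd fa fc xss n) xss"
        using st xss so by (rule structure_ds_in) (simp add: r4)
      have "34 \<le> QB" using bounds by linarith
      then have f4: "mem s4 (QB - 2) = fa" "mem s4 (QB - 1) = fc" "regs s4 20 = length ys" using st1 x3 by (auto simp: r4)
      show ?case
      proof (rule wp_conseq[OF wp_scan_leaves[OF p4 ds rd(1) f4(3) rd(3) r4(3,4) length_queue g4 f4(1,2) cB refl C]], elim conjE, goal_cases)
        case (1 T5 s5)
        have "T1 \<le> 27" using \<open>T1 \<le> 2 * 13 + 1\<close> by simp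
        moreover have "cap * (40 * (20 * (cB + 1) * length ys + 61) + 20 * length ys + 140) =
            (20 * (cB + 1) * length ys + 61) * (40 * cap) + 40 * cap + cap * (20 * length ys + 100)"
          by (simp add: algebra_simps)
        ultimately have "Suc (T1 + Suc (1 + Suc (1 + Suc (T4 + T5)))) \<le>
            cap * (40 * (20 * (cB + 1) * length ys + 61) + 20 * length ys + 140) + 200"
          using 1(1) \<open>T4 \<le> cap * (20 * length ys + 100) + 100\<close> by linarith
        then show ?case using 1(2,3) r4(2) by (intro conjI) simp_all
      qed
    qed
  qed
qed

end

subsection \<open>Choosing the parameters\<close>

text \<open>Division of \<open>2 ^ w - 1\<close> by 256 until it drops below 256 computes \<open>Z = 2 ^ ((w - 1) div 8)\<close>, so that products
  of up to eight numbers below \<open>Z\<close> do not overflow.\<close>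

definition find_scale :: com where
  "find_scale =
    (14 ::= Const 0 -\<^sub>e Const 1) ;; (1 ::= Const 1) ;;
    While (Const 255 <\<^sub>e Reg 14) ((14 ::= Reg 14 div\<^sub>e Const 256) ;; (1 ::= Reg 1 *\<^sub>e Const 2))"

text \<open>Fixed-point powers of \<open>1 / b2\<close> (register 14) and \<open>1 / b1\<close> (register 15): the depth is the first \<open>k\<close> with
  \<open>(1 / b2) ^ k \<ge> n\<close>.\<close>

definition find_depth :: com where
  "find_depth =
    (14 ::= Reg 1) ;; (15 ::= Reg 1) ;; (5 ::= Const 0) ;;
    While (Reg 14 <\<^sub>e Reg 9 *\<^sub>e Reg 1)
      ((14 ::= Reg 14 *\<^sub>e Reg 1 div\<^sub>e Reg 4) ;;
       (15 ::= Reg 15 *\<^sub>e Reg 1 div\<^sub>e Reg 3) ;;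
       (5 ::= Reg 5 +\<^sub>e Const 1))"

text \<open>With 8 * (k + 1) repetitions (register 8), each surviving with probability at least 1 /
  (2 k + 2), all fail with probability at most exp (- 4). The queue bound (register 6) is
  \<open>cc\<close> times the number of repetitions times an integer estimate of (1 / b1) ^
  k.\<close>

definition set_layout :: "nat \<Rightarrow> com" where
  "set_layout cc =
    (8 ::= Const 8 *\<^sub>e (Reg 5 +\<^sub>e Const 1)) ;;
    (6 ::= Const cc *\<^sub>e Reg 8 *\<^sub>e (Reg 15 div\<^sub>e Reg 1 +\<^sub>e Const 1)) ;;
    (7 ::= Reg 9 *\<^sub>e Reg 6) ;;
    (10 ::= Const 34 +\<^sub>e Const 2 *\<^sub>e (Reg 8 *\<^sub>e (Reg 5 +\<^sub>e Const 1))) ;;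
    (11 ::= Reg 10 +\<^sub>e Const 2 *\<^sub>e Reg 6) ;;
    (12 ::= Reg 11 +\<^sub>e Reg 7) ;;
    (13 ::= Reg 12 +\<^sub>e Const 2 *\<^sub>e Reg 7 +\<^sub>e Const 2)"

text \<open>2 ^ w does not fit into a word, so 2 ^ (w - z) is obtained from 2 ^ w - 1. Rounding is
  one-sided on purpose: b1 down, which raises the thresholds for close pairs, and b2 up, so that
  acceptance implies similarity strictly above b2.\<close>

definition setup_prog :: "nat \<Rightarrow> com" where
  "setup_prog cc =
    (9 ::= Inp (Const 0)) ;; find_scale ;;
    (2 ::= (Const 0 -\<^sub>e Const 1) div\<^sub>e Reg 1 +\<^sub>e Const 1) ;;
    (3 ::= Inp (Const 2) div\<^sub>e Reg 2) ;;
    (4 ::= Inp (Const 3) div\<^sub>e Reg 2 +\<^sub>e Const 1) ;;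
    find_depth ;; set_layout cc ;; store_upto 13 ;; (14 ::= Const 32)"

definition build_prog :: "nat \<Rightarrow> com" where
  "build_prog cc = setup_prog cc ;; draw_words ;; process_sets"

lemma wp_find_scale:
  assumes w: "10 \<le> w"
  shows "wp w inp find_scale (\<lambda>T s'. regs s' 1 = 2 ^ ((w - 1) div 8) \<and> mem s' = mem s \<and>
    (\<forall>r. r \<noteq> 1 \<and> r \<noteq> 14 \<longrightarrow> regs s' r = regs s r)) s"
proof -
  define I where "I = (\<lambda>s' :: store. mem s' = mem s \<and> (\<forall>r. r \<noteq> 1 \<and> r \<noteq> 14 \<longrightarrow> regs s' r = regs s r) \<and>
    (\<exists>j. 8 * j < w \<and> regs s' 1 = 2 ^ j \<and> regs s' 14 = 2 ^ (w - 8 * j) - 1))"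
  have "(2::nat) ^ 10 \<le> 2 ^ w" using w by (intro power_increasing) auto
  then have W: "1024 \<le> (2::nat) ^ w" by simp
  have w0: "0 < w" using w by simp
  show ?thesis unfolding find_scale_def
  proof (rule wp_seq, rule wp_assign, rule wp_seq, rule wp_assign, rule wp_while_measure[where I = I and V = "\<lambda>s'. regs s' 14"], goal_cases)
    case 1
    show ?case using W w by (auto simp: I_def intro!: exI[of _ 0])
  next
    case (2 s1)
    then obtain j where j: "8 * j < w" "regs s1 1 = 2 ^ j" "regs s1 14 = 2 ^ (w - 8 * j) - 1" by (auto simp: I_def)
    have "255 < regs s1 14" using 2(2) W by simp
    then have "(2::nat) ^ 8 < 2 ^ (w - 8 * j)" using j by simp
    then have j8: "8 < w - 8 * j" using power_less_imp_less_exp[of "2::nat" 8 "w - 8 * j"] by simp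
    define m where "m = (2::nat) ^ (w - 8 * Suc j)"
    have m: "(2::nat) ^ (w - 8 * j) = 256 * m"
      using j8 power_add[of "2::nat" 8 "w - 8 * Suc j"] by (simp add: m_def)
    have m1: "m \<ge> 1" by (simp add: m_def)
    have d: "(256 * m - 1) div 256 = m - 1" using m1 by (cases m) auto
    have a: "2 ^ j * 2 < (2::nat) ^ w" using j w power_strict_increasing[of "Suc j" w "2::nat"] by (simp add: mult.commute)
    have e: "eval w inp s1 (Reg 14 div\<^sub>e Const 256) = m - 1" using j m d W by simp
    have "256 * m - 1 > m - 1" using m1 by linarith
    moreover have "m = 2 ^ (w - (8 + 8 * j))" "8 + 8 * j < w" using j8 by (simp_all add: m_def)
    ultimately show ?case
      by (intro wp_seq wp_assign, unfold e)
        (use 2(1) j W m j8 a in \<open>auto simp: I_def m_def[symmetric] intro!: exI[of _ "Suc j"]\<close>)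
  next
    case (3 T s')
    then obtain j where j: "8 * j < w" "regs s' 1 = 2 ^ j" "regs s' 14 = 2 ^ (w - 8 * j) - 1" by (auto simp: I_def)
    have "regs s' 14 \<le> 255" using 3(2) W by simp
    then have "(2::nat) ^ (w - 8 * j) \<le> 2 ^ 8" using j by simp
    then have "w - 8 * j \<le> 8" using power_le_imp_le_exp[of "2::nat" "w - 8 * j" 8] by simp
    then have "(w - 1) div 8 = j" using j(1) by (intro div_nat_eqI) auto
    then show ?case using 3(1) j by (auto simp: I_def)
  qed
qed

fun scaled_pow :: "nat \<Rightarrow> nat \<Rightarrow> nat \<Rightarrow> nat" where
  "scaled_pow Z B 0 = Z"
| "scaled_pow Z B (Suc j) = scaled_pow Z B j * Z div B"

context layout
begin

text \<open>Products with Z are formed only from values below \<open>n * Z\<close> or at most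
  \<open>Z * Z\<close>, which rules out overflow; this is the purpose of the assumption on the
  powers for \<open>B1\<close>.\<close>

lemma wp_find_depth:
  assumes r: "regs s 1 = Z" "regs s 3 = B1" "regs s 4 = B2" "regs s 9 = n"
    and k: "\<And>j. j < k \<Longrightarrow> scaled_pow Z B2 j < n * Z" "n * Z \<le> scaled_pow Z B2 k"
    and U: "\<And>j. j \<le> k \<Longrightarrow> scaled_pow Z B1 j \<le> Z * Z"
  shows "wp w inp find_depth (\<lambda>T s'. mem s' = mem s \<and> (\<forall>r. r \<noteq> 5 \<and> r \<noteq> 14 \<and> r \<noteq> 15 \<longrightarrow> regs s' r = regs s r) \<and>
    regs s' 5 = k \<and> regs s' 15 = scaled_pow Z B1 k) s"
proof -
  define I where "I = (\<lambda>s' :: store. mem s' = mem s \<and> (\<forall>r. r \<noteq> 5 \<and> r \<noteq> 14 \<and> r \<noteq> 15 \<longrightarrow> regs s' r = regs s r) \<and>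
    regs s' 5 \<le> k \<and> regs s' 14 = scaled_pow Z B2 (regs s' 5) \<and> regs s' 15 = scaled_pow Z B1 (regs s' 5))"
  have "n \<le> Z" using bounds by linarith
  then have nZ: "n * Z \<le> Z * Z" by simp
  have kw: "Suc k < 2 ^ w" using bounds Z2 Z_ge by linarith
  show ?thesis unfolding find_depth_def
  proof (rule wp_seq, rule wp_assign, rule wp_seq, rule wp_assign, rule wp_seq, rule wp_assign,
      rule wp_while_measure[where I = I and V = "\<lambda>s'. k - regs s' 5"], goal_cases)
    case 1
    show ?case using r by (auto simp: I_def)
  next
    case (2 s1)
    define j where "j = regs s1 5"
    have nZw: "n * Z < 2 ^ w" using nZ Z2 by linarith
    have j: "regs s1 14 = scaled_pow Z B2 j" "regs s1 15 = scaled_pow Z B1 j" "j \<le> k"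
      "regs s1 1 = Z" "regs s1 3 = B1" "regs s1 4 = B2" "regs s1 9 = n" using 2(1) r by (auto simp: I_def j_def)
    have lt: "scaled_pow Z B2 j < n * Z" using 2(2) j nZw by simp
    have jk: "j < k" using lt k(2) j(3) by (cases "j = k") auto
    have "scaled_pow Z B2 j * Z \<le> Z * Z * Z" using lt nZ by (intro mult_right_mono) linarith+
    then have a1: "scaled_pow Z B2 j * Z < 2 ^ w" using Z2 by linarith
    have "scaled_pow Z B1 j * Z \<le> Z * Z * Z" using U[OF j(3)] by (intro mult_right_mono) auto
    then have a2: "scaled_pow Z B1 j * Z < 2 ^ w" using Z2 by linarith
    show ?case
      apply (intro wp_seq wp_assign)
      using 2(1) j a1 a2 jk kw w1 by (auto simp: I_def j_def[symmetric])
  next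
    case (3 T s')
    have nZw: "n * Z < 2 ^ w" using nZ Z2 by linarith
    have "n * Z \<le> scaled_pow Z B2 (regs s' 5)" using 3 r nZw by (simp add: I_def)
    then have "\<not> regs s' 5 < k" using k(1) by (meson linorder_not_less)
    then show ?case using 3(1) by (auto simp: I_def)
  qed
qed

lemma wp_set_layout:
  assumes r: "regs s 1 = Z" "regs s 2 = 2 ^ (w - z)" "regs s 3 = B1" "regs s 4 = B2" "regs s 9 = n" "regs s 5 = k" "regs s 15 = U"
    and Lk: "L = 8 * Suc k" and cap: "cap = cc * L * (U div Z + 1)" and cc: "0 < cc"
  shows "wp w inp (set_layout cc) (\<lambda>T s'. params (regs s') \<and> mem s' = mem s) s"
proof -
  have "cc * L * 1 \<le> cap" unfolding cap by (intro mult_left_mono) auto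
  moreover have "cc * 1 \<le> cc * L" using L by (intro mult_left_mono) auto
  moreover have "1 * (U div Z + 1) \<le> cap" unfolding cap using cc L by (intro mult_right_mono) auto
  ultimately have a: "cc \<le> cap" "cc * L \<le> cap" "U div Z + 1 \<le> cap"
    unfolding mult_1_right mult_1_left by linarith+
  have aw: "cc < 2 ^ w" "cc * L < 2 ^ w" "U div Z + 1 < 2 ^ w" "cap < 2 ^ w" "Mb < 2 ^ w" "k + 1 < 2 ^ w" "L * Suc k < 2 ^ w"
    "2 * (L * Suc k) < 2 ^ w" "QB < 2 ^ w" "2 * cap < 2 ^ w" "HD < 2 ^ w" "EN < 2 ^ w" "2 * Mb < 2 ^ w" "EN + 2 * Mb < 2 ^ w" "SB < 2 ^ w"
    "34 < (2::nat) ^ w" "8 < (2::nat) ^ w" "2 < (2::nat) ^ w" "1 < (2::nat) ^ w"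
    using a bounds Z2 Z_ge by linarith+
  have "L < 2 ^ w" using L(2) bounds(6) Z2(4) by linarith
  with Lk have "8 * (k + 1) < 2 ^ w" by simp
  note aw = aw this \<open>L < 2 ^ w\<close>
  define s1 where "s1 = s\<lparr>regs := (regs s)(8 := L)\<rparr>"
  define s2 where "s2 = s1\<lparr>regs := (regs s1)(6 := cap)\<rparr>"
  define s3 where "s3 = s2\<lparr>regs := (regs s2)(7 := Mb)\<rparr>"
  define s4 where "s4 = s3\<lparr>regs := (regs s3)(10 := QB)\<rparr>"
  define s5 where "s5 = s4\<lparr>regs := (regs s4)(11 := HD)\<rparr>"
  define s6 where "s6 = s5\<lparr>regs := (regs s5)(12 := EN)\<rparr>"
  have e1: "eval w inp s (Const 8 *\<^sub>e (Reg 5 +\<^sub>e Const 1)) = L" using r aw w1 Lk by simp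
  have e2: "eval w inp s1 (Const cc *\<^sub>e Reg 8 *\<^sub>e (Reg 15 div\<^sub>e Reg 1 +\<^sub>e Const 1)) = cap"
    using r aw w1 by (simp add: s1_def cap)
  have e3: "eval w inp s2 (Reg 9 *\<^sub>e Reg 6) = Mb" using r aw by (simp add: s1_def s2_def Mb_def)
  have e4: "eval w inp s3 (Const 34 +\<^sub>e Const 2 *\<^sub>e (Reg 8 *\<^sub>e (Reg 5 +\<^sub>e Const 1))) = QB"
    using r aw w1 by (simp add: s1_def s2_def s3_def QB_def)
  have e5: "eval w inp s4 (Reg 10 +\<^sub>e Const 2 *\<^sub>e Reg 6) = HD"
    using aw by (simp add: s1_def s2_def s3_def s4_def HD_def)
  have e6: "eval w inp s5 (Reg 11 +\<^sub>e Reg 7) = EN"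
    using aw by (simp add: s1_def s2_def s3_def s4_def s5_def EN_def)
  have e7: "eval w inp s6 (Reg 12 +\<^sub>e Const 2 *\<^sub>e Reg 7 +\<^sub>e Const 2) = SB"
    using aw by (simp add: s1_def s2_def s3_def s4_def s5_def s6_def SB_def)
  show ?thesis unfolding set_layout_def
    by (rule wp_seq_assign[OF e1 s1_def], rule wp_seq_assign[OF e2 s2_def], rule wp_seq_assign[OF e3 s3_def],
        rule wp_seq_assign[OF e4 s4_def], rule wp_seq_assign[OF e5 s5_def], rule wp_seq_assign[OF e6 s6_def],
        rule wp_assign, unfold e7)
      (use r in \<open>simp add: s1_def s2_def s3_def s4_def s5_def s6_def params_def\<close>)
qed

lemma wp_setup:
  assumes z: "z = (w - 1) div 8"
    and inp: "length inp = N" "4 \<le> N" "inp ! 0 = n" "B1 = inp ! 2 div 2 ^ (w - z)" "B2 = inp ! 3 div 2 ^ (w - z) + 1"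
    and k: "\<And>j. j < k \<Longrightarrow> scaled_pow Z B2 j < n * Z" "n * Z \<le> scaled_pow Z B2 k"
    and U: "\<And>j. j \<le> k \<Longrightarrow> scaled_pow Z B1 j \<le> Z * Z"
    and Lk: "L = 8 * Suc k" and cap: "cap = cc * L * (scaled_pow Z B1 k div Z + 1)" and cc: "0 < cc"
  shows "wp w inp (setup_prog cc) (\<lambda>T s'. params (regs s') \<and> params (mem s') \<and> regs s' 14 = 32 \<and>
    (\<forall>a\<ge>14. mem s' a = 0)) (init (\<lambda>_. 0))"
proof -
  define s1 where "s1 = (init (\<lambda>_. 0))\<lparr>regs := (regs (init (\<lambda>_. 0)))(9 := n)\<rparr>"
  have e1: "eval w inp (init (\<lambda>_. 0)) (Inp (Const 0)) = n" using inp by simp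
  have w10: "10 \<le> w" using w_pos by simp
  have "1024 \<le> (1000::nat) * Z" using Z_ge by simp
  then have W: "1024 \<le> (2::nat) ^ w" using Z2 by linarith
  show ?thesis unfolding setup_prog_def
  proof (rule wp_seq_assign[OF e1 s1_def], rule wp_seq, rule wp_conseq[OF wp_find_scale[OF w10]], elim conjE, goal_cases)
    case (1 T2 s2)
    have r2: "regs s2 9 = n" "mem s2 = (\<lambda>_. 0)" using 1 by (auto simp: s1_def init_def)
    have "regs s2 1 = 2 ^ z" using 1 by (simp only: z)
    then have r2Z: "regs s2 1 = Z" by (simp add: Z_def)
    note r2 = r2Z r2
    define s3 where "s3 = s2\<lparr>regs := (regs s2)(2 := 2 ^ (w - z))\<rparr>"
    define s4 where "s4 = s3\<lparr>regs := (regs s3)(3 := B1)\<rparr>"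
    define s5 where "s5 = s4\<lparr>regs := (regs s4)(4 := B2)\<rparr>"
    have zw': "z \<le> w" "z > 0" using zw z_ge by auto
    have WG: "(2::nat) ^ w = 2 ^ (w - z) * Z" using zw' by (simp add: Z_def flip: power_add)
    have "(2 ^ w - 1) div Z + 1 = (2::nat) ^ (w - z)"
    proof -
      define g where "g = (2::nat) ^ (w - z) - 1"
      have g: "(2::nat) ^ (w - z) = Suc g" by (simp add: g_def)
      have "2 ^ w - 1 = (Z - 1) + g * Z" using Z_ge by (simp add: WG g)
      moreover have "((Z - 1) + g * Z) div Z = g" using Z_ge by (subst div_mult_self1) auto
      ultimately show ?thesis by (simp only: g)
    qed
    moreover have "(2::nat) ^ (w - z) < 2 ^ w" using zw' w10 by (intro power_strict_increasing) auto
    ultimately have e3: "eval w inp s2 ((Const 0 -\<^sub>e Const 1) div\<^sub>e Reg 1 +\<^sub>e Const 1) = 2 ^ (w - z)"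
      using r2 w1 by simp
    have e4: "eval w inp s3 (Inp (Const 2) div\<^sub>e Reg 2) = B1" using inp W by (simp add: s3_def)
    have "B2 < 2 ^ w" using B2 Z2 Z_ge by (simp add: Z_def[symmetric])
    then have e5: "eval w inp s4 (Inp (Const 3) div\<^sub>e Reg 2 +\<^sub>e Const 1) = B2" using inp W w1 by (simp add: s3_def s4_def)
    have r5: "regs s5 1 = Z" "regs s5 3 = B1" "regs s5 4 = B2" "regs s5 9 = n" "regs s5 2 = 2 ^ (w - z)" "mem s5 = (\<lambda>_. 0)"
      using r2 by (auto simp: s3_def s4_def s5_def)
    show ?case
    proof (rule wp_seq_assign[OF e3 s3_def], rule wp_seq_assign[OF e4 s4_def], rule wp_seq_assign[OF e5 s5_def],
        rule wp_seq, rule wp_conseq[OF wp_find_depth[OF r5(1-4) k U]], goal_cases)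
      case (3 T6 s6)
      have r6: "regs s6 1 = Z" "regs s6 2 = 2 ^ (w - z)" "regs s6 3 = B1" "regs s6 4 = B2" "regs s6 9 = n" "regs s6 5 = k"
        "regs s6 15 = scaled_pow Z B1 k" "mem s6 = (\<lambda>_. 0)" using 3 r5 by auto
      have c13: "13 < (2::nat) ^ w" "(13::nat) < 29" using W by auto
      show ?case
      proof (rule wp_seq, rule wp_conseq[OF wp_set_layout[OF r6(1-7) Lk cap cc]], elim conjE,
          rule wp_seq, rule wp_conseq[OF wp_store_upto[OF c13]], elim conjE, goal_cases)
        case (1 T7 s7 T8 s8)
        have "params (mem s8)" using \<open>params (regs s7)\<close> by (rule params_cong) (use 1 in auto)
        moreover have "params ((regs s8)(14 := 32))" using \<open>params (regs s7)\<close> by (rule params_cong) (use 1 in auto)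
        moreover have "mem s8 a = 0" if "a \<ge> 14" for a using 1 r6 that by auto
        ultimately show ?case using W by (intro wp_assign) simp
      qed
    qed auto
  qed
qed

text \<open>Beyond the draw everything is deterministic, so the final store is a function
  \<open>F\<close> of the words, and the result is the image of the uniform distribution under
  it.\<close>

lemma build_distribution:
  assumes z: "z = (w - 1) div 8"
    and inp: "4 \<le> N" "inp ! 0 = n" "B1 = inp ! 2 div 2 ^ (w - z)" "B2 = inp ! 3 div 2 ^ (w - z) + 1"
    and k: "\<And>j. j < k \<Longrightarrow> scaled_pow Z B2 j < n * Z" "n * Z \<le> scaled_pow Z B2 k"
    and U: "\<And>j. j \<le> k \<Longrightarrow> scaled_pow Z B1 j \<le> Z * Z"
    and Lk: "L = 8 * Suc k" and cap: "cap = cc * L * (scaled_pow Z B1 k div Z + 1)" and cc: "0 < cc"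
    and xss: "sets_in inp xss"
  shows "\<exists>T F. run w inp T ([build_prog cc], init (\<lambda>_. 0)) =
      map_pmf (\<lambda>ws. ([], F ws)) (replicate_pmf (2 * (L * Suc k) + 2) (pmf_of_set {0..<2 ^ w})) \<and>
    (\<forall>ws. length ws = 2 * (L * Suc k) + 2 \<longrightarrow>
      structure_in (mem (F ws)) (take (2 * (L * Suc k)) ws) (ws ! (2 * (L * Suc k))) (ws ! (2 * (L * Suc k) + 1)) inp xss n)"
proof -
  define R where "R = 2 * (L * Suc k) + 2"
  define W where "W = replicate_pmf R (pmf_of_set {0..<(2::nat) ^ w})"
  have QR: "QB = 32 + R" by (simp add: QB_def R_def)
  have lN: "length inp = N" using xss by (simp add: sets_in_def)
  obtain t1 s1 where s1: "exec w inp (setup_prog cc) (init (\<lambda>_. 0)) t1 s1" "params (regs s1)" "params (mem s1)"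
    "regs s1 14 = 32" "\<forall>a\<ge>14. mem s1 a = 0"
    using wp_setup[OF z lN inp k U Lk cap cc] unfolding wp_def by blast
  have "regs s1 14 + R = regs s1 10" "regs s1 10 < 2 ^ w" using s1 QR bounds Z2 by (auto simp: params_def)
  from run_draw_words[OF this, of inp] obtain f where f: "\<And>ws r. r \<noteq> 14 \<Longrightarrow> r \<noteq> 15 \<Longrightarrow> f ws r = regs s1 r"
    "\<And>k. run w inp (6 * R + 1) (draw_words # k, s1) =
      map_pmf (\<lambda>ws. (k, \<lparr>regs = f ws, mem = mem_put (mem s1) 32 ws\<rparr>)) W"
    unfolding W_def s1(4) by blast
  define S where "S = (\<lambda>ws. \<lparr>regs = f ws, mem = mem_put (mem s1) 32 ws\<rparr>)"
  have "wp w inp process_sets (\<lambda>T s'. structure_in (mem s') (take (2 * (L * Suc k)) ws) (ws ! (2 * (L * Suc k)))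
      (ws ! (2 * (L * Suc k) + 1)) inp xss n) (S ws)" if ws: "length ws = R" for ws
  proof (rule wp_process_sets[OF _ _ _ _ _ _ xss])
    have put: "mem (S ws) (32 + i) = ws ! i" if "i < R" for i using mem_put_inside[of i ws "mem s1" 32] ws that by (simp add: S_def)
    have out: "mem (S ws) a = mem s1 a" if "a < 32 \<or> QB \<le> a" for a
      using mem_put_outside[of a 32 ws "mem s1"] ws that QR by (simp add: S_def)
    show "params (regs (S ws))" using s1(2) by (rule params_cong) (simp add: S_def f)
    show "params (mem (S ws))" using s1(3) by (rule params_cong) (simp add: out)
    show "seeds_in (mem (S ws)) (take (2 * (L * Suc k)) ws)"
      unfolding seeds_in_def using put ws by (simp add: R_def)
    have q: "QB - 2 = 32 + 2 * (L * Suc k)" "QB - 1 = 32 + (2 * (L * Suc k) + 1)" by (simp_all add: QB_def)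
    show "mem (S ws) (QB - 2) = ws ! (2 * (L * Suc k))" "mem (S ws) (QB - 1) = ws ! (2 * (L * Suc k) + 1)"
      unfolding q by (rule put, simp add: R_def)+
    show "\<forall>a\<ge>QB. mem (S ws) a = 0" using out s1(5) QR by auto
  qed
  then have "\<forall>ws. \<exists>t s'. length ws = R \<longrightarrow> exec w inp process_sets (S ws) t s' \<and>
      structure_in (mem s') (take (2 * (L * Suc k)) ws) (ws ! (2 * (L * Suc k))) (ws ! (2 * (L * Suc k) + 1)) inp xss n"
    unfolding wp_def by blast
  from choice[OF this] obtain tf where "\<forall>ws. \<exists>s'. length ws = R \<longrightarrow> exec w inp process_sets (S ws) (tf ws) s' \<and>
      structure_in (mem s') (take (2 * (L * Suc k)) ws) (ws ! (2 * (L * Suc k))) (ws ! (2 * (L * Suc k) + 1)) inp xss n"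
    by blast
  from choice[OF this] obtain F where F: "\<And>ws. length ws = R \<Longrightarrow> exec w inp process_sets (S ws) (tf ws) (F ws) \<and>
      structure_in (mem (F ws)) (take (2 * (L * Suc k)) ws) (ws ! (2 * (L * Suc k))) (ws ! (2 * (L * Suc k) + 1)) inp xss n"
    by blast
  have supp: "set_pmf W = {ws. set ws \<subseteq> {0..<2 ^ w} \<and> length ws = R}"
    by (auto simp: W_def set_replicate_pmf)
  have fin: "finite (set_pmf W)" unfolding supp by (rule finite_lists_length_eq) simp
  \<comment> \<open>The running time depends on the words; its maximum over the finite support
    serves all of them, shorter runs being padded.\<close>
  define T2 where "T2 = Max (tf ` set_pmf W)"
  have run2: "run w inp T2 ([process_sets], S ws) = return_pmf ([], F ws)" if "ws \<in> set_pmf W" for ws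
  proof -
    have le: "tf ws \<le> T2" unfolding T2_def using fin that by simp
    have "run w inp (tf ws) ([process_sets], S ws) = return_pmf ([], F ws)"
      using F that unfolding supp exec_def by blast
    then have "run w inp (tf ws + (T2 - tf ws)) ([process_sets], S ws) = return_pmf ([], F ws)"
      unfolding run_add by (simp add: bind_return_pmf run_halted)
    then show ?thesis using le by simp
  qed
  have "run w inp (Suc (t1 + Suc (6 * R + 1 + T2))) ([build_prog cc], init (\<lambda>_. 0)) =
    bind_pmf (run w inp t1 ([setup_prog cc, draw_words ;; process_sets], init (\<lambda>_. 0))) (run w inp (Suc (6 * R + 1 + T2)))"
    by (simp only: run.simps build_prog_def step.simps bind_return_pmf run_add)
  also have "\<dots> = run w inp (6 * R + 1 + T2) ([draw_words, process_sets], s1)"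
    using s1(1) unfolding exec_def by (simp only: bind_return_pmf run.simps step.simps)
  also have "\<dots> = bind_pmf W (\<lambda>ws. run w inp T2 ([process_sets], S ws))"
    unfolding run_add[of _ _ "6 * R + 1"] f(2) S_def by (simp only: bind_map_pmf)
  also have "\<dots> = map_pmf (\<lambda>ws. ([], F ws)) W"
    unfolding map_pmf_def by (intro bind_pmf_cong refl run2)
  finally show ?thesis using F unfolding W_def R_def by blast
qed

end

subsection \<open>The success probability\<close>

text \<open>\<open>D p\<close> stands for the multiset of all descendants of \<open>p\<close>,
  itself included. Expanded nodes together with the descendants of the pending ones form an
  invariant: truncation can only remove nodes, and when it does, the queue is full.\<close>

lemma bfs_mset_step:
  fixes D :: "node \<Rightarrow> node multiset"
  assumes D: "\<And>p. P p \<Longrightarrow> D p = add_mset p (\<Sum>c\<leftarrow>ch p. D c)"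
    and roots: "\<And>p. p \<in> set roots \<Longrightarrow> P p" and ch: "\<And>p p'. P p \<Longrightarrow> p' \<in> set (ch p) \<Longrightarrow> P p'"
    and cap: "length roots \<le> cap"
  shows "mset (take h (bfs cap ch roots h)) + (\<Sum>p\<leftarrow>drop h (bfs cap ch roots h). D p) \<subseteq># (\<Sum>p\<leftarrow>roots. D p) \<and>
    (length (bfs cap ch roots h) = cap \<or>
      mset (take h (bfs cap ch roots h)) + (\<Sum>p\<leftarrow>drop h (bfs cap ch roots h). D p) = (\<Sum>p\<leftarrow>roots. D p))"
proof (induction h)
  case (Suc h)
  define Q where "Q = bfs cap ch roots h"
  have lQ: "length Q \<le> cap" unfolding Q_def by (rule length_bfs[OF cap])
  show ?case
  proof (cases "h < length Q")
    case False
    then show ?thesis using Suc by (simp add: Q_def Let_def)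
  next
    case True
    define q where "q = Q ! h"
    have "P q" unfolding q_def Q_def
      by (rule bfs_invariant[where P = P, OF roots ch nth_mem]) (use True in \<open>auto simp: Q_def\<close>)
    then have Dq: "D q = add_mset q (\<Sum>c\<leftarrow>ch q. D c)" by (rule D)
    define m where "m = cap - length Q"
    have Q': "bfs cap ch roots (Suc h) = Q @ take m (ch q)"
      using True lQ by (simp add: Q_def[symmetric] Let_def q_def m_def)
    have t: "take (Suc h) (Q @ take m (ch q)) = take h Q @ [q]" "drop (Suc h) (Q @ take m (ch q)) = drop (Suc h) Q @ take m (ch q)"
      using True by (auto simp: q_def take_Suc_conv_app_nth)
    have d: "drop h Q = q # drop (Suc h) Q" using True by (simp add: q_def Cons_nth_drop_Suc)
    have s: "(\<Sum>c\<leftarrow>ch q. D c) = (\<Sum>c\<leftarrow>take m (ch q). D c) + (\<Sum>c\<leftarrow>drop m (ch q). D c)"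
      by (metis append_take_drop_id map_append sum_list_append)
    define E where "E = mset (take h Q) + (\<Sum>p\<leftarrow>drop h Q. D p)"
    define E' where "E' = mset (take (Suc h) (Q @ take m (ch q))) + (\<Sum>p\<leftarrow>drop (Suc h) (Q @ take m (ch q)). D p)"
    have EE: "E = E' + (\<Sum>c\<leftarrow>drop m (ch q). D c)" unfolding E_def E'_def t d by (simp add: Dq s ac_simps)
    have IH: "E \<subseteq># (\<Sum>p\<leftarrow>roots. D p)" "length Q = cap \<or> E = (\<Sum>p\<leftarrow>roots. D p)"
      using Suc unfolding E_def Q_def by auto
    have "E' \<subseteq># (\<Sum>p\<leftarrow>roots. D p)" using IH(1) EE by (metis mset_subset_eq_add_left subset_mset.order_trans)
    moreover have "length (Q @ take m (ch q)) = cap \<or> E' = (\<Sum>p\<leftarrow>roots. D p)"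
    proof (cases "length (ch q) \<le> m")
      case True
      then have "E' = E" using EE by simp
      moreover have "length (Q @ take m (ch q)) = cap" if "length Q = cap" using that by (simp add: m_def)
      ultimately show ?thesis using IH(2) by auto
    next
      case False
      then show ?thesis using lQ by (simp add: m_def)
    qed
    ultimately show ?thesis unfolding Q' E'_def by blast
  qed
qed auto

lemma bfs_mset:
  fixes D :: "node \<Rightarrow> node multiset"
  assumes "\<And>p. P p \<Longrightarrow> D p = add_mset p (\<Sum>c\<leftarrow>ch p. D c)"
    and "\<And>p. p \<in> set roots \<Longrightarrow> P p" and "\<And>p p'. P p \<Longrightarrow> p' \<in> set (ch p) \<Longrightarrow> P p'"
    and "length roots \<le> cap"
  shows "mset (bfs cap ch roots cap) \<subseteq># (\<Sum>p\<leftarrow>roots. D p)"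
    and "length (bfs cap ch roots cap) < cap \<Longrightarrow> mset (bfs cap ch roots cap) = (\<Sum>p\<leftarrow>roots. D p)"
  \<comment> \<open>After \<open>cap\<close> rounds no node is pending, as the queue has length at
    most \<open>cap\<close>.\<close>
  using bfs_mset_step[where h = cap, OF assms] length_bfs[OF assms(4), of ch cap] by auto

lemma filter_mset_sum: "finite A \<Longrightarrow> filter_mset P (\<Sum>x\<in>A. f x) = (\<Sum>x\<in>A. filter_mset P (f x))"
  by (induction A rule: finite_induct) auto

context layout
begin

primrec desc :: "nat list \<Rightarrow> nat list \<Rightarrow> nat \<Rightarrow> node \<Rightarrow> node multiset" where
  "desc sd xs 0 p = {#p#}"
| "desc sd xs (Suc m) p = add_mset p (\<Sum>c\<leftarrow>kids w z (tau (length xs)) sd xs p. desc sd xs m c)"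

text \<open>Repetition \<open>r\<close> owns a block of \<open>2 * Suc k\<close> words, of which
  level \<open>j\<close> depends on the first \<open>2 * j\<close>.\<close>

definition level :: "nat list \<Rightarrow> nat list \<Rightarrow> nat \<Rightarrow> nat \<Rightarrow> nat list" where
  "level sd xs r j = grow w z (tau (length xs)) xs [0] (take (2 * j) (drop (r * (2 * Suc k)) sd))"

definition level_nodes :: "nat list \<Rightarrow> nat list \<Rightarrow> nat \<Rightarrow> nat \<Rightarrow> node multiset" where
  "level_nodes sd xs r j = mset (map (Pair (r * Suc k + j)) (level sd xs r j))"

definition total :: "nat list \<Rightarrow> nat list \<Rightarrow> nat" where
  "total sd xs = (\<Sum>r<L. \<Sum>j\<le>k. length (level sd xs r j))"

lemma concat_kids:
  "concat (map (\<lambda>v. kids w z \<tau> sd xs (t, v)) V) =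
    map (Pair (Suc t)) (next_level w z \<tau> xs (sd ! (2 * t)) (sd ! (2 * t + 1)) V)"
  by (induction V) (auto simp: kids_def next_level_def keys_def o_def)

lemma sum_list_concat: "(\<Sum>x\<leftarrow>concat xss. f x) = (\<Sum>xs\<leftarrow>xss. \<Sum>x\<leftarrow>xs. (f x :: 'b multiset))"
  by (induction xss) auto

text \<open>Regroups a tree by levels: the children of a whole level form the next one, so
  descendants of nodes turn into the lists of \<open>grow\<close>. The induction needs arbitrary
  starting lists \<open>V\<close>.\<close>

lemma sum_desc:
  assumes "2 * (t + m) \<le> length sd"
  shows "(\<Sum>v\<leftarrow>V. desc sd xs m (t, v)) =
    (\<Sum>i\<le>m. mset (map (Pair (t + i)) (grow w z (tau (length xs)) xs V (take (2 * i) (drop (2 * t) sd)))))"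
  using assms
proof (induction m arbitrary: t V)
  case 0
  show ?case by (induction V) auto
next
  case (Suc m)
  define a c where "a = sd ! (2 * t)" and "c = sd ! (2 * t + 1)"
  have dr: "drop (2 * t) sd = a # c # drop (2 * Suc t) sd"
    using Suc.prems Cons_nth_drop_Suc[of "2 * t" sd] Cons_nth_drop_Suc[of "Suc (2 * t)" sd] by (simp add: a_def c_def)
  define V' where "V' = next_level w z (tau (length xs)) xs a c V"
  have kc: "concat (map (\<lambda>v. kids w z (tau (length xs)) sd xs (t, v)) V) = map (Pair (Suc t)) V'"
    unfolding V'_def a_def c_def by (rule concat_kids)
  have "(\<Sum>v\<leftarrow>V. desc sd xs (Suc m) (t, v)) =
    mset (map (Pair t) V) + (\<Sum>v\<leftarrow>V. \<Sum>p\<leftarrow>kids w z (tau (length xs)) sd xs (t, v). desc sd xs m p)"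
    by (induction V) auto
  also have "(\<Sum>v\<leftarrow>V. \<Sum>p\<leftarrow>kids w z (tau (length xs)) sd xs (t, v). desc sd xs m p) =
    (\<Sum>p\<leftarrow>concat (map (\<lambda>v. kids w z (tau (length xs)) sd xs (t, v)) V). desc sd xs m p)"
    by (simp only: sum_list_concat map_map o_def)
  also have "\<dots> = (\<Sum>v\<leftarrow>V'. desc sd xs m (Suc t, v))"
    unfolding kc by (simp add: o_def)
  also have "\<dots> = (\<Sum>i\<le>m. mset (map (Pair (Suc t + i)) (grow w z (tau (length xs)) xs V' (take (2 * i) (drop (2 * Suc t) sd)))))"
    by (rule Suc.IH) (use Suc.prems in simp)
  also have "\<dots> = (\<Sum>i\<le>m. mset (map (Pair (t + Suc i)) (grow w z (tau (length xs)) xs V (take (2 * Suc i) (drop (2 * t) sd)))))"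
    unfolding dr by (simp add: V'_def)
  finally show ?case by (simp add: sum.atMost_Suc_shift del: sum.atMost_Suc)
qed

text \<open>The depth left below a node is determined by its level modulo \<open>Suc k\<close>; this
  supplies the recursion demanded by \<open>bfs_mset\<close>.\<close>

lemma desc_children:
  assumes "good_node p"
  shows "desc sd xs (k - fst p mod Suc k) p = add_mset p (\<Sum>c\<leftarrow>children sd xs p. desc sd xs (k - fst c mod Suc k) c)"
proof (cases "is_leaf p")
  case True
  moreover have "fst p mod Suc k < Suc k" by (rule mod_less_divisor) simp
  ultimately have "fst p mod Suc k = k" unfolding is_leaf_def by linarith
  then show ?thesis using True by (simp add: children_def)
next
  case False
  then have lt: "fst p mod Suc k < k" by (simp add: is_leaf_def)
  then obtain m where m: "k - fst p mod Suc k = Suc m" by (metis Suc_diff_Suc)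
  have "Suc (fst p) mod Suc k = Suc (fst p mod Suc k)" using lt by (simp add: mod_Suc)
  then have "k - fst c mod Suc k = m" if "c \<in> set (children sd xs p)" for c
    using that m False by (auto simp: children_def kids_def)
  then have "(\<Sum>c\<leftarrow>children sd xs p. desc sd xs (k - fst c mod Suc k) c) = (\<Sum>c\<leftarrow>children sd xs p. desc sd xs m c)"
    by (intro arg_cong[where f = sum_list] map_cong) auto
  then show ?thesis using False m by (simp add: children_def)
qed

text \<open>The queue is always part of the untruncated forest, which serves the upper bounds. If
  the forest has fewer than \<open>cap\<close> nodes the queue is all of it, which finding a shared
  leaf requires.\<close>

lemma queue_mset:
  assumes "length sd = 2 * (L * Suc k)"
  shows "mset (queue sd xs) \<subseteq># (\<Sum>r<L. \<Sum>j\<le>k. level_nodes sd xs r j)"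
    and "total sd xs < cap \<Longrightarrow> mset (queue sd xs) = (\<Sum>r<L. \<Sum>j\<le>k. level_nodes sd xs r j)"
proof -
  define D where "D = (\<lambda>p. desc sd xs (k - fst p mod Suc k) p)"
  have DD: "D p = add_mset p (\<Sum>c\<leftarrow>children sd xs p. D c)" if "good_node p" for p
    unfolding D_def using that by (rule desc_children)
  have "D (r * Suc k, 0) = (\<Sum>j\<le>k. level_nodes sd xs r j)" if "r < L" for r
  proof -
    have "Suc r * Suc k \<le> L * Suc k" using that by (intro mult_right_mono) auto
    then have "2 * (r * Suc k + k) \<le> length sd" using assms by simp
    note sum_desc[OF this, of xs "[0]"]
    moreover have "D (r * Suc k, 0) = desc sd xs k (r * Suc k, 0)"
      by (simp only: D_def fst_conv mod_mult_self2_is_0 diff_zero)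
    moreover have "2 * (r * Suc k) = r * (2 * Suc k)" by simp
    ultimately show ?thesis
      by (simp only: level_nodes_def level_def list.map sum_list_simps add_0_right)
  qed
  then have roots_sum: "(\<Sum>p\<leftarrow>roots. D p) = (\<Sum>r<L. \<Sum>j\<le>k. level_nodes sd xs r j)"
    by (simp add: roots_def o_def sum_list_distinct_conv_sum_set lessThan_atLeast0)
  have lr: "length roots \<le> cap" using L by (simp add: length_roots)
  note bm = bfs_mset[of good_node D "children sd xs" roots cap, OF DD good_roots good_children lr, folded queue_def, unfolded roots_sum]
  show 1: "mset (queue sd xs) \<subseteq># (\<Sum>r<L. \<Sum>j\<le>k. level_nodes sd xs r j)" by (rule bm(1))
  assume "total sd xs < cap"
  moreover have "size (\<Sum>r<L. \<Sum>j\<le>k. level_nodes sd xs r j) = total sd xs"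
    by (simp add: total_def size_multiset_sum level_nodes_def)
  ultimately have "length (queue sd xs) < cap" using size_mset_mono[OF 1] by simp
  then show "mset (queue sd xs) = (\<Sum>r<L. \<Sum>j\<le>k. level_nodes sd xs r j)"
    using bm(2) by simp
qed

lemma leaf_in_queue:
  assumes "length sd = 2 * (L * Suc k)" "total sd xs < cap" "r < L" "v \<in> set (level sd xs r k)"
  shows "(r * Suc k + k, v) \<in> set (queue sd xs)" "is_leaf (r * Suc k + k, v)"
proof -
  have "(r * Suc k + k, v) \<in># level_nodes sd xs r k" using assms(4) by (auto simp: level_nodes_def)
  also have "set_mset (level_nodes sd xs r k) \<subseteq> set_mset (\<Sum>r<L. \<Sum>j\<le>k. level_nodes sd xs r j)"
    using assms(3) by (auto simp: set_mset_sum)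
  finally show "(r * Suc k + k, v) \<in> set (queue sd xs)"
    using queue_mset(2)[OF assms(1,2)] by (metis set_mset_mset)
  show "is_leaf (r * Suc k + k, v)" unfolding is_leaf_def fst_conv mod_mult_self3 by simp
qed

lemma leaves_mset:
  assumes "length sd = 2 * (L * Suc k)"
  shows "mset (filter is_leaf (queue sd xs)) \<subseteq># (\<Sum>r<L. level_nodes sd xs r k)"
proof -
  have "filter_mset is_leaf (level_nodes sd xs r j) = (if j = k then level_nodes sd xs r k else {#})" if "j \<le> k" for r j
  proof (cases "j = k")
    case True
    have "is_leaf (r * Suc k + k, v)" for v unfolding is_leaf_def fst_conv mod_mult_self3 by simp
    then show ?thesis using True unfolding level_nodes_def mset_filter[symmetric]
      by (simp add: filter_True del: mset_filter mset_map)
  next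
    case False
    have "\<not> is_leaf (r * Suc k + j, v)" for v
      unfolding is_leaf_def fst_conv mod_mult_self3 using that False by simp
    then show ?thesis using False unfolding level_nodes_def mset_filter[symmetric]
      by (simp add: filter_False del: mset_filter mset_map)
  qed
  then have "filter_mset is_leaf (\<Sum>r<L. \<Sum>j\<le>k. level_nodes sd xs r j) = (\<Sum>r<L. \<Sum>j\<le>k. if j = k then level_nodes sd xs r k else {#})"
    by (simp add: filter_mset_sum)
  also have "\<dots> = (\<Sum>r<L. level_nodes sd xs r k)" by simp
  finally show ?thesis using multiset_filter_mono[OF queue_mset(1)[OF assms], of is_leaf xs] by simp
qed

end

section \<open>Candidates that the test rejects\<close>

lemma sum_of_bool_mod_eq:
  assumes "0 < m" "m \<le> Z"
  shows "(\<Sum>\<beta><Z. of_bool (\<beta> mod m = r)) \<le> 2 * real Z / real m"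
proof -
  define S where "S = {\<beta>. \<beta> < Z \<and> \<beta> mod m = r}"
  have "inj_on (\<lambda>\<beta>. \<beta> div m) S"
    by (intro inj_onI) (metis (mono_tags, lifting) S_def div_mult_mod_eq mem_Collect_eq)
  moreover have "(\<lambda>\<beta>. \<beta> div m) ` S \<subseteq> {..Z div m}" by (auto simp: S_def div_le_mono)
  ultimately have "card S \<le> card {..Z div m}" by (intro card_inj_on_le) auto
  then have "real (card S) \<le> real (Z div m) + 1" by simp
  \<comment> \<open>Rounding up the size of a residue class adds at most 1, which is at most
    \<open>Z / m\<close>; hence the factor 2.\<close>
  also have "\<dots> \<le> real Z / real m + real Z / real m"
  proof (intro add_mono)
    have "real (Z div m) * real m \<le> real Z"
      unfolding of_nat_mult[symmetric] by (simp only: of_nat_le_iff div_times_less_eq_dividend)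
    then show "real (Z div m) \<le> real Z / real m" using assms by (simp add: field_simps)
  qed (use assms in auto)
  finally have "real (card S) \<le> 2 * real Z / real m" by simp
  moreover have "(\<Sum>\<beta><Z. of_bool (\<beta> mod m = r)) = real (card S)"
    by (simp add: of_bool_def sum.If_cases S_def Int_def lessThan_def)
  ultimately show ?thesis by simp
qed

definition node_coll :: "node multiset \<Rightarrow> node multiset \<Rightarrow> real" where
  "node_coll A B = (\<Sum>p\<in>#A. real (count B p))"

lemma node_coll_nonneg: "0 \<le> node_coll A B"
  by (induction A) (auto simp: node_coll_def)

lemma node_coll_mono:
  assumes "A \<subseteq># A'" "B \<subseteq># B'"
  shows "node_coll A B \<le> node_coll A' B'"
proof -
  have "node_coll A B \<le> node_coll A B'"
    unfolding node_coll_def using assms(2) by (intro sum_mset_mono) (auto simp: mset_subset_eq_count)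
  also have "node_coll A' B' = node_coll A B' + node_coll (A' - A) B'"
    using assms(1) unfolding node_coll_def by (metis image_mset_union subset_mset.add_diff_inverse sum_mset.union)
  then have "node_coll A B' \<le> node_coll A' B'" using node_coll_nonneg[of "A' - A" B'] by simp
  finally show ?thesis .
qed

lemma node_coll_sum_left: "finite S \<Longrightarrow> node_coll (\<Sum>r\<in>S. f r) B = (\<Sum>r\<in>S. node_coll (f r) B)"
  by (induction S rule: finite_induct) (auto simp: node_coll_def)

lemma node_coll_lists: "(\<Sum>p\<leftarrow>A. \<Sum>p'\<leftarrow>B. of_bool (p' = p) :: real) = node_coll (mset A) (mset B)"
proof -
  have "(\<Sum>p'\<leftarrow>B. of_bool (p' = p) :: real) = real (count (mset B) p)" for p by (induction B) auto
  then show ?thesis by (induction A) (auto simp: node_coll_def)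
qed

context layout
begin

text \<open>The bucket key packs identifier and level, so different nodes have different keys and
  are hashed pairwise independently. The factor 2 allows for a hash range that \<open>Mb\<close>
  does not divide.\<close>

lemma avg_bucket_eq:
  assumes "good_node p" "good_node p'" "p \<noteq> p'"
  shows "avg (2 ^ w) 2 (\<lambda>f. of_bool (bucket (f ! 0) (f ! 1) p' = bucket (f ! 0) (f ! 1) p)) \<le> 2 / real Mb"
proof -
  define x y where "x = snd p' * 2 ^ z + fst p'" and "y = snd p * 2 ^ z + fst p"
  have le: "L * Suc k \<le> Z" using bounds by linarith
  have f: "fst p < 2 ^ z" "fst p' < 2 ^ z" "snd p < 2 ^ z" "snd p' < 2 ^ z"
    using assms le by (auto simp: good_node_def Z_def)
  then have xy: "x \<noteq> y" unfolding x_def y_def using key_eq_iff[OF f(2,1)] assms(3) by (auto simp: prod_eq_iff)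
  have zw3: "3 * z \<le> w" "z \<le> w" using zw by auto
  have xk: "x * 2 ^ z \<le> 2 ^ w" by (rule set_keys_less[of "[snd p']" z "[fst p']"]) (use f zw3 in \<open>auto simp: keys_def x_def\<close>)
  have yk: "y * 2 ^ z \<le> 2 ^ w" by (rule set_keys_less[of "[snd p]" z "[fst p]"]) (use f zw3 in \<open>auto simp: keys_def y_def\<close>)
  have MbZ: "Mb \<le> Z" using bounds by linarith
  have "avg (2 ^ w) 2 (\<lambda>f. of_bool (bucket (f ! 0) (f ! 1) p' = bucket (f ! 0) (f ! 1) p)) =
    (\<Sum>\<alpha><2 ^ z. \<Sum>\<beta><2 ^ z. of_bool (\<alpha> mod Mb = \<beta> mod Mb)) / (2 ^ z)\<^sup>2"
    unfolding bucket_def Z_def x_def[symmetric] y_def[symmetric]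
    by (rule avg_hash_pair[OF xy xk yk zw3(2), of "\<lambda>\<alpha> \<beta>. of_bool (\<alpha> mod Mb = \<beta> mod Mb)"])
  also have "\<dots> \<le> (\<Sum>\<alpha><(2::nat) ^ z. 2 * real Z / real Mb) / (2 ^ z)\<^sup>2"
  proof (intro divide_right_mono sum_mono)
    fix \<alpha>
    show "(\<Sum>\<beta><2 ^ z. of_bool (\<alpha> mod Mb = \<beta> mod Mb)) \<le> 2 * real Z / real Mb"
      using sum_of_bool_mod_eq[OF Mb_pos MbZ, of "\<alpha> mod Mb"] by (simp add: Z_def eq_commute)
  qed simp
  also have "\<dots> = 2 / real Mb" by (simp add: Z_def power2_eq_square)
  finally show ?thesis .
qed

definition reject_count :: "nat list \<Rightarrow> nat \<Rightarrow> nat \<Rightarrow> nat list list \<Rightarrow> nat list \<Rightarrow> nat" where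
  "reject_count sd fa fc xss ys =
    length (filter (\<lambda>i. \<not> accept ys (xss ! i)) (candidates (entries sd fa fc xss n) fa fc (queue sd ys)))"

abbreviation (input) "leaves sd xs \<equiv> filter is_leaf (queue sd xs)"

text \<open>A candidate is a leaf of the query together with a leaf of some set in the same bucket,
  counted with multiplicity.\<close>

lemma reject_count_eq:
  "real (reject_count sd fa fc xss ys) = (\<Sum>i\<leftarrow>filter (\<lambda>i. \<not> accept ys (xss ! i)) [0..<n].
    \<Sum>p\<leftarrow>leaves sd ys. \<Sum>p'\<leftarrow>leaves sd (xss ! i). of_bool (bucket fa fc p' = bucket fa fc p))"
proof -
  define rej where "rej = (\<lambda>i. \<not> accept ys (xss ! i))"
  define es where "es = entries sd fa fc xss n"
  define g where "g = (\<lambda>i p. \<Sum>p'\<leftarrow>leaves sd (xss ! i). of_bool (bucket fa fc p' = bucket fa fc p) :: real)"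
  have 1: "real (length (filter rej (chain es b (length es)))) =
    (\<Sum>i\<leftarrow>filter rej [0..<n]. \<Sum>p'\<leftarrow>leaves sd (xss ! i). of_bool (bucket fa fc p' = b))" for b
  proof -
    have "real (length (filter rej (map snd (filter (\<lambda>q. fst q = b) (leaf_entries fa fc i Q))))) =
      (if rej i then \<Sum>p'\<leftarrow>filter is_leaf Q. of_bool (bucket fa fc p' = b) else 0)" for i Q
      by (induction Q) (auto simp: leaf_entries_def)
    then have "real (length (filter rej (map snd (filter (\<lambda>q. fst q = b)
        (concat (map (\<lambda>j. leaf_entries fa fc j (queue sd (xss ! j))) js)))))) =
      (\<Sum>i\<leftarrow>filter rej js. \<Sum>p'\<leftarrow>leaves sd (xss ! i). of_bool (bucket fa fc p' = b))" for js
      by (induction js) auto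
    moreover have "length (filter rej (chain es b (length es))) = length (filter rej (map snd (filter (\<lambda>q. fst q = b) es)))"
      using arg_cong[OF mset_chain[of "length es" es b], of "\<lambda>M. size (filter_mset rej M)"]
      by (simp flip: mset_filter mset_map)
    ultimately show ?thesis by (simp add: es_def entries_def)
  qed
  have swap: "(\<Sum>p\<leftarrow>A. \<Sum>i\<leftarrow>B. f i p :: real) = (\<Sum>i\<leftarrow>B. \<Sum>p\<leftarrow>A. f i p)" for A :: "node list" and B :: "nat list" and f
    by (induction A) (auto simp: sum_list_addf)
  have "real (length (filter rej (candidates es fa fc Q))) = (\<Sum>p\<leftarrow>filter is_leaf Q. \<Sum>i\<leftarrow>filter rej [0..<n]. g i p)" for Q
    by (induction Q) (auto simp: candidates_def 1 g_def)
  then show ?thesis unfolding reject_count_def rej_def[symmetric] es_def[symmetric] swap g_def by simp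
qed

text \<open>A node carries its level and thereby its repetition, so leaves coincide only within one
  repetition.\<close>

lemma node_coll_leaves:
  assumes "length sd = 2 * (L * Suc k)"
  shows "node_coll (mset (leaves sd ys)) (mset (leaves sd xs)) \<le> (\<Sum>r<L. coll (level sd xs r k) (level sd ys r k))"
proof -
  have c: "real (count (\<Sum>r'<L. level_nodes sd xs r' k) (r * Suc k + k, v)) = real (count_list (level sd xs r k) v)" if "r < L" for r v
  proof -
    have "count (level_nodes sd xs r' k) (r * Suc k + k, v) = (if r' = r then count_list (level sd xs r k) v else 0)" for r'
    proof -
      have cnt: "count (mset (map (Pair t) vs)) (t', v) = (if t = t' then count_list vs v else 0)" for t t' vs
        by (induction vs) auto
      have "r' * Suc k + k = r * Suc k + k \<longleftrightarrow> r' = r" by (metis Suc_not_Zero add_right_cancel mult_cancel2)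
      then show ?thesis unfolding level_nodes_def cnt by (cases "r' = r") (simp_all only: if_True if_False)
    qed
    then show ?thesis using that by (simp add: count_sum)
  qed
  have "node_coll (mset (leaves sd ys)) (mset (leaves sd xs)) \<le>
    node_coll (\<Sum>r<L. level_nodes sd ys r k) (\<Sum>r<L. level_nodes sd xs r k)"
    by (intro node_coll_mono leaves_mset assms)
  also have "\<dots> = (\<Sum>r<L. \<Sum>p\<in>#level_nodes sd ys r k. real (count (\<Sum>r'<L. level_nodes sd xs r' k) p))"
    by (simp add: node_coll_sum_left) (simp add: node_coll_def)
  also have "\<dots> = (\<Sum>r<L. \<Sum>v\<leftarrow>level sd ys r k. real (count_list (level sd xs r k) v))"
  proof (intro sum.cong refl)
    fix r assume "r \<in> {..<L}"
    then have r: "r < L" by simp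
    have "(\<Sum>p\<in>#mset (map (Pair (r * Suc k + k)) vs). real (count (\<Sum>r'<L. level_nodes sd xs r' k) p)) =
      (\<Sum>v\<leftarrow>vs. real (count_list (level sd xs r k) v))" for vs
      by (induction vs) (simp_all only: list.map mset.simps image_mset_add_mset sum_mset.add_mset sum_list_simps c[OF r] image_mset_empty sum_mset.empty)
    then show "(\<Sum>p\<in>#level_nodes sd ys r k. real (count (\<Sum>r'<L. level_nodes sd xs r' k) p)) =
      (\<Sum>v\<leftarrow>level sd ys r k. real (count_list (level sd xs r k) v))" unfolding level_nodes_def by blast
  qed
  also have "\<dots> = (\<Sum>r<L. coll (level sd xs r k) (level sd ys r k))"
  proof -
    have "coll A B = (\<Sum>v\<leftarrow>B. real (count_list A v))" for A B
    proof (induction A)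
      case (Cons a A)
      have "(\<Sum>v\<leftarrow>B. real (count_list (a # A) v)) = (\<Sum>v\<leftarrow>B. of_bool (a = v)) + (\<Sum>v\<leftarrow>B. real (count_list A v))"
        by (induction B) auto
      then show ?case using Cons by (simp add: coll_def)
    qed (simp add: coll_def)
    then show ?thesis by simp
  qed
  finally show ?thesis .
qed

text \<open>Rejected candidates come from equal leaves or from distinct leaves in one bucket. The
  latter number at most n * cap * cap * 2 / \<open>Mb\<close> on average, which is 2 * cap by the
  choice of \<open>Mb\<close>.\<close>

lemma avg_reject_count:
  assumes "length sd = 2 * (L * Suc k)"
  shows "avg (2 ^ w) 2 (\<lambda>f. real (reject_count sd (f ! 0) (f ! 1) xss ys)) \<le>
    (\<Sum>i\<leftarrow>filter (\<lambda>i. \<not> accept ys (xss ! i)) [0..<n]. \<Sum>r<L. coll (level sd (xss ! i) r k) (level sd ys r k)) + 2 * real cap"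
proof -
  define Is where "Is = filter (\<lambda>i. \<not> accept ys (xss ! i)) [0..<n]"
  have lI: "length Is \<le> n" using length_filter_le[of _ "[0..<n]"] by (simp add: Is_def)
  have good: "good_node p" if "p \<in> set (leaves sd xs)" for p xs using that good_queue[of p sd xs cap] by (simp add: queue_def)
  have len: "real (length (leaves sd xs)) \<le> real cap" for xs using le_trans[OF length_filter_le length_queue] by simp
  have pair: "avg (2 ^ w) 2 (\<lambda>f. of_bool (bucket (f ! 0) (f ! 1) p' = bucket (f ! 0) (f ! 1) p)) \<le>
    of_bool (p' = p) + 2 / real Mb" if "good_node p" "good_node p'" for p p'
    using avg_bucket_eq[OF that] by (cases "p = p'") auto
  have "avg (2 ^ w) 2 (\<lambda>f. real (reject_count sd (f ! 0) (f ! 1) xss ys)) =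
    (\<Sum>i\<leftarrow>Is. \<Sum>p\<leftarrow>leaves sd ys. \<Sum>p'\<leftarrow>leaves sd (xss ! i).
      avg (2 ^ w) 2 (\<lambda>f. of_bool (bucket (f ! 0) (f ! 1) p' = bucket (f ! 0) (f ! 1) p)))"
    unfolding reject_count_eq Is_def[symmetric] by (subst avg_sum_list, simp)+ (rule refl)
  also have "\<dots> \<le> (\<Sum>i\<leftarrow>Is. \<Sum>p\<leftarrow>leaves sd ys. \<Sum>p'\<leftarrow>leaves sd (xss ! i). of_bool (p' = p) + 2 / real Mb)"
    by (intro sum_list_mono pair) (auto intro: good)
  also have "\<dots> = (\<Sum>i\<leftarrow>Is. node_coll (mset (leaves sd ys)) (mset (leaves sd (xss ! i))) +
      real (length (leaves sd ys)) * (real (length (leaves sd (xss ! i))) * (2 / real Mb)))"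
    unfolding node_coll_lists[symmetric] by (simp only: sum_list_addf sum_list_triv)
  also have "\<dots> \<le> (\<Sum>i\<leftarrow>Is. (\<Sum>r<L. coll (level sd (xss ! i) r k) (level sd ys r k)) + real cap * (real cap * (2 / real Mb)))"
    using assms by (intro sum_list_mono add_mono node_coll_leaves mult_mono len) auto
  also have "\<dots> = (\<Sum>i\<leftarrow>Is. \<Sum>r<L. coll (level sd (xss ! i) r k) (level sd ys r k)) + real (length Is) * (real cap * (real cap * (2 / real Mb)))"
    by (simp only: sum_list_addf sum_list_triv)
  also have "real (length Is) * (real cap * (real cap * (2 / real Mb))) \<le> real n * (real cap * (real cap * (2 / real Mb)))"
    using lI by (intro mult_right_mono) auto
  also have "\<dots> = 2 * real cap" using n L by (simp add: Mb_def)
  finally show ?thesis by (simp add: Is_def)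
qed

section \<open>Averages over all seeds\<close>

lemma block_fits:
  assumes "r < L" "j \<le> k"
  shows "r * (2 * Suc k) + 2 * j + (2 * (L * Suc k) - (r * (2 * Suc k) + 2 * j)) = 2 * (L * Suc k)"
proof -
  have "Suc r * Suc k \<le> L * Suc k" using assms by (intro mult_right_mono) auto
  then show ?thesis using assms by simp
qed

lemma avg_level:
  assumes "r < L" "j \<le> k"
  shows "avg (2 ^ w) (2 * (L * Suc k)) (\<lambda>sd. f (level sd xs r j) (level sd ys r j)) =
    avg (2 ^ w) (2 * j) (\<lambda>ws. f (grow w z (tau (length xs)) xs [0] ws) (grow w z (tau (length ys)) ys [0] ws))"
  using avg_block[of "2 ^ w" "r * (2 * Suc k)" "2 * j" "2 * (L * Suc k) - (r * (2 * Suc k) + 2 * j)"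
    "\<lambda>ws. f (grow w z (tau (length xs)) xs [0] ws) (grow w z (tau (length ys)) ys [0] ws)"]
  unfolding block_fits[OF assms] level_def by simp

lemma avg_total:
  assumes "real (length xs) * pass z (tau (length xs)) \<le> M"
  shows "avg (2 ^ w) (2 * (L * Suc k)) (\<lambda>sd. real (total sd xs)) \<le> real L * (\<Sum>j\<le>k. M ^ j)"
proof -
  have zw': "z \<le> w" using zw by simp
  have "avg (2 ^ w) (2 * (L * Suc k)) (\<lambda>sd. real (total sd xs)) =
    (\<Sum>r<L. \<Sum>j\<le>k. avg (2 ^ w) (2 * (L * Suc k)) (\<lambda>sd. real (length (level sd xs r j))))"
    unfolding total_def by (simp add: avg_sum)
  also have "\<dots> = (\<Sum>r<L. \<Sum>j\<le>k. (real (length xs) * pass z (tau (length xs))) ^ j)"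
  proof (intro sum.cong refl)
    fix r j assume "r \<in> {..<L}" "j \<in> {..k}"
    then have "r < L" "j \<le> k" by auto
    from avg_level[OF this, of "\<lambda>a b. real (length a)" xs xs]
    show "avg (2 ^ w) (2 * (L * Suc k)) (\<lambda>sd. real (length (level sd xs r j))) =
      (real (length xs) * pass z (tau (length xs))) ^ j"
      unfolding avg_length_grow[OF zw'] by simp
  qed
  also have "\<dots> \<le> (\<Sum>r<L. \<Sum>j\<le>k. M ^ j)"
    using assms pass_nonneg by (intro sum_mono power_mono) auto
  finally show ?thesis by simp
qed

text \<open>The repetitions are independent, and 8 (k + 1) failures of probability at most 1 - 1 /
  (2 k + 2) have joint probability at most exp (- 4), below 1 / 16. The choice of \<open>L\<close>
  is made for this.\<close>

lemma avg_no_survivor: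
  assumes "set cs \<subseteq> {..<2 ^ z}" "distinct cs" "real (length cs) * pass z \<tau> \<ge> 1"
    and eps: "\<epsilon> \<ge> 0" "1 \<le> pass z \<tau> * 2 ^ z * \<epsilon>" "\<epsilon> * (real k)\<^sup>2 \<le> 1" and Lk: "L = 8 * Suc k"
  shows "avg (2 ^ w) (2 * (L * Suc k)) (\<lambda>sd. \<Prod>r<L. of_bool (grow w z \<tau> cs [0] (take (2 * k) (drop (r * (2 * Suc k)) sd)) = [])) \<le> 1 / 16"
proof -
  define g where "g = (\<lambda>b. of_bool (grow w z \<tau> cs [0] (take (2 * k) b) = []) :: real)"
  have zw3: "3 * z \<le> w" using zw by simp
  have "1 / (2 * real k + 2) \<le> avg (2 ^ w) (2 * k) (\<lambda>ws. of_bool (grow w z \<tau> cs [0] ws \<noteq> []))"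
    using assms zw3 by (intro grow_survives) auto
  also have "\<dots> = avg (2 ^ w) (2 * k) (\<lambda>ws. 1 - of_bool (grow w z \<tau> cs [0] ws = []))"
    by (intro avg_cong) auto
  also have "\<dots> = 1 - avg (2 ^ w) (2 * k) (\<lambda>ws. of_bool (grow w z \<tau> cs [0] ws = []))"
    by (simp add: avg_diff)
  \<comment> \<open>Level \<open>k\<close> is not expanded, so the last two words of a block do not
    affect the event.\<close>
  also have "avg (2 ^ w) (2 * k) (\<lambda>ws. of_bool (grow w z \<tau> cs [0] ws = [])) = avg (2 ^ w) (2 * Suc k) g"
    using avg_block[of "2 ^ w" 0 "2 * k" 2 "\<lambda>ws. of_bool (grow w z \<tau> cs [0] ws = [])"] by (simp add: g_def)
  finally have le: "avg (2 ^ w) (2 * Suc k) g \<le> 1 - 1 / (2 * real k + 2)" by simp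
  have ge: "0 \<le> avg (2 ^ w) (2 * Suc k) g"
    using avg_mono[of "2 * Suc k" "2 ^ w" "\<lambda>_. 0" g] by (simp add: g_def)
  have "avg (2 ^ w) (2 * (L * Suc k)) (\<lambda>sd. \<Prod>r<L. of_bool (grow w z \<tau> cs [0] (take (2 * k) (drop (r * (2 * Suc k)) sd)) = [])) =
    avg (2 ^ w) (L * (2 * Suc k)) (\<lambda>sd. \<Prod>r<L. g (take (2 * Suc k) (drop (r * (2 * Suc k)) sd)))"
    by (simp add: g_def min_def mult.left_commute)
  also have "\<dots> = avg (2 ^ w) (2 * Suc k) g ^ L" by (rule avg_prod_blocks)
  also have "\<dots> \<le> (1 - 1 / (2 * real k + 2)) ^ L" using ge le by (rule power_mono[rotated])
  also have "\<dots> \<le> exp (- 1 / (2 * real k + 2)) ^ L"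
    using exp_ge_add_one_self[of "- 1 / (2 * real k + 2)"] by (intro power_mono) (auto simp: field_simps)
  also have "\<dots> = exp (- 4)"
    unfolding exp_of_nat_mult[symmetric] Lk by (simp add: field_simps)
  also have "\<dots> = (1 / exp 1) ^ 4" by (simp add: exp_minus power_one_over inverse_eq_divide flip: exp_of_nat_mult)
  also have "\<dots> \<le> (1 / 2) ^ 4" using exp_ge_add_one_self[of 1] by (intro power_mono divide_left_mono) auto
  also have "\<dots> = 1 / 16" by (simp add: power_one_over)
  finally show ?thesis .
qed

end

lemma exists_in_take:
  assumes "i \<in> set C" "P i" "length (filter (\<lambda>i. \<not> P i) C) < m"
  shows "\<exists>i\<in>set (take m C). P i"
proof (rule ccontr)
  assume none: "\<not> ?thesis"
  show False
  proof (cases "m \<le> length C")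
    case True
    have "filter (\<lambda>i. \<not> P i) (take m C) = take m C" using none by (intro filter_True) auto
    moreover have "length (filter (\<lambda>i. \<not> P i) C) = length (filter (\<lambda>i. \<not> P i) (take m C)) + length (filter (\<lambda>i. \<not> P i) (drop m C))"
      by (metis append_take_drop_id filter_append length_append)
    ultimately show False using True assms(3) by simp
  qed (use none assms in auto)
qed

context layout
begin

definition finds :: "nat list \<Rightarrow> nat \<Rightarrow> nat \<Rightarrow> nat list list \<Rightarrow> nat list \<Rightarrow> bool" where
  "finds sd fa fc xss ys \<longleftrightarrow>
    (\<exists>i\<in>set (take (40 * cap) (candidates (entries sd fa fc xss n) fa fc (queue sd ys))). accept ys (xss ! i))"

text \<open>A survivor of the shared process on \<open>cs\<close> is a leaf of both trees by
  \<open>set_grow_mono\<close>, hence in both queues as neither is truncated. The set is then a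
  candidate through the common bucket, and few rejections leave it within the budget.\<close>

lemma finds_of_survivor:
  assumes sd: "length sd = 2 * (L * Suc k)" and i: "i < n" "accept ys (xss ! i)"
    and t: "total sd (xss ! i) < cap" "total sd ys < cap"
    and r: "r < L" "grow w z (min (tau (length (xss ! i))) (tau (length ys))) cs [0] (take (2 * k) (drop (r * (2 * Suc k)) sd)) \<noteq> []"
    and cs: "set cs \<subseteq> set (xss ! i)" "set cs \<subseteq> set ys"
    and rj: "reject_count sd fa fc xss ys < 40 * cap"
  shows "finds sd fa fc xss ys"
proof -
  obtain v where v: "v \<in> set (grow w z (min (tau (length (xss ! i))) (tau (length ys))) cs [0] (take (2 * k) (drop (r * (2 * Suc k)) sd)))"
    using r(2) by (metis list.set_intros(1) neq_Nil_conv)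
  have vx: "v \<in> set (level sd (xss ! i) r k)" "v \<in> set (level sd ys r k)"
    unfolding level_def using v set_grow_mono[OF cs(1) min.cobounded1 subset_refl] set_grow_mono[OF cs(2) min.cobounded2 subset_refl]
    by blast+
  define p where "p = (r * Suc k + k, v)"
  have px: "p \<in> set (queue sd (xss ! i))" "p \<in> set (queue sd ys)" "is_leaf p"
    unfolding p_def using leaf_in_queue[OF sd t(1) r(1) vx(1)] leaf_in_queue[OF sd t(2) r(1) vx(2)] by blast+
  define es where "es = entries sd fa fc xss n"
  have "(bucket fa fc p, i) \<in> set es"
    unfolding es_def entries_def leaf_entries_def using px i by auto
  then have "i \<in># mset (chain es (bucket fa fc p) (length es))"
    unfolding mset_chain[OF le_refl] by (auto simp: image_iff intro!: bexI[of _ "(bucket fa fc p, i)"])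
  then have "i \<in> set (candidates es fa fc (queue sd ys))"
    unfolding candidates_def using px by auto
  then show ?thesis unfolding finds_def es_def[symmetric]
    by (rule exists_in_take) (use i rj in \<open>auto simp: reject_count_def es_def\<close>)
qed

text \<open>Failure is bounded pointwise by the sum \<open>bad\<close> of four terms, one per cause
  and at least 1 when that cause occurs, as in Markov's inequality. Their averages are at most 1/16,
  1/10, 1/10 and 3/40; \<open>S\<close> and \<open>T\<close> are the requirements on
  \<open>cap\<close> behind the last three.\<close>

lemma success_probability:
  fixes M \<eta> \<epsilon> :: real
  assumes xss: "\<And>i. i < n \<Longrightarrow> distinct (xss ! i) \<and> set (xss ! i) \<subseteq> {..<Z} \<and> length (xss ! i) \<le> d"
    and ys: "distinct ys" "set ys \<subseteq> {..<Z}" "length ys \<le> d"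
    and i0: "i0 < n" "accept ys (xss ! i0)"
    and M: "M \<ge> 1" "\<And>m. m \<le> d \<Longrightarrow> real m * pass z (tau m) \<le> M"
    and eta: "0 \<le> \<eta>" "\<eta> \<le> M" "\<And>i. i < n \<Longrightarrow> \<not> accept ys (xss ! i) \<Longrightarrow>
      coll (xss ! i) ys * pass z (min (tau (length (xss ! i))) (tau (length ys))) \<le> \<eta>"
    and close: "1 \<le> real (card (set (xss ! i0) \<inter> set ys)) * pass z (min (tau (length (xss ! i0))) (tau (length ys)))"
    and eps: "\<epsilon> \<ge> 0" "1 \<le> pass z (min (tau (length (xss ! i0))) (tau (length ys))) * 2 ^ z * \<epsilon>" "\<epsilon> * (real k)\<^sup>2 \<le> 1"
    and S: "10 * (real L * (\<Sum>j\<le>k. M ^ j)) \<le> real cap"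
    and T: "real L * (real n * (\<eta> ^ k + real k * (2 * M * M) ^ k * (real d * real d / 2 ^ z))) \<le> real cap"
    and Lk: "L = 8 * Suc k"
  shows "1 / 2 \<le> avg (2 ^ w) (2 * (L * Suc k) + 2)
    (\<lambda>ws. of_bool (finds (take (2 * (L * Suc k)) ws) (ws ! (2 * (L * Suc k))) (ws ! (2 * (L * Suc k) + 1)) xss ys))"
proof -
  define R where "R = 2 * (L * Suc k)"
  define xs where "xs = xss ! i0"
  define \<tau> where "\<tau> = min (tau (length xs)) (tau (length ys))"
  define cs where "cs = filter (\<lambda>i. i \<in> set ys) xs"
  have x0: "distinct xs" "set xs \<subseteq> {..<Z}" "length xs \<le> d" using xss[OF i0(1)] by (auto simp: xs_def)
  have cs: "set cs = set xs \<inter> set ys" "distinct cs" using x0 by (auto simp: cs_def)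
  then have lcs: "length cs = card (set xs \<inter> set ys)" by (metis distinct_card)
  have capp: "0 < cap" using L by simp
  define b1 where "b1 = (\<lambda>sd. \<Prod>r<L. of_bool (grow w z \<tau> cs [0] (take (2 * k) (drop (r * (2 * Suc k)) sd)) = []) :: real)"
  define bad where "bad = (\<lambda>sd f. b1 sd + (1 / real cap) * real (total sd xs) + (1 / real cap) * real (total sd ys) +
    (1 / (40 * real cap)) * real (reject_count sd (f ! 0) (f ! 1) xss ys))"
  have b1_nonneg: "0 \<le> b1 sd" for sd unfolding b1_def by (intro prod_nonneg) auto
  have pt: "1 - of_bool (finds sd (f ! 0) (f ! 1) xss ys) \<le> bad sd f" if sd: "length sd = R" for sd f
  proof (cases "finds sd (f ! 0) (f ! 1) xss ys")
    case True
    then show ?thesis using b1_nonneg[of sd] by (simp add: bad_def)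
  next
    case False
    have nn: "0 \<le> b1 sd" "0 \<le> (1 / real cap) * real (total sd xs)" "0 \<le> (1 / real cap) * real (total sd ys)"
      "0 \<le> (1 / (40 * real cap)) * real (reject_count sd (f ! 0) (f ! 1) xss ys)"
      using b1_nonneg by auto
    have "1 \<le> b1 sd \<or> cap \<le> total sd xs \<or> cap \<le> total sd ys \<or> 40 * cap \<le> reject_count sd (f ! 0) (f ! 1) xss ys"
    proof (rule ccontr)
      assume c: "\<not> ?thesis"
      have "\<exists>r<L. grow w z \<tau> cs [0] (take (2 * k) (drop (r * (2 * Suc k)) sd)) \<noteq> []"
      proof (rule ccontr)
        assume "\<not> ?thesis"
        then have "b1 sd = 1" unfolding b1_def by (intro prod.neutral) auto
        then show False using c by simp
      qed
      then obtain r where "r < L" "grow w z \<tau> cs [0] (take (2 * k) (drop (r * (2 * Suc k)) sd)) \<noteq> []" by blast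
      then have "finds sd (f ! 0) (f ! 1) xss ys"
        using c sd i0 cs by (intro finds_of_survivor[where r = r and cs = cs and i = i0]) (auto simp: R_def xs_def \<tau>_def)
      then show False using False by blast
    qed
    then have "1 \<le> bad sd f"
    proof (elim disjE)
      assume "1 \<le> b1 sd" then show ?thesis using nn unfolding bad_def by linarith
    next
      assume "cap \<le> total sd xs"
      then have "1 \<le> (1 / real cap) * real (total sd xs)" using capp by (simp add: field_simps)
      then show ?thesis using nn unfolding bad_def by linarith
    next
      assume "cap \<le> total sd ys"
      then have "1 \<le> (1 / real cap) * real (total sd ys)" using capp by (simp add: field_simps)
      then show ?thesis using nn unfolding bad_def by linarith
    next
      assume "40 * cap \<le> reject_count sd (f ! 0) (f ! 1) xss ys"
      then have "real (40 * cap) \<le> real (reject_count sd (f ! 0) (f ! 1) xss ys)" by (simp only: of_nat_le_iff)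
      then have "1 \<le> (1 / (40 * real cap)) * real (reject_count sd (f ! 0) (f ! 1) xss ys)" using capp by (simp add: field_simps)
      then show ?thesis using nn unfolding bad_def by linarith
    qed
    then show ?thesis using False by simp
  qed
  have E1: "avg (2 ^ w) R b1 \<le> 1 / 16"
    unfolding b1_def R_def
    by (rule avg_no_survivor) (use close eps cs x0 lcs Lk in \<open>auto simp: \<tau>_def xs_def Z_def\<close>)
  have E2: "(1 / real cap) * avg (2 ^ w) R (\<lambda>sd. real (total sd us)) \<le> 1 / 10" if "length us \<le> d" for us
  proof -
    have "10 * avg (2 ^ w) R (\<lambda>sd. real (total sd us)) \<le> real cap"
      using avg_total[OF M(2)[OF that]] S unfolding R_def by linarith
    then show ?thesis using capp by (simp add: field_simps)
  qed
  define Is where "Is = filter (\<lambda>i. \<not> accept ys (xss ! i)) [0..<n]"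
  \<comment> \<open>Bounds the expected coincidences of leaves of a rejected pair in one repetition:
    the genuine ones, and the accidental ones with growth rate \<open>2 * M * M\<close>, which
    dominates both \<open>M * M + \<eta>\<close> and 1.\<close>
  define K where "K = \<eta> ^ k + real k * (2 * M * M) ^ k * (real d * real d / 2 ^ z)"
  have K0: "0 \<le> K" using eta(1) M(1) by (simp add: K_def)
  have E3: "avg (2 ^ w) R (\<lambda>sd. coll (level sd (xss ! i) r k) (level sd ys r k)) \<le> K" if i: "i \<in> set Is" and r: "r < L" for i r
  proof -
    have i': "i < n" "\<not> accept ys (xss ! i)" using i by (auto simp: Is_def)
    define us where "us = xss ! i"
    have us: "distinct us" "set us \<subseteq> {..<2 ^ z}" "length us \<le> d" using xss[OF i'(1)] by (auto simp: us_def Z_def)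
    have zw3: "3 * z \<le> w" using zw by simp
    have c1: "coll [0] [0] = 1" by (simp add: coll_def)
    have pass1: "pass z t \<le> 1" for t by (simp add: pass_def)
    have D: "real (length us) * real (length ys) * pass z (min (tau (length us)) (tau (length ys))) / 2 ^ z \<le> real d * real d / 2 ^ z"
    proof (intro divide_right_mono)
      have "real (length us) * real (length ys) * pass z (min (tau (length us)) (tau (length ys))) \<le> real d * real d * 1"
        using us ys pass1 pass_nonneg by (intro mult_mono) auto
      then show "real (length us) * real (length ys) * pass z (min (tau (length us)) (tau (length ys))) \<le> real d * real d" by simp
    qed simp
    have "(real (length us) * pass z (tau (length us))) * (real (length ys) * pass z (tau (length ys))) \<le> M * M"
      using M us ys pass_nonneg by (intro mult_mono) auto
    moreover have "\<eta> \<le> M * M" using eta(2) M(1) mult_right_mono[of 1 M M] by linarith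
    ultimately have G: "(real (length us) * pass z (tau (length us))) * (real (length ys) * pass z (tau (length ys))) + \<eta> \<le> 2 * M * M"
      by linarith
    have G1: "1 \<le> 2 * M * M" "\<eta> \<le> 2 * M * M" using mult_mono[of 1 M 1 M] M(1) \<open>\<eta> \<le> M * M\<close> by linarith+
    have "avg (2 ^ w) (2 * k) (\<lambda>ws. coll (grow w z (tau (length us)) us [0] ws) (grow w z (tau (length ys)) ys [0] ws)) \<le>
      \<eta> ^ k * coll [0] [0] + real k * (2 * M * M) ^ k * (real d * real d / 2 ^ z) * (real (length [0::nat]) * real (length [0::nat]))"
      using us ys zw3 eta(3)[OF i', folded us_def] D G G1 by (intro avg_coll_grow) (auto simp: Z_def)
    then show ?thesis
      unfolding R_def avg_level[OF r le_refl, of coll] us_def[symmetric] by (simp add: K_def c1)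
  qed
  have E4: "avg (2 ^ w) R (\<lambda>sd. avg (2 ^ w) 2 (\<lambda>f. real (reject_count sd (f ! 0) (f ! 1) xss ys))) \<le> 3 * real cap"
  proof -
    have "avg (2 ^ w) R (\<lambda>sd. avg (2 ^ w) 2 (\<lambda>f. real (reject_count sd (f ! 0) (f ! 1) xss ys))) \<le>
      avg (2 ^ w) R (\<lambda>sd. (\<Sum>i\<leftarrow>Is. \<Sum>r<L. coll (level sd (xss ! i) r k) (level sd ys r k)) + 2 * real cap)"
      unfolding Is_def by (intro avg_mono avg_reject_count) (simp add: R_def)
    also have "\<dots> = (\<Sum>i\<leftarrow>Is. \<Sum>r<L. avg (2 ^ w) R (\<lambda>sd. coll (level sd (xss ! i) r k) (level sd ys r k))) + 2 * real cap"
      by (simp add: avg_add avg_sum_list avg_sum)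
    also have "\<dots> \<le> (\<Sum>i\<leftarrow>Is. \<Sum>r<L. K) + 2 * real cap"
      using E3 by (intro add_right_mono sum_list_mono sum_mono) auto
    also have "(\<Sum>i\<leftarrow>Is. \<Sum>r<L. K) = real (length Is) * (real L * K)" by (simp add: sum_list_triv)
    also have "\<dots> \<le> real n * (real L * K)"
      using K0 length_filter_le[of _ "[0..<n]"] by (intro mult_right_mono) (auto simp: Is_def)
    also have "\<dots> \<le> real cap" using T by (simp add: K_def mult_ac)
    finally show ?thesis by simp
  qed
  have "avg (2 ^ w) (R + 2) (\<lambda>ws. of_bool (finds (take R ws) (ws ! R) (ws ! (R + 1)) xss ys)) =
    avg (2 ^ w) R (\<lambda>sd. avg (2 ^ w) 2 (\<lambda>f. of_bool (finds sd (f ! 0) (f ! 1) xss ys)))"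
    unfolding avg_append by (intro avg_cong) (simp add: nth_append)
  also have "\<dots> \<ge> avg (2 ^ w) R (\<lambda>sd. avg (2 ^ w) 2 (\<lambda>f. 1 - bad sd f))"
  proof (intro avg_mono)
    fix sd f :: "nat list"
    assume "length sd = R"
    from pt[OF this, of f] show "1 - bad sd f \<le> of_bool (finds sd (f ! 0) (f ! 1) xss ys)" by linarith
  qed
  moreover have "avg (2 ^ w) R (\<lambda>sd. avg (2 ^ w) 2 (\<lambda>f. 1 - bad sd f)) =
    1 - (avg (2 ^ w) R b1 + (1 / real cap) * avg (2 ^ w) R (\<lambda>sd. real (total sd xs)) + (1 / real cap) * avg (2 ^ w) R (\<lambda>sd. real (total sd ys)) +
    (1 / (40 * real cap)) * avg (2 ^ w) R (\<lambda>sd. avg (2 ^ w) 2 (\<lambda>f. real (reject_count sd (f ! 0) (f ! 1) xss ys))))"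
    unfolding bad_def by (simp only: avg_diff avg_add avg_cmult avg_const zero_less_power zero_less_numeral)
  moreover have "(1 / (40 * real cap)) * avg (2 ^ w) R (\<lambda>sd. avg (2 ^ w) 2 (\<lambda>f. real (reject_count sd (f ! 0) (f ! 1) xss ys))) \<le> 3 / 40"
    using E4 capp by (simp add: field_simps)
  ultimately have "1 / 2 \<le> avg (2 ^ w) (R + 2) (\<lambda>ws. of_bool (finds (take R ws) (ws ! R) (ws ! (R + 1)) xss ys))"
    using E1 E2[OF x0(3)] E2[OF ys(3)] by linarith
  then show ?thesis unfolding R_def .
qed

section \<open>Thresholds and branching factors\<close>

lemma pass_tau_le:
  assumes "m \<le> d"
  shows "real m * pass z (tau m) \<le> real Z / real B1 + real d / real Z"
proof (cases "m = 0")
  case False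
  have "real (Z * Z div (B1 * m)) \<le> real (Z * Z) / real (B1 * m)" by (rule of_nat_div_le_of_nat)
  then have "real (tau m) \<le> real Z * real Z / (real B1 * real m) + 1" by (simp add: tau_def)
  moreover have "pass z (tau m) \<le> real (tau m) / real Z" by (simp add: pass_def Z_def divide_right_mono)
  ultimately have "pass z (tau m) \<le> (real Z * real Z / (real B1 * real m) + 1) / real Z"
    by (meson divide_right_mono of_nat_0_le_iff order_trans)
  then have "real m * pass z (tau m) \<le> real m * ((real Z * real Z / (real B1 * real m) + 1) / real Z)"
    by (intro mult_left_mono) auto
  also have "\<dots> = real Z / real B1 + real m / real Z" using False B1 Z_ge by (simp add: field_simps)
  also have "\<dots> \<le> real Z / real B1 + real d / real Z" using assms by (intro add_left_mono divide_right_mono) auto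
  finally show ?thesis .
qed simp

text \<open>A rejected pair shares at most \<open>B2 / Z\<close> times the larger size, and the
  smaller threshold is at most that of the larger set; the bound of \<open>pass_tau_le\<close> is
  thus scaled by \<open>B2 / Z\<close>.\<close>

lemma pass_tau_reject:
  assumes xs: "distinct xs" "length xs \<le> d" and ys: "distinct ys" "length ys \<le> d" and rej: "\<not> accept ys xs"
  shows "coll xs ys * pass z (min (tau (length xs)) (tau (length ys))) \<le>
    real B2 / real Z * (real Z / real B1 + real d / real Z)"
proof -
  define m where "m = max (length xs) (length ys)"
  have m: "m \<le> d" using assms by (simp add: m_def)
  have c: "coll xs ys = real (card (set xs \<inter> set ys))" using xs ys by (simp add: coll_distinct)
  have "card (set xs \<inter> set ys) * Z \<le> B2 * m"
  proof -
    have "B2 * length xs \<le> B2 * m" "B2 * length ys \<le> B2 * m" by (auto simp: m_def)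
    then show ?thesis using rej unfolding accept_def by linarith
  qed
  then have "real (card (set xs \<inter> set ys)) * real Z \<le> real B2 * real m" by (metis of_nat_le_iff of_nat_mult)
  then have "coll xs ys \<le> real B2 / real Z * real m" using Z_ge by (simp add: c field_simps)
  moreover have "pass z (min (tau (length xs)) (tau (length ys))) \<le> pass z (tau m)"
    by (auto simp: pass_def m_def max_def intro!: divide_right_mono)
  ultimately have "coll xs ys * pass z (min (tau (length xs)) (tau (length ys))) \<le> real B2 / real Z * real m * pass z (tau m)"
    using pass_nonneg coll_nonneg by (intro mult_mono) auto
  also have "\<dots> = real B2 / real Z * (real m * pass z (tau m))" by simp
  also have "\<dots> \<le> real B2 / real Z * (real Z / real B1 + real d / real Z)"
    using pass_tau_le[OF m] by (intro mult_left_mono) auto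
  finally show ?thesis .
qed

lemma tau_ge: "m > 0 \<Longrightarrow> real Z * real Z / (real B1 * real m) \<le> real (tau m)"
proof -
  assume m: "m > 0"
  have "Z * Z < (Z * Z div (B1 * m) + 1) * (B1 * m)"
    using m B1 dividend_less_div_times[of "B1 * m" "Z * Z"] by (simp add: algebra_simps)
  then have "real Z * real Z \<le> real (tau m) * (real B1 * real m)"
    unfolding tau_def by (metis less_imp_le of_nat_le_iff of_nat_mult)
  then show ?thesis using m B1 by (simp add: field_simps)
qed

text \<open>Both thresholds are at least \<open>Z * Z / (B1 * mx)\<close> for the larger size
  \<open>mx\<close>, and \<open>B1\<close> is rounded down, so \<open>c\<close> common elements give
  branching factor at least 1. If the threshold reaches the hash range, every element passes and
  \<open>c \<ge> 1\<close> suffices. The second claim allows \<open>d / Z\<close> as the collision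
  rate \<open>\<epsilon>\<close> of the survival argument.\<close>

lemma pass_tau_close:
  fixes b1 :: real
  assumes b1: "real B1 \<le> b1 * real Z" and xs: "0 < length xs" "length xs \<le> d" and ys: "0 < length ys" "length ys \<le> d"
    and c: "b1 * real (max (length xs) (length ys)) \<le> c" "1 \<le> c"
  shows "1 \<le> c * pass z (min (tau (length xs)) (tau (length ys)))"
    and "1 \<le> pass z (min (tau (length xs)) (tau (length ys))) * 2 ^ z * (real d / real Z)"
proof -
  define \<tau> where "\<tau> = min (tau (length xs)) (tau (length ys))"
  define mx where "mx = max (length xs) (length ys)"
  have mx: "0 < mx" "mx \<le> d" using xs ys by (auto simp: mx_def less_max_iff_disj)
  have t: "real Z * real Z / (real B1 * real mx) \<le> real \<tau>"
  proof -
    have "real Z * real Z / (real B1 * real mx) \<le> real (tau m)" if "0 < m" "m \<le> mx" for m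
    proof -
      have "real Z * real Z / (real B1 * real mx) \<le> real Z * real Z / (real B1 * real m)"
        using that B1 by (intro divide_left_mono mult_left_mono) auto
      then show ?thesis using tau_ge[OF that(1)] by linarith
    qed
    from this[of "length xs"] this[of "length ys"] show ?thesis using xs ys by (auto simp: \<tau>_def mx_def min_def)
  qed
  have B1p: "0 < real B1" "0 < real mx" "0 < real Z" using B1 mx Z_ge by auto
  have pz: "pass z \<tau> = min (real \<tau>) (real Z) / real Z" by (simp add: pass_def Z_def of_nat_min)
  show "1 \<le> c * pass z (min (tau (length xs)) (tau (length ys)))"
  proof (cases "Z \<le> \<tau>")
    case True
    then have "pass z \<tau> = 1" using pz B1p by (simp add: min_absorb2)
    then show ?thesis using c by (simp add: \<tau>_def)
  next
    case False
    then have p: "pass z \<tau> = real \<tau> / real Z" using pz by simp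
    have "real Z / (real B1 * real mx) \<le> pass z \<tau>" unfolding p using t B1p by (simp add: field_simps)
    moreover have "real B1 * real mx / real Z \<le> c"
    proof -
      have "real B1 * real mx / real Z \<le> b1 * real Z * real mx / real Z"
        using b1 B1p by (intro divide_right_mono mult_right_mono) auto
      also have "\<dots> = b1 * real mx" using B1p by simp
      finally show ?thesis using c by (simp add: mx_def)
    qed
    ultimately have "(real B1 * real mx / real Z) * (real Z / (real B1 * real mx)) \<le> c * pass z \<tau>"
      using B1p c by (intro mult_mono) auto
    then show ?thesis using B1p by (simp add: \<tau>_def)
  qed
  have "real Z / real d \<le> min (real \<tau>) (real Z)"
  proof (intro min.boundedI)
    have "real B1 \<le> real Z" using B1(2) by (simp add: Z_def)
    then have "real B1 * real mx \<le> real Z * real d" using mx by (intro mult_mono) auto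
    then have "real Z * real Z / (real Z * real d) \<le> real Z * real Z / (real B1 * real mx)"
      using B1p mx by (intro divide_left_mono) auto
    then show "real Z / real d \<le> real \<tau>" using t B1p by simp
    show "real Z / real d \<le> real Z" using mx B1p by (simp add: field_simps)
  qed
  then have "(real Z / real d) * (real d / real Z) \<le> min (real \<tau>) (real Z) * (real d / real Z)" by (intro mult_right_mono) auto
  then show "1 \<le> pass z (min (tau (length xs)) (tau (length ys))) * 2 ^ z * (real d / real Z)"
    using mx B1p pz by (simp add: \<tau>_def[symmetric] Z_def)
qed

end

subsection \<open>Depth and branching factor\<close>

text \<open>Rounding to \<open>w\<close> bits and then dropping \<open>w - z\<close> of them is the
  same as rounding to \<open>z\<close> bits at once.\<close>

lemma floor_div_bounds:
  fixes b :: real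
  assumes "0 \<le> b" "z \<le> w"
  shows "real (fixed_point w b div 2 ^ (w - z)) \<le> b * 2 ^ z" "b * 2 ^ z < real (fixed_point w b div 2 ^ (w - z)) + 1"
proof -
  define F G q where "F = fixed_point w b" and "G = (2::nat) ^ (w - z)" and "q = F div G"
  have WG: "(2::real) ^ w = 2 ^ z * real G" using assms(2) by (simp add: G_def flip: power_add)
  have G0: "0 < real G" by (simp add: G_def)
  have F: "real F \<le> b * 2 ^ w" "b * 2 ^ w < real F + 1"
    using assms(1) by (auto simp: F_def fixed_point_def)
  have "q * G \<le> F" "Suc F \<le> (q + 1) * G"
    using dividend_less_div_times[of G F] G0 by (auto simp: q_def G_def)
  then have "real q * real G \<le> real F" "real F + 1 \<le> (real q + 1) * real G"
    by (metis of_nat_le_iff of_nat_mult) (metis \<open>Suc F \<le> (q + 1) * G\<close> of_nat_1 of_nat_Suc of_nat_add of_nat_le_iff of_nat_mult add.commute)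
  then have "real q * real G \<le> (b * 2 ^ z) * real G" "(b * 2 ^ z) * real G < (real q + 1) * real G"
    using F by (auto simp: WG mult_ac)
  then have "real q \<le> b * 2 ^ z" "b * 2 ^ z < real q + 1" using G0 by auto
  then show "real (fixed_point w b div 2 ^ (w - z)) \<le> b * 2 ^ z" "b * 2 ^ z < real (fixed_point w b div 2 ^ (w - z)) + 1"
    by (simp_all add: q_def F_def G_def)
qed

lemma scaled_pow_upper:
  assumes "0 < B"
  shows "real (scaled_pow Z B j) \<le> real Z * (real Z / real B) ^ j"
proof (induction j)
  case (Suc j)
  have "real (scaled_pow Z B j * Z div B) \<le> real (scaled_pow Z B j * Z) / real B" by (rule of_nat_div_le_of_nat)
  also have "\<dots> \<le> (real Z * (real Z / real B) ^ j) * real Z / real B"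
    using Suc assms by (auto intro!: divide_right_mono mult_right_mono)
  finally show ?case by (simp add: mult_ac)
qed simp

text \<open>Every division loses less than 1, which is at most one unit of (Z / B) ^ (j + 1); the
  losses add up to at most \<open>j\<close> such units.\<close>

lemma scaled_pow_lower:
  assumes "0 < B" "B \<le> Z"
  shows "(real Z - real j) * (real Z / real B) ^ j \<le> real (scaled_pow Z B j)"
proof (induction j)
  case (Suc j)
  have p1: "1 \<le> (real Z / real B) ^ Suc j" using assms by (intro one_le_power) simp
  define m where "m = scaled_pow Z B j * Z"
  have "m < (m div B + 1) * B" using dividend_less_div_times[of B m] assms by (simp add: algebra_simps)
  then have "real m \<le> (real (m div B) + 1) * real B"
    by (metis less_imp_le of_nat_1 of_nat_add of_nat_le_iff of_nat_mult)
  then have "real m / real B - 1 \<le> real (m div B)" using assms by (simp add: field_simps)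
  moreover have "(real Z - real j) * (real Z / real B) ^ Suc j \<le> real m / real B"
  proof -
    have "(real Z - real j) * (real Z / real B) ^ j * (real Z / real B) \<le> real (scaled_pow Z B j) * (real Z / real B)"
      using Suc by (intro mult_right_mono) auto
    then show ?thesis by (simp add: m_def mult_ac)
  qed
  ultimately have "(real Z - real j) * (real Z / real B) ^ Suc j - (real Z / real B) ^ Suc j \<le> real (m div B)" using p1 by linarith
  then have "(real Z - real (Suc j)) * (real Z / real B) ^ Suc j \<le> real (m div B)"
    by (simp only: of_nat_Suc left_diff_distrib distrib_right mult_1_left)
  then show ?case by (simp only: m_def scaled_pow.simps)
qed simp

lemma scaled_pow_half:
  assumes "0 < B" "B \<le> Z" "2 * j \<le> Z"
  shows "real Z / 2 * (real Z / real B) ^ j \<le> real (scaled_pow Z B j)"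
proof -
  have "real (2 * j) \<le> real Z" using assms(3) by (simp only: of_nat_le_iff)
  then have "real Z / 2 \<le> real Z - real j" by simp
  then have "real Z / 2 * (real Z / real B) ^ j \<le> (real Z - real j) * (real Z / real B) ^ j"
    by (intro mult_right_mono) auto
  then show ?thesis using scaled_pow_lower[OF assms(1,2), of j] by linarith
qed

text \<open>\<open>\<gamma> < 1\<close> is a fixed bound on \<open>B / Z\<close>, so the depth is
  logarithmic whatever the rounding. The target 2 n in place of n compensates the factor 1 / 2 of
  \<open>scaled_pow_half\<close>.\<close>

lemma depth_exists:
  fixes \<gamma> :: real
  assumes B: "0 < B" "real B \<le> \<gamma> * real Z" "0 < \<gamma>" "\<gamma> < 1" and n: "2 \<le> n"
    and J: "J = nat \<lceil>log (1 / \<gamma>) (2 * real n)\<rceil>" "2 * J \<le> Z"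
  shows "\<exists>k. 1 \<le> k \<and> k \<le> J \<and> (\<forall>j<k. scaled_pow Z B j < n * Z) \<and> n * Z \<le> scaled_pow Z B k"
proof -
  have Zp: "0 < real Z" using B by (cases Z) auto
  have "real B \<le> 1 * real Z" using B Zp by (meson less_imp_le mult_right_mono of_nat_0_le_iff order_trans)
  then have BZ: "B \<le> Z" by simp
  have g1: "1 < 1 / \<gamma>" using B by simp
  have "log (1 / \<gamma>) (2 * real n) \<le> real J" unfolding J by linarith
  then have "2 * real n \<le> (1 / \<gamma>) powr real J" using g1 n by (simp add: log_le_iff)
  also have "\<dots> = (1 / \<gamma>) ^ J" using g1 by (intro powr_realpow) linarith
  also have "\<dots> \<le> (real Z / real B) ^ J" using B Zp by (intro power_mono) (auto simp: field_simps)
  finally have "real Z / 2 * (2 * real n) \<le> real Z / 2 * (real Z / real B) ^ J" by (intro mult_left_mono) auto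
  also have "\<dots> \<le> real (scaled_pow Z B J)" by (rule scaled_pow_half[OF B(1) BZ J(2)])
  finally have "real (n * Z) \<le> real (scaled_pow Z B J)" by (simp add: mult_ac)
  then have JJ: "n * Z \<le> scaled_pow Z B J" by (simp only: of_nat_le_iff)
  define k where "k = (LEAST j. n * Z \<le> scaled_pow Z B j)"
  have k1: "n * Z \<le> scaled_pow Z B k" unfolding k_def using JJ by (rule LeastI)
  have "k \<le> J" unfolding k_def using JJ by (rule Least_le)
  moreover have "\<forall>j<k. scaled_pow Z B j < n * Z" unfolding k_def using not_less_Least by force
  moreover have "1 \<le> k"
  proof (rule ccontr)
    assume "\<not> 1 \<le> k"
    then have "n * Z \<le> Z" using k1 by (simp add: not_le)
    then show False using n Zp by simp
  qed
  ultimately show ?thesis using k1 by blast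
qed

lemma power_one_plus_le:
  fixes x :: real
  assumes "0 \<le> x" "real k * x \<le> 1"
  shows "(1 + x) ^ k \<le> 3"
proof -
  have "(1 + x) ^ k \<le> exp x ^ k" using assms exp_ge_add_one_self[of x] by (intro power_mono) auto
  also have "\<dots> = exp (real k * x)" by (simp add: exp_of_nat_mult)
  also have "\<dots> \<le> exp 1" using assms by simp
  also have "\<dots> \<le> 3" by (rule exp_le)
  finally show ?thesis .
qed

text \<open>\<open>big\<close> makes Z large enough for rounding errors to stay within constant
  factors after \<open>k\<close> multiplications; \<open>depth\<close> is the stopping rule of the
  depth loop.\<close>

locale depth_params =
  fixes b1 b2 \<rho> :: real and n d Z B1 B2 k :: nat
  assumes b: "0 < b2" "b2 < b1" "b1 < 1" and rho: "\<rho> = ln (1 / b1) / ln (1 / b2)"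
    and n: "2 \<le> n" and k: "1 \<le> k" and Zp: "0 < Z"
    and B1: "real B1 \<le> b1 * real Z" "b1 * real Z < real B1 + 1"
    and B2: "b2 * real Z < real B2" "real B2 \<le> b2 * real Z + 1"
    and big: "2 * real k \<le> real Z" "real k \<le> b2 * real Z" "real k * (2 / b1 + real d) \<le> real Z" "2 \<le> b1 * real Z" "B2 \<le> Z"
    and depth: "scaled_pow Z B2 (k - 1) < n * Z" "n * Z \<le> scaled_pow Z B2 k"
begin

text \<open>Bound on the branching factor of every set: \<open>Z / B1\<close> from the threshold and
  \<open>d / Z\<close> from its upward rounding.\<close>

definition "M = real Z / real B1 + real d / real Z"

lemma B_pos: "0 < B1" "0 < B2" "B1 \<le> Z"
proof -
  show "0 < B1" using B1(2) big(4) by (cases B1) auto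
  show "0 < B2" using B2(1) b Zp by (cases B2) (auto simp: mult_less_0_iff)
  have "b1 * real Z \<le> 1 * real Z" using b by (intro mult_right_mono) auto
  then show "B1 \<le> Z" using B1(1) by simp
qed

lemma ratio_ge: "1 / b1 \<le> real Z / real B1"
  using B1(1) B_pos b Zp by (simp add: field_simps)

lemma M_ge: "1 / b1 \<le> M" "1 \<le> M"
proof -
  show 1: "1 / b1 \<le> M" using ratio_ge by (simp add: M_def add_increasing2)
  have "1 \<le> 1 / b1" using b by simp
  then show "1 \<le> M" using 1 by linarith
qed

text \<open>The stopping rule makes \<open>k\<close> large enough for \<open>n\<close> rejected sets
  together to share with the query about as many paths as one set has, namely
  \<open>M ^ k\<close>.\<close>

lemma reject_decay: "real n * (real B2 / real Z) ^ k \<le> 1"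
proof -
  have "real n * real Z \<le> real (scaled_pow Z B2 k)" using depth(2) by (metis of_nat_le_iff of_nat_mult)
  also have "\<dots> \<le> real Z * (real Z / real B2) ^ k" by (rule scaled_pow_upper[OF B_pos(2)])
  finally have "real n \<le> (real Z / real B2) ^ k" using Zp by simp
  then have "real n * (real B2 / real Z) ^ k \<le> (real Z / real B2) ^ k * (real B2 / real Z) ^ k"
    by (intro mult_right_mono) auto
  also have "\<dots> = 1" using B_pos Zp by (simp flip: power_mult_distrib)
  finally show ?thesis .
qed

text \<open>The loop had not stopped at \<open>k - 1\<close>. The 6 is 2 for fixed-point rounding
  times 3 for replacing \<open>B2 / Z\<close> by b2.\<close>

lemma inverse_b2_pow: "(1 / b2) ^ (k - 1) \<le> 6 * real n"
proof -
  have "real Z / 2 * (real Z / real B2) ^ (k - 1) \<le> real (scaled_pow Z B2 (k - 1))"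
    using B_pos big by (intro scaled_pow_half) auto
  also have "\<dots> \<le> real n * real Z" using depth(1) by (metis less_imp_le of_nat_le_iff of_nat_mult)
  finally have "real Z * (real Z / real B2) ^ (k - 1) \<le> real Z * (2 * real n)" by (simp add: mult_ac)
  then have 1: "(real Z / real B2) ^ (k - 1) \<le> 2 * real n" using Zp by simp
  have "real B2 / (b2 * real Z) \<le> 1 + 1 / (b2 * real Z)" using B2(2) b Zp by (simp add: field_simps)
  moreover have "(1 + 1 / (b2 * real Z)) ^ (k - 1) \<le> 3"
    using b Zp big(2) k by (intro power_one_plus_le) (auto simp: field_simps of_nat_diff)
  ultimately have 2: "(real B2 / (b2 * real Z)) ^ (k - 1) \<le> 3"
    using b by (meson divide_nonneg_nonneg less_imp_le mult_nonneg_nonneg of_nat_0_le_iff order_trans power_mono)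
  have "1 / b2 = (real Z / real B2) * (real B2 / (b2 * real Z))" using B_pos Zp by simp
  then have "(1 / b2) ^ (k - 1) = (real Z / real B2) ^ (k - 1) * (real B2 / (b2 * real Z)) ^ (k - 1)"
    by (simp only: power_mult_distrib)
  also have "\<dots> \<le> (2 * real n) * 3" using 1 2 b by (intro mult_mono) auto
  finally show ?thesis by simp
qed

lemma rho_bounds: "0 < \<rho>" "\<rho> < 1"
proof -
  have "0 < ln (1 / b1)" "ln (1 / b1) < ln (1 / b2)" using b by (auto simp: ln_div)
  then show "0 < \<rho>" "\<rho> < 1" by (auto simp: rho)
qed

text \<open>The definition of \<open>\<rho>\<close> says that 1 / b1 = (1 / b2) powr
  \<open>\<rho>\<close>, so the bound on the power of 1 / b2 transfers; the last level costs one
  more factor 1 / b1.\<close>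

lemma inverse_b1_pow: "(1 / b1) ^ k \<le> 6 / b1 * real n powr \<rho>"
proof -
  have "(1 / b1) = (1 / b2) powr \<rho>"
    using b by (simp add: rho powr_def)
  then have "(1 / b1) ^ (k - 1) = ((1 / b2) powr \<rho>) powr real (k - 1)" using b by (simp add: powr_realpow)
  also have "\<dots> = ((1 / b2) ^ (k - 1)) powr \<rho>" using b by (simp add: powr_powr mult.commute flip: powr_realpow)
  also have "\<dots> \<le> (6 * real n) powr \<rho>" using inverse_b2_pow rho_bounds b by (intro powr_mono2) auto
  also have "\<dots> = 6 powr \<rho> * real n powr \<rho>" by (simp add: powr_mult)
  also have "\<dots> \<le> 6 powr 1 * real n powr \<rho>" using rho_bounds by (intro mult_right_mono powr_mono) auto
  finally have "(1 / b1) ^ (k - 1) \<le> 6 * real n powr \<rho>" by simp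
  then have "(1 / b1) * (1 / b1) ^ (k - 1) \<le> (1 / b1) * (6 * real n powr \<rho>)" using b by (intro mult_left_mono) auto
  moreover have "(1 / b1) ^ k = (1 / b1) * (1 / b1) ^ (k - 1)" using k by (metis Suc_diff_1 less_le_trans power_Suc zero_less_one)
  ultimately show ?thesis by simp
qed

lemma M_le: "M \<le> (1 / b1) * (1 + (2 / b1 + real d) / real Z)"
proof -
  have "real Z / real B1 \<le> (1 / b1) * (1 + 2 / (b1 * real Z))"
  proof -
    have "(b1 * real Z) * (b1 * real Z) \<le> (b1 * real Z + 2) * (b1 * real Z - 1)"
      using big(4) by (simp add: algebra_simps)
    also have "\<dots> \<le> (b1 * real Z + 2) * real B1" using B1(2) big(4) by (intro mult_left_mono) auto
    finally have "(b1 * real Z) * (b1 * real Z) \<le> (b1 * real Z + 2) * real B1" .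
    then show ?thesis using b Zp B_pos by (simp add: field_simps)
  qed
  moreover have "real d / real Z \<le> (1 / b1) * (real d / real Z)"
    using b mult_right_mono[of 1 "1 / b1" "real d / real Z"] by simp
  ultimately have "M \<le> (1 / b1) * (1 + 2 / (b1 * real Z)) + (1 / b1) * (real d / real Z)" by (simp add: M_def)
  also have "\<dots> = (1 / b1) * (1 + (2 / b1 + real d) / real Z)" using b Zp by (simp add: field_simps)
  finally show ?thesis .
qed

lemma M_pow: "M ^ k \<le> 18 / b1 * real n powr \<rho>"
proof -
  have "M ^ k \<le> ((1 / b1) * (1 + (2 / b1 + real d) / real Z)) ^ k" using M_le M_ge by (intro power_mono) auto
  also have "\<dots> = (1 / b1) ^ k * (1 + (2 / b1 + real d) / real Z) ^ k" by (simp only: power_mult_distrib)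
  also have "\<dots> \<le> (6 / b1 * real n powr \<rho>) * 3"
    using inverse_b1_pow b big(3) Zp by (intro mult_mono power_one_plus_le) (auto simp: field_simps)
  finally show ?thesis by simp
qed

text \<open>Growth by at least 1 / b1 per level makes the sum geometric, with the last level
  dominant.\<close>

lemma M_pow_sum: "(\<Sum>j\<le>i. M ^ j) \<le> M ^ i / (1 - b1)"
proof (induction i)
  case 0
  show ?case using b by (simp add: field_simps)
next
  case (Suc i)
  have M0: "0 < M" using M_ge by linarith
  have "1 \<le> b1 * M" using M_ge(1) b by (simp add: field_simps)
  then have "M ^ i * 1 \<le> M ^ i * (b1 * M)" using M0 by (intro mult_left_mono) auto
  then have "M ^ i \<le> b1 * M ^ Suc i" by (simp add: mult_ac)
  then have "M ^ i / (1 - b1) \<le> b1 * M ^ Suc i / (1 - b1)" using b by (intro divide_right_mono) auto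
  then have "(\<Sum>j\<le>Suc i. M ^ j) \<le> b1 * M ^ Suc i / (1 - b1) + M ^ Suc i" using Suc by simp
  also have "\<dots> = M ^ Suc i / (1 - b1)" using b by (simp add: field_simps)
  finally show ?case .
qed

lemma ratio_pow_le: "(real Z / real B1) ^ j \<le> M ^ j"
  by (intro power_mono) (auto simp: M_def)

lemma scaled_B1_upper: "real (scaled_pow Z B1 j) \<le> real Z * M ^ j"
  using scaled_pow_upper[OF B_pos(1), of Z j] mult_left_mono[OF ratio_pow_le[of j], of "real Z"] by simp

text \<open>The program derives its queue bound from fixed-point powers; this certifies that it is
  not too small. Of the 6, a factor 3 pays for \<open>d / Z\<close> in \<open>M\<close> and a factor
  2 for rounding.\<close>

lemma scaled_B1_lower: "M ^ k \<le> 6 * real (scaled_pow Z B1 k div Z + 1)"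
proof -
  have "M = (real Z / real B1) * (1 + real B1 / real Z * (real d / real Z))"
    using B_pos Zp by (simp add: M_def field_simps)
  also have "\<dots> \<le> (real Z / real B1) * (1 + real d / real Z)"
    using B_pos Zp mult_right_mono[of "real B1 / real Z" 1 "real d / real Z"] by (intro mult_left_mono) auto
  finally have "M ^ k \<le> ((real Z / real B1) * (1 + real d / real Z)) ^ k" using M_ge by (intro power_mono) auto
  also have "\<dots> = (real Z / real B1) ^ k * (1 + real d / real Z) ^ k" by (simp only: power_mult_distrib)
  also have "\<dots> \<le> (real Z / real B1) ^ k * 3"
  proof (intro mult_left_mono power_one_plus_le)
    have "real k * real d \<le> real k * (2 / b1 + real d)" using b by (intro mult_left_mono) auto
    then have "real k * real d \<le> real Z" using big(3) by linarith
    then show "real k * (real d / real Z) \<le> 1" using Zp by (simp add: field_simps)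
  qed auto
  finally have 1: "M ^ k \<le> 3 * (real Z / real B1) ^ k" by simp
  have "real Z / 2 * (real Z / real B1) ^ k \<le> real (scaled_pow Z B1 k)" using B_pos big by (intro scaled_pow_half) auto
  also have "\<dots> \<le> real ((scaled_pow Z B1 k div Z + 1) * Z)"
    using dividend_less_div_times[of Z "scaled_pow Z B1 k"] Zp by (simp only: of_nat_le_iff) (simp add: algebra_simps)
  finally have "real Z * (real Z / real B1) ^ k \<le> real Z * (2 * real (scaled_pow Z B1 k div Z + 1))" by (simp add: algebra_simps)
  then have "(real Z / real B1) ^ k \<le> 2 * real (scaled_pow Z B1 k div Z + 1)" using Zp by simp
  then show ?thesis using 1 by linarith
qed

end

subsection \<open>Correctness of the data structure\<close>

lemma length_encode_set: "finite x \<Longrightarrow> length (encode_set x) = Suc (length (sorted_list_of_set x))"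
  by (simp add: encode_set_def)

lemma set_pos_encode:
  assumes "\<forall>x\<in>set ps. finite x" "i \<le> length ps"
  shows "set_pos (map sorted_list_of_set ps) i = 4 + length (concat (map encode_set (take i ps)))"
  using assms(2)
proof (induction i)
  case (Suc i)
  then have i: "i < length ps" by simp
  then have "finite (ps ! i)" using assms(1) by simp
  then show ?case using Suc i by (simp add: take_Suc_conv_app_nth length_encode_set)
qed simp

lemma encode_instance_nth:
  assumes "\<forall>x\<in>set ps. finite x" "i < length ps" "j < length (encode_set (ps ! i))"
  shows "encode_instance w d s1 s2 ps ! (set_pos (map sorted_list_of_set ps) i + j) = encode_set (ps ! i) ! j"
proof -
  have "concat (map encode_set ps) = concat (map encode_set (take i ps)) @ encode_set (ps ! i) @ concat (map encode_set (drop (Suc i) ps))"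
    by (subst id_take_nth_drop[OF assms(2)]) simp
  then have inp: "encode_instance w d s1 s2 ps = ([length ps, d, fixed_point w s1, fixed_point w s2] @ concat (map encode_set (take i ps))) @
      encode_set (ps ! i) @ concat (map encode_set (drop (Suc i) ps))"
    by (simp add: encode_instance_def)
  have "set_pos (map sorted_list_of_set ps) i = length ([length ps, d, fixed_point w s1, fixed_point w s2] @ concat (map encode_set (take i ps)))"
    using set_pos_encode[OF assms(1), of i] assms(2) by simp
  then show ?thesis unfolding inp using assms(3) by (simp only: nth_append_length_plus nth_append_left)
qed

lemma length_encode_instance:
  assumes "\<forall>x\<in>set ps. finite x"
  shows "length (encode_instance w d s1 s2 ps) = set_pos (map sorted_list_of_set ps) (length ps)"
  using set_pos_encode[OF assms le_refl] by (simp add: encode_instance_def)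

context layout
begin

lemma sets_in_encode:
  assumes ps: "length ps = n" "\<forall>x\<in>set ps. x \<subseteq> {1..d}" "d < Z" and N: "N = length (encode_instance w d s1 s2 ps)"
  shows "sets_in (encode_instance w d s1 s2 ps) (map sorted_list_of_set ps)"
proof -
  define xss where "xss = map sorted_list_of_set ps"
  have fin: "\<forall>x\<in>set ps. finite x" using ps(2) finite_subset by blast
  have Nn: "set_pos xss n = N" unfolding N length_encode_instance[OF fin] ps(1) xss_def ..
  have "encode_instance w d s1 s2 ps ! set_pos xss i = length (xss ! i) \<and> reads (encode_instance w d s1 s2 ps) (set_pos xss i + 1) (xss ! i)"
    if i: "i < n" for i
  proof -
    have x: "ps ! i \<in> set ps" "finite (ps ! i)" "ps ! i \<subseteq> {1..d}" using i ps fin by auto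
    have e: "encode_set (ps ! i) = length (xss ! i) # xss ! i" using x i ps by (simp add: encode_set_def xss_def)
    have nth: "encode_instance w d s1 s2 ps ! (set_pos xss i + j) = encode_set (ps ! i) ! j" if "j < length (encode_set (ps ! i))" for j
      unfolding xss_def using encode_instance_nth[OF fin _ that] i ps by simp
    have "set_pos xss i + Suc (length (xss ! i)) \<le> N" using set_pos_mono[of "Suc i" n xss] i Nn by simp
    moreover have "N \<le> Z" using bounds by linarith
    moreover have "set (xss ! i) \<subseteq> {..<Z}"
    proof -
      have "{1..d} \<subseteq> {..<Z}" using ps(3) by auto
      then show ?thesis using x i ps(1) by (simp add: xss_def)
    qed
    moreover have "encode_instance w d s1 s2 ps ! set_pos xss i = length (xss ! i)" using nth[of 0] e by simp
    moreover have "encode_instance w d s1 s2 ps ! (set_pos xss i + 1 + j) = xss ! i ! j" if "j < length (xss ! i)" for j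
      using nth[of "Suc j"] e that by simp
    ultimately show ?thesis unfolding reads_def N[symmetric] by simp
  qed
  then show ?thesis unfolding sets_in_def xss_def[symmetric] using Nn ps N by (simp add: xss_def)
qed

lemma accept_similar:
  fixes b2 :: real
  assumes "finite x" "finite q" "b2 * real Z < real B2" "accept (sorted_list_of_set q) (sorted_list_of_set x)"
  shows "b2 < braun_blanquet x q"
proof -
  define c mx where "c = card (x \<inter> q)" and "mx = max (card x) (card q)"
  have "B2 * mx < c * Z" using assms unfolding accept_def c_def mx_def max_def by simp
  then have r: "real B2 * real mx < real c * real Z" by (metis of_nat_less_iff of_nat_mult)
  have Zp: "0 < real Z" using Z_ge by simp
  have mx: "0 < mx"
  proof (rule ccontr)
    assume "\<not> 0 < mx"
    then have "x = {}" using assms(1) by (auto simp: mx_def)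
    then show False using r by (simp add: c_def mult_less_0_iff)
  qed
  have "b2 * real Z * real mx \<le> real B2 * real mx" using assms(3) by (intro mult_right_mono) auto
  then have "(b2 * real mx) * real Z < real c * real Z" using r by (simp add: mult_ac)
  then have "b2 * real mx < real c" using Zp by simp
  then show ?thesis using mx by (simp add: braun_blanquet_def c_def mx_def field_simps)
qed

text \<open>Joins the deterministic behaviour of both programs with
  \<open>success_probability\<close>: for each list of words, \<open>finds\<close> implies a correct
  answer. \<open>gap\<close> separates the rounded b2 from b1, so that a close set is
  accepted.\<close>

lemma instance_solved:
  fixes b1 b2 \<rho> :: real
  assumes z: "z = (w - 1) div 8"
    and ps: "length ps = n" "\<forall>x\<in>set ps. x \<subseteq> {1..d}" "d < Z"
    and N: "N = length (encode_instance w d b1 b2 ps)"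
    and B: "B1 = fixed_point w b1 div 2 ^ (w - z)" "B2 = fixed_point w b2 div 2 ^ (w - z) + 1"
    and k: "\<And>j. j < k \<Longrightarrow> scaled_pow Z B2 j < n * Z"
    and U: "\<And>j. j \<le> k \<Longrightarrow> scaled_pow Z B1 j \<le> Z * Z"
    and Lk: "L = 8 * Suc k" and cap: "cap = cc * L * (scaled_pow Z B1 k div Z + 1)" and cc: "0 < cc"
    and dp: "depth_params b1 b2 \<rho> n d Z B1 B2 k"
    and M: "M = real Z / real B1 + real d / real Z"
    and gap: "real B2 < b1 * real Z"
    and dk: "real d * (real k)\<^sup>2 \<le> real Z"
    and S: "10 * (real L * (\<Sum>j\<le>k. M ^ j)) \<le> real cap"
    and T: "real L * (real n * ((real B2 / real Z * M) ^ k + real k * (2 * M * M) ^ k * (real d * real d / 2 ^ z))) \<le> real cap"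
    and cB: "Z \<le> cB * B2"
    and cells: "SB + N \<le> cells"
    and qtime: "\<And>l. cap * (40 * (20 * (cB + 1) * l + 61) + 20 * l + 140) + 200 \<le> qtime l"
  shows "solves_similarity_search w d b1 b2 ps (build_prog cc) query_prog cells qtime"
proof -
  interpret dp: depth_params b1 b2 \<rho> n d Z B1 B2 k by (rule dp)
  define inp where "inp = encode_instance w d b1 b2 ps"
  define xss where "xss = map sorted_list_of_set ps"
  define R where "R = 2 * (L * Suc k)"
  define W where "W = replicate_pmf (R + 2) (pmf_of_set {0..<(2::nat) ^ w})"
  have fin: "\<forall>x\<in>set ps. finite x" using ps(2) finite_subset by blast
  have xss_in: "sets_in inp xss" unfolding inp_def xss_def using ps N by (rule sets_in_encode)
  have inp: "4 \<le> N" "inp ! 0 = n" "B1 = inp ! 2 div 2 ^ (w - z)" "B2 = inp ! 3 div 2 ^ (w - z) + 1"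
    using N ps B by (simp_all add: inp_def encode_instance_def)
  obtain T0 F where run: "run w inp T0 ([build_prog cc], init (\<lambda>_. 0)) = map_pmf (\<lambda>ws. ([], F ws)) W"
    and st: "\<And>ws. length ws = R + 2 \<Longrightarrow> structure_in (mem (F ws)) (take R ws) (ws ! R) (ws ! (R + 1)) inp xss n"
    using build_distribution[OF z inp k dp.depth(2) U Lk cap cc xss_in] unfolding W_def R_def by blast
  have supp: "set_pmf W = {ws. set ws \<subseteq> {0..<2 ^ w} \<and> length ws = R + 2}"
    unfolding W_def set_replicate_pmf by (subst set_pmf_of_set) auto
  define D where "D = map_pmf (\<lambda>ws. mem (F ws)) W"
  have D: "D = map_pmf mem (result w inp (build_prog cc) (\<lambda>_. 0) T0)"
    by (simp add: D_def result_def run map_pmf_comp)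
  have halts: "halts_within w inp (build_prog cc) (\<lambda>_. 0) T0" by (auto simp: halts_within_def run)
  have zero: "\<forall>m\<in>set_pmf D. \<forall>a\<ge>cells. m a = 0"
  proof (intro ballI allI impI)
    fix m a assume "m \<in> set_pmf D" "cells \<le> a"
    then obtain ws where ws: "length ws = R + 2" "m = mem (F ws)" by (auto simp: D_def supp)
    have "set_pos xss n = N" using xss_in by (simp add: sets_in_def)
    then show "m a = 0" using st[OF ws(1)] ws(2) cells \<open>cells \<le> a\<close> by (simp add: structure_in_def)
  qed
  have so: "\<forall>i<n. sorted_wrt (<) (xss ! i)" using ps by (simp add: xss_def)
  have qu: "(\<forall>m \<in> set_pmf D. halts_within w (encode_set q) query_prog m (qtime (card q))) \<and>
           ((\<exists>x \<in> set ps. braun_blanquet x q \<ge> b1) \<longrightarrow>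
              measure_pmf.prob
                (bind_pmf D (\<lambda>m. result w (encode_set q) query_prog m (qtime (card q))))
                {s. \<exists>x \<in> set ps. braun_blanquet x q > b2 \<and> returns s x} \<ge> 1 / 2)" if q: "q \<subseteq> {1..d}" for q
  proof -
    define ys where "ys = sorted_list_of_set q"
    have fq: "finite q" using q finite_subset by blast
    have ly: "length ys = card q" by (simp add: ys_def)
    have "card q \<le> d" using card_mono[OF _ q] by simp
    then have rd: "reads (encode_set q) 1 ys" "encode_set q ! 0 = length ys" "sorted_wrt (<) ys"
      using q ps(3) fq by (auto simp: reads_def encode_set_def ys_def)
    have "\<exists>s'. run w (encode_set q) (qtime (card q)) ([query_prog], init (mem (F ws))) = return_pmf ([], s') \<and>
      (finds (take R ws) (ws ! R) (ws ! (R + 1)) xss ys \<longrightarrow> (\<exists>x\<in>set ps. b2 < braun_blanquet x q \<and> returns s' x))"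
      if ws: "length ws = R + 2" for ws
    proof -
      define m where "m = mem (F ws)"
      define C where "C = candidates (entries (take R ws) (ws ! R) (ws ! (R + 1)) xss n) (ws ! R) (ws ! (R + 1)) (queue (take R ws) ys)"
      have m: "structure_in m (take R ws) (ws ! R) (ws ! (R + 1)) inp xss n" unfolding m_def using ws by (rule st)
      have "wp w (encode_set q) query_prog (\<lambda>T s'. T \<le> qtime (card q) \<and>
        ((\<forall>a. HD \<le> a \<longrightarrow> mem s' a = m a) \<and>
        ((\<exists>i\<in>set C. accept ys (xss ! i) \<and> regs s' 0 = SB + set_pos xss i) \<or>
          (\<forall>i\<in>set (take (40 * cap) C). \<not> accept ys (xss ! i))))) (init m)"
        by (rule wp_conseq[OF wp_query[OF m xss_in so rd cB C_def]])
          (use qtime[of "length ys"] ly in auto)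
      from wp_run[OF this] obtain s' where s': "run w (encode_set q) (qtime (card q)) ([query_prog], init m) = return_pmf ([], s')"
        "\<And>a. HD \<le> a \<Longrightarrow> mem s' a = m a"
        "(\<exists>i\<in>set C. accept ys (xss ! i) \<and> regs s' 0 = SB + set_pos xss i) \<or> (\<forall>i\<in>set (take (40 * cap) C). \<not> accept ys (xss ! i))"
        by blast
      have "\<exists>x\<in>set ps. b2 < braun_blanquet x q \<and> returns s' x" if f: "finds (take R ws) (ws ! R) (ws ! (R + 1)) xss ys"
      proof -
        obtain i where i: "i \<in> set C" "accept ys (xss ! i)" "regs s' 0 = SB + set_pos xss i"
          using s'(3) f unfolding finds_def C_def[symmetric] by blast
        have "i \<in> snd ` set (entries (take R ws) (ws ! R) (ws ! (R + 1)) xss n)"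
        proof -
          have "set (chain es b e) \<subseteq> snd ` set es" if "e \<le> length es" for es b e
            using that by (induction e) auto
          then show ?thesis using i(1) unfolding C_def candidates_def by (fastforce split: if_splits)
        qed
        then have "i < n" using snd_entries_less by blast
        then have i': "i < length ps" "ps ! i \<in> set ps" "xss ! i = sorted_list_of_set (ps ! i)" using ps by (auto simp: xss_def)
        have "b2 < braun_blanquet (ps ! i) q"
          using accept_similar[OF _ fq dp.B2(1), of "ps ! i"] fin i' i(2) by (simp add: ys_def)
        moreover have "returns s' (ps ! i)" unfolding returns_def
        proof (intro allI impI)
          fix j assume j: "j < length (encode_set (ps ! i))"
          have "length (encode_set (ps ! i)) = Suc (length (xss ! i))" using fin i' by (simp add: length_encode_set)
          then have "set_pos xss i + j < set_pos xss n" using j set_pos_mono[of "Suc i" n xss] \<open>i < n\<close> by simp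
          moreover have "4 \<le> set_pos xss i + j" using set_pos_ge[of xss i] by simp
          ultimately have "m (SB + (set_pos xss i + j)) = inp ! (set_pos xss i + j)" using m unfolding structure_in_def by blast
          also have "\<dots> = encode_set (ps ! i) ! j" unfolding inp_def xss_def by (rule encode_instance_nth[OF fin i'(1) j])
          finally show "mem s' (regs s' 0 + j) = encode_set (ps ! i) ! j"
            using s'(2)[of "SB + (set_pos xss i + j)"] bounds i(3) by (simp add: add.assoc)
        qed
        ultimately show ?thesis using i' by blast
      qed
      then show ?thesis using s'(1) unfolding m_def by blast
    qed
    \<comment> \<open>The query draws no words, so choice yields its final store as a function of
      the words of \<open>build\<close>.\<close>
    then have "\<forall>ws. \<exists>s'. length ws = R + 2 \<longrightarrow> run w (encode_set q) (qtime (card q)) ([query_prog], init (mem (F ws))) = return_pmf ([], s') \<and>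
      (finds (take R ws) (ws ! R) (ws ! (R + 1)) xss ys \<longrightarrow> (\<exists>x\<in>set ps. b2 < braun_blanquet x q \<and> returns s' x))" by blast
    from choice[OF this] obtain s' where s': "\<And>ws. length ws = R + 2 \<Longrightarrow>
        run w (encode_set q) (qtime (card q)) ([query_prog], init (mem (F ws))) = return_pmf ([], s' ws)"
      "\<And>ws. length ws = R + 2 \<Longrightarrow> finds (take R ws) (ws ! R) (ws ! (R + 1)) xss ys \<Longrightarrow>
        \<exists>x\<in>set ps. b2 < braun_blanquet x q \<and> returns (s' ws) x" by blast
    have h: "\<forall>m \<in> set_pmf D. halts_within w (encode_set q) query_prog m (qtime (card q))"
      by (auto simp: D_def supp halts_within_def s'(1))
    define A where "A = {s. \<exists>x \<in> set ps. braun_blanquet x q > b2 \<and> returns s x}"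
    have "bind_pmf D (\<lambda>m. result w (encode_set q) query_prog m (qtime (card q))) = map_pmf s' W"
    proof -
      have "bind_pmf D (\<lambda>m. result w (encode_set q) query_prog m (qtime (card q))) =
        bind_pmf W (\<lambda>ws. result w (encode_set q) query_prog (mem (F ws)) (qtime (card q)))"
        by (simp add: D_def bind_map_pmf)
      also have "\<dots> = bind_pmf W (\<lambda>ws. return_pmf (s' ws))"
        by (intro bind_pmf_cong refl) (auto simp: supp result_def s'(1))
      finally show ?thesis by (simp add: map_pmf_def)
    qed
    then have "measure_pmf.prob (bind_pmf D (\<lambda>m. result w (encode_set q) query_prog m (qtime (card q)))) A =
      measure_pmf.prob W (s' -` A)" by simp
    also have "\<dots> = avg (2 ^ w) (R + 2) (\<lambda>ws. of_bool (ws \<in> s' -` A))"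
      unfolding W_def by (rule prob_replicate_pmf_of_set) simp
    finally have pr: "measure_pmf.prob (bind_pmf D (\<lambda>m. result w (encode_set q) query_prog m (qtime (card q)))) A =
      avg (2 ^ w) (R + 2) (\<lambda>ws. of_bool (ws \<in> s' -` A))" .
    have "1 / 2 \<le> avg (2 ^ w) (R + 2) (\<lambda>ws. of_bool (ws \<in> s' -` A))" if ex: "\<exists>x \<in> set ps. braun_blanquet x q \<ge> b1"
    proof -
      obtain i where i: "i < n" "b1 \<le> braun_blanquet (ps ! i) q"
        using ex ps(1) by (auto simp: in_set_conv_nth)
      define x where "x = ps ! i"
      have x: "x \<in> set ps" "finite x" "x \<subseteq> {1..d}" using i ps fin by (auto simp: x_def)
      define c mx where "c = card (x \<inter> q)" and "mx = max (card x) (card q)"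
      have bb: "b1 \<le> real c / real mx" using i by (simp add: braun_blanquet_def x_def c_def mx_def)
      \<comment> \<open>For two empty sets the quotient is 0 by division by zero, which does not
        reach b1.\<close>
      have mx: "0 < mx" using bb dp.b by (cases "mx = 0") auto
      have cb: "b1 * real mx \<le> real c" using bb mx by (simp add: field_simps)
      have c0: "0 < c" using cb mx dp.b by (cases "c = 0") (auto simp: mult_le_0_iff)
      have xi: "xss ! i = sorted_list_of_set x" using i ps by (simp add: xss_def x_def)
      have lx: "length (xss ! i) = card x" "card x \<le> d" using xi card_mono[OF _ x(3)] by auto
      have cc': "card (set (xss ! i) \<inter> set ys) = c" using xi x fq by (simp add: ys_def c_def)
      have x0: "0 < card x" "0 < card q" using c0 x fq by (auto simp: c_def card_gt_0_iff)
      have acc: "accept ys (xss ! i)"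
      proof -
        have "real B2 * real mx < b1 * real Z * real mx" using gap mx by (intro mult_strict_right_mono) auto
        also have "\<dots> = (b1 * real mx) * real Z" by simp
        also have "\<dots> \<le> real c * real Z" using cb by (intro mult_right_mono) auto
        finally have "B2 * mx < c * Z" by (metis of_nat_less_iff of_nat_mult)
        moreover have "B2 * card x \<le> B2 * mx" "B2 * card q \<le> B2 * mx" by (auto simp: mx_def)
        ultimately show ?thesis unfolding accept_def cc' lx ly by linarith
      qed
      have b1Z: "real B1 \<le> b1 * real Z" by (rule dp.B1(1))
      have Mm: "real m * pass z (tau m) \<le> M" if "m \<le> d" for m unfolding M using that by (rule pass_tau_le)
      have MM: "M = dp.M" by (simp add: M dp.M_def)
      have M1: "1 \<le> M" using dp.M_ge(2) MM by simp
      have le1: "real B2 / real Z \<le> 1" using dp.big(5) dp.Zp by simp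
      have eta: "0 \<le> real B2 / real Z * M" "real B2 / real Z * M \<le> M"
        using M1 mult_right_mono[OF le1, of M] by auto
      have rej: "coll (xss ! j) ys * pass z (min (tau (length (xss ! j))) (tau (length ys))) \<le> real B2 / real Z * M"
        if "j < n" "\<not> accept ys (xss ! j)" for j
      proof -
        have "ps ! j \<in> set ps" using that ps by simp
        then have "card (ps ! j) \<le> d" using ps(2) card_mono[of "{1..d}" "ps ! j"] by simp
        then show ?thesis unfolding M
          using that \<open>card q \<le> d\<close> ps by (intro pass_tau_reject) (auto simp: ys_def xss_def)
      qed
      have xsd: "distinct (xss ! j) \<and> set (xss ! j) \<subseteq> {..<Z} \<and> length (xss ! j) \<le> d" if "j < n" for j
      proof -
        have j: "ps ! j \<in> set ps" using that ps by simp
        then have "card (ps ! j) \<le> d" "ps ! j \<subseteq> {1..d}" "finite (ps ! j)"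
          using ps(2) card_mono[of "{1..d}" "ps ! j"] fin by auto
        moreover have "{1..d} \<subseteq> {..<Z}" using ps(3) by auto
        ultimately show ?thesis using that ps(1) by (simp add: xss_def)
      qed
      have cl: "1 \<le> real c * pass z (min (tau (length (xss ! i))) (tau (length ys)))"
        "1 \<le> pass z (min (tau (length (xss ! i))) (tau (length ys))) * 2 ^ z * (real d / real Z)"
        using b1Z lx ly x0 \<open>card q \<le> d\<close> cb c0 by (intro pass_tau_close[of b1 "xss ! i" d ys "real c"]; simp add: mx_def)+
      have dk': "real d / real Z * (real k)\<^sup>2 \<le> 1" using dk dp.Zp by (simp add: field_simps)
      have ysd: "distinct ys" "set ys \<subseteq> {..<Z}" "length ys \<le> d"
        using \<open>card q \<le> d\<close> q fq ps(3) by (auto simp: ys_def)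
      have "1 / 2 \<le> avg (2 ^ w) (R + 2) (\<lambda>ws. of_bool (finds (take R ws) (ws ! R) (ws ! (R + 1)) xss ys))"
        unfolding R_def
        by (rule success_probability[OF xsd ysd i(1) acc M1 Mm eta rej _ _ cl(2) dk' S T Lk]) (use cl(1) cc' in simp_all)
      also have "\<dots> \<le> avg (2 ^ w) (R + 2) (\<lambda>ws. of_bool (ws \<in> s' -` A))"
      proof (rule avg_mono)
        fix ws :: "nat list" assume "length ws = R + 2"
        then show "of_bool (finds (take R ws) (ws ! R) (ws ! (R + 1)) xss ys) \<le> (of_bool (ws \<in> s' -` A) :: real)"
          using s'(2)[of ws] by (auto simp: A_def)
      qed
      finally show ?thesis .
    qed
    then show ?thesis using h pr unfolding A_def by simp
  qed
  show ?thesis unfolding solves_similarity_search_def inp_def[symmetric]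
    using halts D zero qu by blast
qed

end

section \<open>Fixing the constants\<close>

lemma length_encode_instance_sum:
  assumes "distinct ps" "\<forall>x\<in>set ps. finite x"
  shows "length (encode_instance w d s1 s2 ps) = 4 + length ps + (\<Sum>x\<in>set ps. card x)"
proof -
  have "length (concat (map encode_set ps)) = length ps + (\<Sum>x\<leftarrow>ps. card x)"
    using assms(2) by (induction ps) (auto simp: encode_set_def)
  then show ?thesis using assms(1) by (simp add: encode_instance_def sum_list_distinct_conv_sum_set)
qed

text \<open>The size conditions reduce to the form coefficient * n ^ p \<le> Z; \<open>Kc\<close>
  sums the coefficients and \<open>P\<close> dominates the exponents, so one inequality covers them.
  \<open>ck\<close> bounds k / log n, \<open>A\<close> gives (2 M^2) ^ k \<le> n ^ A, and
  \<open>CC\<close> bounds cap / (n powr \<open>\<rho>\<close> * log n). In \<open>cc\<close>, 60 is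
  10 from \<open>success_probability\<close> times 6 from \<open>scaled_B1_lower\<close>, and 1 / (1
  - b1) comes from the geometric sum over the levels.\<close>

lemma solves_if_scale_large:
  fixes b1 b2 \<rho> \<gamma> ck CC Kc C :: real and \<kappa> A P cc cB :: nat
  assumes b: "0 < b2" "b2 < b1" "b1 < 1" and rho: "\<rho> = ln (1 / b1) / ln (1 / b2)"
    and gam: "\<gamma> = (1 + b2) / 2" and ck: "ck = 1 + 2 / log 2 (1 / \<gamma>)"
    and A: "ck * log 2 (2 * (2 / b1)\<^sup>2) \<le> real A" and cc: "60 / (1 - b1) \<le> real cc" and cB: "1 / b2 \<le> real cB"
    and CC: "CC = real cc * (16 * ck) * (36 / b1)" and P: "P = 3 + A + 2 * \<kappa>"
    and Kc: "Kc = 2 * ck + ck / b2 + ck * (2 / b1 + 1) + ck\<^sup>2 + ck + 2 + 40 * CC + (42 + 64 * ck\<^sup>2 + 5 * CC) +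
      2 / (1 - b2) + 2 / b1 + 2 / (b1 - b2)"
    and C: "C = (42 + 64 * ck\<^sup>2 + 5 * CC) + (CC * (800 * (real cB + 1) + 2600) + 200)"
    and n: "2 \<le> n" and d: "d \<le> n ^ \<kappa>" and ps: "length ps = n" "distinct ps" "\<forall>x\<in>set ps. x \<subseteq> {1..d}"
    and z: "z = (w - 1) div 8" "8 * z \<le> w" and large: "Kc * real n ^ P \<le> 2 ^ z"
  shows "solves_similarity_search w d b1 b2 ps (build_prog cc) query_prog
    (nat \<lfloor>C * (real n powr (1 + \<rho>) * log 2 (real n) + real (\<Sum>x\<in>set ps. card x))\<rfloor>)
    (\<lambda>l. nat \<lfloor>C * real (max 1 l) * real n powr \<rho> * log 2 (real n)\<rfloor>)"
proof -
  define x lg Z where "x = real n" and "lg = log 2 x" and "Z = (2::nat) ^ z"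
  have x2: "2 \<le> x" using n by (simp add: x_def)
  have lg: "1 \<le> lg" "lg \<le> x"
  proof -
    have "log 2 2 \<le> log 2 x" using x2 by (subst log_le_cancel_iff) auto
    then show "1 \<le> lg" by (simp add: lg_def)
    have "n < 2 ^ n" by (rule less_exp)
    then have "real n < 2 ^ n" by (metis of_nat_less_iff of_nat_numeral of_nat_power)
    then have "x \<le> 2 powr x" by (simp add: x_def powr_realpow)
    then show "lg \<le> x" using x2 by (simp add: lg_def log_le_iff)
  qed
  have gam1: "0 < \<gamma>" "\<gamma> < 1" using b by (auto simp: gam)
  have lgam: "0 < log 2 (1 / \<gamma>)" using gam1 by simp
  have ck1: "1 \<le> ck" using lgam by (simp add: ck)
  have cc60: "60 \<le> real cc"
  proof -
    have "60 \<le> 60 / (1 - b1)" using b by (simp add: field_simps)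
    then show ?thesis using cc by linarith
  qed
  have CC1: "0 \<le> CC" using ck1 b by (simp add: CC)
  have ckk: "0 \<le> ck / b2" "0 \<le> ck * (2 / b1 + 1)" "0 \<le> ck\<^sup>2" "0 \<le> 2 / (1 - b2)" "0 \<le> 2 / b1" "0 \<le> 2 / (b1 - b2)" using ck1 b by auto
  have zr: "real Z = 2 ^ z" by (simp add: Z_def)
  have poly: "c * x ^ p \<le> real Z" if "0 \<le> c" "c \<le> Kc" "p \<le> P" for c p
  proof -
    have "c * x ^ p \<le> Kc * x ^ P" using that x2 by (intro mult_mono power_increasing) auto
    then show ?thesis using large by (simp add: x_def zr)
  qed
  have Kge: "2 * ck \<le> Kc" "ck / b2 \<le> Kc" "ck * (2 / b1 + 1) \<le> Kc" "ck\<^sup>2 \<le> Kc" "ck \<le> Kc" "2 \<le> Kc" "40 * CC \<le> Kc"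
    "42 + 64 * ck\<^sup>2 + 5 * CC \<le> Kc" "2 / (1 - b2) \<le> Kc" "2 / b1 \<le> Kc" "2 / (b1 - b2) \<le> Kc"
    using ckk CC1 ck1 unfolding Kc by linarith+
  have Zc: "2 / (1 - b2) \<le> real Z" "2 / b1 \<le> real Z" "2 / (b1 - b2) \<le> real Z" "2 \<le> real Z"
    using poly[of "2 / (1 - b2)" 0] poly[of "2 / b1" 0] poly[of "2 / (b1 - b2)" 0] poly[of 2 0] Kge ckk by auto
  have dx: "real d \<le> x ^ \<kappa>" using d by (metis of_nat_le_iff of_nat_power x_def)
  have dZ: "d < Z"
  proof -
    have "2 * x ^ \<kappa> \<le> real Z" using Kge by (intro poly) (auto simp: P)
    moreover have "0 < x ^ \<kappa>" using x2 by simp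
    ultimately have "real d < real Z" using dx by linarith
    then show ?thesis by simp
  qed
  define B1 B2 where "B1 = fixed_point w b1 div 2 ^ (w - z)" and "B2 = fixed_point w b2 div 2 ^ (w - z) + 1"
  have zw: "z \<le> w" using z(2) by simp
  have B1: "real B1 \<le> b1 * real Z" "b1 * real Z < real B1 + 1"
    using floor_div_bounds[of b1 z w] b zw by (auto simp: B1_def zr)
  have B2: "b2 * real Z < real B2" "real B2 \<le> b2 * real Z + 1"
    using floor_div_bounds[of b2 z w] b zw by (auto simp: B2_def zr)
  \<comment> \<open>\<open>\<gamma>\<close> is the midpoint of b2 and 1; rounding b2 up adds at most
    1, which half of (1 - b2) * Z absorbs.\<close>
  have B2g: "real B2 \<le> \<gamma> * real Z"
  proof -
    have "2 \<le> (1 - b2) * real Z" using Zc(1) b by (simp add: field_simps)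
    then show ?thesis using B2(2) by (simp add: gam algebra_simps)
  qed
  have B2Z: "B2 \<le> Z"
  proof -
    have "\<gamma> * real Z \<le> 1 * real Z" using gam1 by (intro mult_right_mono) auto
    then show ?thesis using B2g by simp
  qed
  have b1Z: "2 \<le> b1 * real Z" using Zc(2) b by (simp add: field_simps)
  have gap: "real B2 < b1 * real Z"
  proof -
    have "2 \<le> (b1 - b2) * real Z" using Zc(3) b by (simp add: field_simps)
    then show ?thesis using B2(2) by (simp add: algebra_simps)
  qed
  have B2p: "0 < B2" by (simp add: B2_def)
  define J where "J = nat \<lceil>log (1 / \<gamma>) (2 * real n)\<rceil>"
  have J: "real J \<le> ck * lg"
  proof -
    have l2: "log (1 / \<gamma>) (2 * real n) = (1 + lg) / log 2 (1 / \<gamma>)"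
      using n gam1 by (simp add: log_base_change[of 2 "1 / \<gamma>"] log_mult lg_def x_def add_divide_distrib)
    have "0 \<le> (1 + lg) / log 2 (1 / \<gamma>)" using lg lgam by simp
    then have "real J \<le> 1 + (1 + lg) / log 2 (1 / \<gamma>)" unfolding J_def l2 by linarith
    also have "\<dots> \<le> 1 * lg + (2 * lg) / log 2 (1 / \<gamma>)" using lg lgam by (intro add_mono divide_right_mono) auto
    also have "\<dots> = ck * lg" by (simp add: ck algebra_simps)
    finally show ?thesis .
  qed
  have ckx: "ck * lg \<le> ck * x" using lg ck1 by (intro mult_left_mono) auto
  have p1: "2 * ck * x \<le> real Z" using poly[of "2 * ck" 1] Kge ck1 by (simp add: P)
  have "2 * J \<le> Z"
  proof -
    have "2 * real J \<le> real Z" using J ckx p1 by linarith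
    then show ?thesis by linarith
  qed
  from depth_exists[OF B2p B2g gam1 n J_def this] obtain k where k: "1 \<le> k" "k \<le> J"
    "\<And>j. j < k \<Longrightarrow> scaled_pow Z B2 j < n * Z" "n * Z \<le> scaled_pow Z B2 k" by blast
  have kl: "real k \<le> ck * lg" using k(2) J by linarith
  then have kx: "real k \<le> ck * x" using ckx by linarith
  have k1: "1 \<le> real k" using k(1) by simp
  have x\<kappa>: "1 \<le> x ^ \<kappa>" using x2 by (intro one_le_power) auto
  have dp: "depth_params b1 b2 \<rho> n d Z B1 B2 k"
  proof
    show "2 * real k \<le> real Z" using kx p1 by linarith
    have "(ck / b2) * x \<le> real Z" using poly[of "ck / b2" 1] Kge ckk by (simp add: P)
    then have "ck * x \<le> b2 * real Z" using b by (simp add: field_simps)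
    then show "real k \<le> b2 * real Z" using kx by linarith
    have "2 / b1 * 1 + real d \<le> 2 / b1 * x ^ \<kappa> + 1 * x ^ \<kappa>" using x\<kappa> dx b by (intro add_mono mult_left_mono) auto
    then have "2 / b1 + real d \<le> (2 / b1 + 1) * x ^ \<kappa>" by (simp add: distrib_right)
    then have "real k * (2 / b1 + real d) \<le> (ck * x) * ((2 / b1 + 1) * x ^ \<kappa>)" using kx b x\<kappa> x2 ck1 by (intro mult_mono) auto
    also have "\<dots> = ck * (2 / b1 + 1) * x ^ Suc \<kappa>" by simp
    also have "\<dots> \<le> real Z" using Kge ckk by (intro poly) (auto simp: P)
    finally show "real k * (2 / b1 + real d) \<le> real Z" .
    show "scaled_pow Z B2 (k - 1) < n * Z" using k(1) by (intro k(3)) simp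
  qed (use b rho n k B1 B2 b1Z B2Z Zc in auto)
  interpret dp: depth_params b1 b2 \<rho> n d Z B1 B2 k by (rule dp)
  define M where "M = real Z / real B1 + real d / real Z"
  have MM: "dp.M = M" by (simp add: M_def dp.M_def)
  note dpM = dp.M_ge[unfolded MM] dp.M_pow[unfolded MM] dp.M_pow_sum[unfolded MM] dp.scaled_B1_upper[unfolded MM]
    dp.scaled_B1_lower[unfolded MM] dp.M_le[unfolded MM]
  have M1: "1 \<le> M" by (rule dpM(2))
  have M2: "M \<le> 2 / b1"
  proof -
    have "1 * (2 / b1 + real d) \<le> real k * (2 / b1 + real d)" using k1 b by (intro mult_right_mono) auto
    then have "(2 / b1 + real d) / real Z \<le> 1" using dp.big(3) dp.Zp by (simp add: field_simps)
    then have "(1 / b1) * (1 + (2 / b1 + real d) / real Z) \<le> (1 / b1) * (1 + 1)" using b by (intro mult_left_mono add_left_mono) auto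
    then show ?thesis using dpM(7) by simp
  qed
  define c2 where "c2 = 2 * (2 / b1)\<^sup>2"
  have b2': "2 \<le> 2 / b1" using b by (simp add: field_simps)
  have c21: "1 \<le> c2" using power_mono[OF b2', of 2] by (simp add: c2_def)
  have c2k: "c2 ^ k \<le> x ^ A"
  proof -
    have "c2 ^ k = c2 powr real k" using c21 by (simp add: powr_realpow)
    also have "\<dots> \<le> c2 powr (ck * lg)" using c21 kl by (intro powr_mono) auto
    \<comment> \<open>A constant raised to a multiple of log n is a fixed power of n; accidental
      collisions become harmless once Z is a sufficiently larger power.\<close>
    also have "\<dots> = x powr (ck * log 2 c2)"
    proof -
      have "c2 = 2 powr (log 2 c2)" "x = 2 powr lg" using c21 x2 by (auto simp: lg_def)
      then show ?thesis by (metis mult.commute mult.assoc powr_powr)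
    qed
    also have "\<dots> \<le> x powr real A" using A x2 by (intro powr_mono) (auto simp: c2_def)
    also have "\<dots> = x ^ A" using x2 by (simp add: powr_realpow)
    finally show ?thesis .
  qed
  have MMk: "(2 * M * M) ^ k \<le> x ^ A"
  proof -
    have "M * M \<le> (2 / b1) * (2 / b1)" using M1 M2 b by (intro mult_mono) auto
    then have "2 * M * M \<le> c2" by (simp add: c2_def power2_eq_square)
    then have "(2 * M * M) ^ k \<le> c2 ^ k" using M1 by (intro power_mono) auto
    then show ?thesis using c2k by linarith
  qed
  have Mk: "M ^ j \<le> real Z" if "j \<le> k" for j
  proof -
    have "M ^ j \<le> M ^ k" using M1 that by (intro power_increasing) auto
    also have "\<dots> \<le> (2 * M * M) ^ k" using M1 by (intro power_mono) auto
    also have "\<dots> \<le> 1 * x ^ A" using MMk by simp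
    also have "\<dots> \<le> real Z" using Kge by (intro poly) (auto simp: P)
    finally show ?thesis .
  qed
  have U: "scaled_pow Z B1 j \<le> Z * Z" if "j \<le> k" for j
  proof -
    have "real (scaled_pow Z B1 j) \<le> real Z * M ^ j" by (rule dpM(5))
    also have "\<dots> \<le> real Z * real Z" using Mk[OF that] by (intro mult_left_mono) auto
    finally show ?thesis by (metis of_nat_le_iff of_nat_mult)
  qed
  define L cap where "L = 8 * Suc k" and "cap = cc * L * (scaled_pow Z B1 k div Z + 1)"
  define y where "y = x powr \<rho> * lg"
  have rho01: "0 < \<rho>" "\<rho> < 1" by (rule dp.rho_bounds)+
  have xr: "1 \<le> x powr \<rho>" "x powr \<rho> \<le> x" using x2 rho01 powr_mono[of \<rho> 1 x] by (auto simp: ge_one_powr_ge_zero)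
  have y1: "1 \<le> y" unfolding y_def using xr lg mult_mono[of 1 "x powr \<rho>" 1 lg] by simp
  have Ll: "real L \<le> 16 * ck * lg" using k1 kl by (simp add: L_def)
  have cap_real: "real cap = real cc * real L * real (scaled_pow Z B1 k div Z + 1)" by (simp only: cap_def of_nat_mult)
  have capM: "real cc * real L * M ^ k \<le> 6 * real cap"
    using mult_left_mono[OF dpM(6), of "real cc * real L"] by (simp only: cap_real) (simp add: mult_ac)
  have cap_le: "real cap \<le> CC * y"
  proof -
    have "real (scaled_pow Z B1 k div Z) \<le> real (scaled_pow Z B1 k) / real Z" by (rule of_nat_div_le_of_nat)
    also have "\<dots> \<le> M ^ k" using dpM(5)[of k] dp.Zp by (simp add: field_simps)
    finally have "real (scaled_pow Z B1 k div Z + 1) \<le> M ^ k + 1" by simp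
    \<comment> \<open>The 1 added against rounding is at most \<open>M ^ k\<close>; this doubles 18
      / b1 to 36 / b1.\<close>
    also have "\<dots> \<le> 2 * M ^ k" using one_le_power[OF M1, of k] by simp
    also have "\<dots> \<le> 36 / b1 * x powr \<rho>" using dpM(3) by (simp add: x_def)
    finally have "real cap \<le> real cc * (16 * ck * lg) * (36 / b1 * x powr \<rho>)"
      unfolding cap_real using Ll ck1 lg b by (intro mult_mono) auto
    also have "\<dots> = CC * y" by (simp add: CC y_def)
    finally show ?thesis .
  qed
  have yx: "y \<le> x\<^sup>2" unfolding y_def power2_eq_square using xr lg x2 by (intro mult_mono) auto
  define N where "N = length (encode_instance w d b1 b2 ps)"
  define \<Sigma> where "\<Sigma> = (\<Sum>x\<in>set ps. card x)"
  have fin: "\<forall>x\<in>set ps. finite x" using ps(3) finite_subset by blast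
  have N: "real N = 4 + x + real \<Sigma>" using length_encode_instance_sum[OF ps(2) fin, of w d b1 b2] ps(1) by (simp add: N_def \<Sigma>_def x_def)
  have "\<Sigma> \<le> (\<Sum>x\<in>set ps. d)" unfolding \<Sigma>_def
  proof (intro sum_mono)
    fix u assume "u \<in> set ps"
    then show "card u \<le> d" using ps(3) card_mono[of "{1..d}" u] by simp
  qed
  also have "\<dots> = n * d" using ps by (simp add: distinct_card)
  finally have Sd: "real \<Sigma> \<le> x * x ^ \<kappa>"
    using mult_left_mono[OF dx, of x] x2 by (metis (no_types, opaque_lifting) linorder_not_less of_nat_le_iff of_nat_mult order_trans x_def not_numeral_le_zero nle_le)
  have LS: "real (L * Suc k) \<le> 32 * ck\<^sup>2 * lg\<^sup>2"
  proof -
    have "real (Suc k) \<le> 2 * (ck * lg)" using k1 kl by simp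
    then have "real (Suc k) * real (Suc k) \<le> (2 * (ck * lg)) * (2 * (ck * lg))" by (intro mult_mono) auto
    also have "\<dots> = 4 * ck\<^sup>2 * lg\<^sup>2" by (simp add: power2_eq_square)
    finally have "8 * (real (Suc k) * real (Suc k)) \<le> 32 * ck\<^sup>2 * lg\<^sup>2" by linarith
    moreover have "real (L * Suc k) = 8 * (real (Suc k) * real (Suc k))" by (simp only: L_def of_nat_mult of_nat_numeral mult.assoc)
    ultimately show ?thesis by linarith
  qed
  define size where "size = 36 + 2 * (L * Suc k) + 2 * cap + 3 * (n * cap) + N"
  have size: "real size = 36 + 2 * real (L * Suc k) + 2 * real cap + 3 * (x * real cap) + (4 + x + real \<Sigma>)"
    unfolding size_def by (simp only: of_nat_add of_nat_mult of_nat_numeral N x_def)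
  have fit1: "size \<le> Z"
  proof -
    define t where "t = x ^ (3 + \<kappa>)"
    have pt: "x ^ p \<le> t" if "p \<le> 3 + \<kappa>" for p unfolding t_def using that x2 by (intro power_increasing) auto
    have t1: "1 \<le> t" using pt[of 0] by simp
    have "lg\<^sup>2 \<le> x\<^sup>2" using lg by (intro power_mono) auto
    also have "\<dots> \<le> t" by (rule pt) simp
    finally have "32 * ck\<^sup>2 * lg\<^sup>2 \<le> 32 * ck\<^sup>2 * t" by (intro mult_left_mono) auto
    then have 1: "real (L * Suc k) \<le> 32 * ck\<^sup>2 * t" using LS by linarith
    have "CC * y \<le> CC * t" using yx pt[of 2] CC1 by (intro mult_left_mono) auto
    then have 2: "real cap \<le> CC * t" using cap_le by linarith
    have "x * real cap \<le> x * (CC * x\<^sup>2)" using cap_le mult_left_mono[OF yx CC1] x2 by (intro mult_left_mono) auto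
    also have "\<dots> = CC * x ^ 3" by (simp add: power2_eq_square power3_eq_cube)
    also have "\<dots> \<le> CC * t" using pt[of 3] CC1 by (intro mult_left_mono) auto
    finally have 3: "x * real cap \<le> CC * t" .
    have 4: "x \<le> t" "real \<Sigma> \<le> t" using pt[of 1] pt[of "Suc \<kappa>"] Sd by auto
    have "real size \<le> 36 * t + 2 * (32 * ck\<^sup>2 * t) + 2 * (CC * t) + 3 * (CC * t) + (4 * t + t + t)"
      unfolding size using 1 2 3 4 t1 by linarith
    also have "\<dots> = (42 + 64 * ck\<^sup>2 + 5 * CC) * t" by (simp add: algebra_simps)
    also have "\<dots> \<le> real Z" unfolding t_def using Kge CC1 by (intro poly) (auto simp: P)
    finally show ?thesis by simp
  qed
  have fit2: "40 * cap \<le> Z"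
  proof -
    have "40 * real cap \<le> 40 * (CC * x\<^sup>2)" using cap_le mult_left_mono[OF yx CC1] by linarith
    also have "\<dots> = 40 * CC * x\<^sup>2" by simp
    also have "\<dots> \<le> real Z" using Kge CC1 by (intro poly) (auto simp: P)
    finally show ?thesis by linarith
  qed
  have ccp: "0 < cc" using cc60 by (cases cc) auto
  have Lcap: "L \<le> cap"
  proof -
    have "1 * L * 1 \<le> cap" unfolding cap_def using ccp by (intro mult_mono) auto
    then show ?thesis by simp
  qed
  interpret lay: layout w z B1 B2 k L cap n N
  proof
    show "36 + 2 * (L * Suc k) + 2 * cap + 3 * (n * cap) + N \<le> 2 ^ z" using fit1 unfolding size_def Z_def .
  qed (use z dp.B_pos B2Z Lcap n fit2 in \<open>auto simp: Z_def L_def\<close>)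
  have layZ: "lay.Z = Z" by (simp add: lay.Z_def Z_def)
  have S: "10 * (real L * (\<Sum>j\<le>k. M ^ j)) \<le> real cap"
  proof -
    have "real L * (\<Sum>j\<le>k. M ^ j) \<le> real L * (M ^ k / (1 - b1))" using dpM(4) by (intro mult_left_mono) auto
    moreover have "10 * (real L * (M ^ k / (1 - b1))) = (60 / (1 - b1)) * (real L * M ^ k) / 6" using b by (simp add: field_simps)
    ultimately have "10 * (real L * (\<Sum>j\<le>k. M ^ j)) \<le> (60 / (1 - b1)) * (real L * M ^ k) / 6" by linarith
    also have "\<dots> \<le> real cc * (real L * M ^ k) / 6" using cc M1 by (intro divide_right_mono mult_right_mono) auto
    finally show ?thesis using capM unfolding mult.assoc by linarith
  qed
  have T: "real L * (real n * ((real B2 / real Z * M) ^ k + real k * (2 * M * M) ^ k * (real d * real d / 2 ^ z))) \<le> real cap"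
  proof -
    have "real n * (real B2 / real Z * M) ^ k = (real n * (real B2 / real Z) ^ k) * M ^ k" by (simp only: power_mult_distrib mult.assoc)
    also have "\<dots> \<le> 1 * M ^ k" using dp.reject_decay M1 by (intro mult_right_mono) auto
    finally have 1: "real n * (real B2 / real Z * M) ^ k \<le> M ^ k" by simp
    have "real n * (real k * (2 * M * M) ^ k * (real d * real d)) \<le> x * ((ck * x) * x ^ A * (x ^ \<kappa> * x ^ \<kappa>))"
      using kx MMk dx x2 M1 ck1 by (intro mult_mono) (auto simp: x_def)
    also have "\<dots> = ck * x ^ (2 + A + 2 * \<kappa>)" by (simp add: power_add power_mult power2_eq_square mult_ac power_mult_distrib)
    also have "\<dots> \<le> real Z" using Kge ck1 by (intro poly) (auto simp: P)
    finally have "real n * (real k * (2 * M * M) ^ k * (real d * real d)) / real Z \<le> 1" using dp.Zp by (simp add: field_simps)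
    then have 2: "real n * (real k * (2 * M * M) ^ k * (real d * real d / 2 ^ z)) \<le> 1" by (simp add: zr)
    have "real n * ((real B2 / real Z * M) ^ k + real k * (2 * M * M) ^ k * (real d * real d / 2 ^ z)) \<le> M ^ k + 1"
      using 1 2 unfolding distrib_left by linarith
    also have "\<dots> \<le> 2 * M ^ k" using one_le_power[OF M1, of k] by simp
    finally have "real L * (real n * ((real B2 / real Z * M) ^ k + real k * (2 * M * M) ^ k * (real d * real d / 2 ^ z))) \<le> real L * (2 * M ^ k)"
      by (intro mult_left_mono) auto
    also have "\<dots> = 12 * (real L * M ^ k) / 6" by simp
    also have "\<dots> \<le> real cc * (real L * M ^ k) / 6" using cc60 M1 by (intro divide_right_mono mult_right_mono) auto
    finally show ?thesis using capM unfolding mult.assoc by linarith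
  qed
  have dk: "real d * (real k)\<^sup>2 \<le> real Z"
  proof -
    have "real d * (real k)\<^sup>2 \<le> x ^ \<kappa> * (ck * x)\<^sup>2" using dx kx x2 by (intro mult_mono power_mono) auto
    also have "\<dots> = ck\<^sup>2 * x ^ (2 + \<kappa>)" by (simp add: power_add power_mult_distrib power2_eq_square mult_ac)
    also have "\<dots> \<le> real Z" using Kge by (intro poly) (auto simp: P)
    finally show ?thesis .
  qed
  have cBZ: "Z \<le> cB * B2"
  proof -
    have "real Z = (1 / b2) * (b2 * real Z)" using b by simp
    also have "\<dots> \<le> real cB * real B2" using cB B2(1) b by (intro mult_mono) auto
    finally show ?thesis by (metis of_nat_le_iff of_nat_mult)
  qed
  have C1: "42 + 64 * ck\<^sup>2 + 5 * CC \<le> C" "CC * (800 * (real cB + 1) + 2600) + 200 \<le> C"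
    using CC1 unfolding C by (auto intro!: add_nonneg_nonneg mult_nonneg_nonneg)
  have xy: "x powr (1 + \<rho>) * lg = x * y" using x2 by (simp add: y_def powr_add)
  have "lay.SB + N = size"
    by (simp add: lay.SB_def lay.EN_def lay.HD_def lay.QB_def lay.Mb_def size_def mult_ac)
  have cells: "lay.SB + N \<le> nat \<lfloor>C * (x powr (1 + \<rho>) * lg + real \<Sigma>)\<rfloor>"
  proof -
    define u where "u = x * y"
    have xu: "x \<le> u" "y \<le> u" using y1 x2 mult_left_mono[of 1 y x] mult_right_mono[of 1 x y] by (auto simp: u_def)
    have u1: "1 \<le> u" using xu x2 by linarith
    have "lg * 1 \<le> lg * x powr \<rho>" using xr lg by (intro mult_left_mono) auto
    then have ly: "lg \<le> y" by (simp add: y_def mult.commute)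
    then have "lg\<^sup>2 \<le> u" unfolding power2_eq_square u_def using lg by (intro mult_mono) auto
    then have "32 * ck\<^sup>2 * lg\<^sup>2 \<le> 32 * ck\<^sup>2 * u" by (intro mult_left_mono) auto
    then have 1: "real (L * Suc k) \<le> 32 * ck\<^sup>2 * u" using LS by linarith
    have 2: "real cap \<le> CC * u" using cap_le mult_left_mono[OF xu(2) CC1] by linarith
    have "x * real cap \<le> x * (CC * y)" using cap_le x2 by (intro mult_left_mono) auto
    then have 3: "x * real cap \<le> CC * u" by (simp add: u_def mult_ac)
    have "real size \<le> 36 * u + 2 * (32 * ck\<^sup>2 * u) + 2 * (CC * u) + 3 * (CC * u) + (4 * u + u + real \<Sigma>)"
      unfolding size using 1 2 3 xu u1 by linarith
    also have "\<dots> = (41 + 64 * ck\<^sup>2 + 5 * CC) * u + real \<Sigma>" by (simp add: algebra_simps)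
    also have "\<dots> \<le> C * u + C * real \<Sigma>"
    proof (intro add_mono)
      show "(41 + 64 * ck\<^sup>2 + 5 * CC) * u \<le> C * u" using C1(1) u1 by (intro mult_right_mono) auto
      have "1 \<le> C" using C1(1) CC1 zero_le_power2[of ck] by linarith
      then have "1 * real \<Sigma> \<le> C * real \<Sigma>" by (intro mult_right_mono) auto
      then show "real \<Sigma> \<le> C * real \<Sigma>" by simp
    qed
    finally show ?thesis unfolding \<open>lay.SB + N = size\<close> xy by (intro le_nat_floor) (simp add: u_def distrib_left)
  qed
  have qtime: "cap * (40 * (20 * (cB + 1) * l + 61) + 20 * l + 140) + 200 \<le> nat \<lfloor>C * real (max 1 l) * x powr \<rho> * lg\<rfloor>" for l
  proof -
    define m where "m = real (max 1 l)"
    have m: "1 \<le> m" "real l \<le> m" by (auto simp: m_def)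
    have "real (40 * (20 * (cB + 1) * l + 61) + 20 * l + 140) = 800 * (real cB + 1) * real l + 20 * real l + 2580" by simp
    also have "\<dots> \<le> 800 * (real cB + 1) * m + 20 * m + 2580 * m" using m by (intro add_mono mult_left_mono) auto
    also have "\<dots> = (800 * (real cB + 1) + 2600) * m" by (simp add: algebra_simps)
    finally have "real (40 * (20 * (cB + 1) * l + 61) + 20 * l + 140) \<le> (800 * (real cB + 1) + 2600) * m" .
    then have "real cap * real (40 * (20 * (cB + 1) * l + 61) + 20 * l + 140) \<le> (CC * y) * ((800 * (real cB + 1) + 2600) * m)"
      using cap_le CC1 y1 by (intro mult_mono) auto
    moreover have "200 * 1 \<le> 200 * (y * m)" using m y1 mult_mono[of 1 y 1 m] by simp
    ultimately have "real cap * real (40 * (20 * (cB + 1) * l + 61) + 20 * l + 140) + 200 \<le> (CC * (800 * (real cB + 1) + 2600) + 200) * (y * m)"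
      by (simp add: algebra_simps)
    also have "\<dots> \<le> C * (y * m)" using C1(2) y1 m by (intro mult_right_mono) auto
    also have "\<dots> = C * real (max 1 l) * x powr \<rho> * lg" by (simp add: y_def m_def mult_ac)
    finally show ?thesis by (intro le_nat_floor) (simp only: of_nat_add of_nat_mult of_nat_numeral)
  qed
  show ?thesis
    unfolding x_def[symmetric] lg_def[symmetric] \<Sigma>_def[symmetric]
    by (rule lay.instance_solved[OF z(1) ps(1,3) _ N_def B1_def B2_def, unfolded layZ, OF dZ k(3) U L_def cap_def ccp dp M_def gap dk S T cBZ cells qtime])
qed

text \<open>The word length has to make Z = 2 ^ ((w - 1) div 8) exceed the polynomial of
  \<open>solves_if_scale_large\<close>. The programs depend on the parameters only through
  \<open>cc\<close>, which is determined by b1; everything else is computed from the input.\<close>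

theorem theorem4p1:
  fixes b1 b2 \<rho> :: real and \<kappa> :: nat
  assumes "0 < b2" and "b2 < b1" and "b1 < 1"
    and "\<rho> = ln (1 / b1) / ln (1 / b2)"
  shows "\<exists>c0 > 0. \<forall>c1 \<ge> c0. \<exists>build query. \<exists>C > 0.
    \<forall>(n :: nat) (d :: nat) (w :: nat) (ps :: nat set list).
      n \<ge> 2 \<and> c0 * log 2 (real n) \<le> real w \<and> real w \<le> c1 * log 2 (real n) \<and> d \<le> n ^ \<kappa> \<and>
      length ps = n \<and> distinct ps \<and> (\<forall>x \<in> set ps. x \<subseteq> {1..d}) \<longrightarrow>
      solves_similarity_search w d b1 b2 ps build query
        (nat \<lfloor>C * (real n powr (1 + \<rho>) * log 2 (real n) + real (\<Sum>x \<in> set ps. card x))\<rfloor>)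
        (\<lambda>k. nat \<lfloor>C * real (max 1 k) * real n powr \<rho> * log 2 (real n)\<rfloor>)"
proof -
  define \<gamma> where "\<gamma> = (1 + b2) / 2"
  define ck where "ck = 1 + 2 / log 2 (1 / \<gamma>)"
  define A where "A = nat \<lceil>ck * log 2 (2 * (2 / b1)\<^sup>2)\<rceil>"
  define cc where "cc = nat \<lceil>60 / (1 - b1)\<rceil>"
  define cB where "cB = nat \<lceil>1 / b2\<rceil>"
  define CC where "CC = real cc * (16 * ck) * (36 / b1)"
  define P where "P = 3 + A + 2 * \<kappa>"
  define Kc where "Kc = 2 * ck + ck / b2 + ck * (2 / b1 + 1) + ck\<^sup>2 + ck + 2 + 40 * CC + (42 + 64 * ck\<^sup>2 + 5 * CC) +
      2 / (1 - b2) + 2 / b1 + 2 / (b1 - b2)"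
  define C where "C = (42 + 64 * ck\<^sup>2 + 5 * CC) + (CC * (800 * (real cB + 1) + 2600) + 200)"
  have gam: "0 < \<gamma>" "\<gamma> < 1" using assms by (auto simp: \<gamma>_def)
  have ck1: "1 \<le> ck" using gam by (simp add: ck_def)
  have CC0: "0 \<le> CC" using ck1 assms by (simp add: CC_def)
  have C0: "0 < C" using CC0 by (auto simp: C_def intro!: add_pos_nonneg)
  \<comment> \<open>As \<open>n \<ge> 2\<close>, the coefficient \<open>Kc\<close> is at most n to
    the power of its ceiling, so it can be moved into the exponent.\<close>
  define a where "a = P + nat \<lceil>Kc\<rceil>"
  \<comment> \<open>The 8 is there because z is about w / 8; the additional power of n pays for the
    rounding of z, which may lose a factor 2.\<close>
  define c0 where "c0 = 8 * (real a + 1)"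
  have "solves_similarity_search w d b1 b2 ps (build_prog cc) query_prog
        (nat \<lfloor>C * (real n powr (1 + \<rho>) * log 2 (real n) + real (\<Sum>x \<in> set ps. card x))\<rfloor>)
        (\<lambda>k. nat \<lfloor>C * real (max 1 k) * real n powr \<rho> * log 2 (real n)\<rfloor>)"
    if n: "2 \<le> n" and w: "c0 * log 2 (real n) \<le> real w" and d: "d \<le> n ^ \<kappa>"
      and ps: "length ps = n" "distinct ps" "\<forall>x \<in> set ps. x \<subseteq> {1..d}" for n d w :: nat and ps :: "nat set list"
  proof -
    define z where "z = (w - 1) div 8"
    have z8: "8 * z \<le> w" "w \<le> 8 * z + 8" unfolding z_def by presburger+
    have "c0 * log 2 (real n) \<le> 8 * real z + 8" using w z8(2) by linarith
    then have "(real a + 1) * log 2 (real n) \<le> real z + 1"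
      unfolding c0_def mult.assoc by linarith
    then have "log 2 (real n ^ (a + 1)) \<le> real (z + 1)" 
      using n by (subst log_nat_power) (auto simp: algebra_simps)
    then have "real n ^ (a + 1) \<le> 2 powr real (z + 1)" using n by (subst (asm) log_le_iff) auto
    also have "\<dots> = 2 ^ z * 2" by (subst powr_realpow) auto
    finally have "real n ^ a * real n \<le> 2 ^ z * 2" by (simp add: mult.commute)
    moreover have "real n ^ a * 2 \<le> real n ^ a * real n" using n by (intro mult_left_mono) auto
    ultimately have na: "real n ^ a \<le> 2 ^ z" by linarith
    have "Kc \<le> real (nat \<lceil>Kc\<rceil>)" by linarith
    also have "\<dots> \<le> 2 ^ nat \<lceil>Kc\<rceil>" using less_exp[of "nat \<lceil>Kc\<rceil>"] by (metis less_imp_le of_nat_le_iff of_nat_numeral of_nat_power)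
    also have "\<dots> \<le> real n ^ nat \<lceil>Kc\<rceil>" using n by (intro power_mono) auto
    finally have "Kc * real n ^ P \<le> real n ^ nat \<lceil>Kc\<rceil> * real n ^ P" by (intro mult_right_mono) auto
    also have "\<dots> = real n ^ a" by (simp add: a_def power_add)
    finally have large: "Kc * real n ^ P \<le> 2 ^ z" using na by linarith
    have A: "ck * log 2 (2 * (2 / b1)\<^sup>2) \<le> real A" and cc: "60 / (1 - b1) \<le> real cc" and cB: "1 / b2 \<le> real cB"
      unfolding A_def cc_def cB_def by linarith+
    show ?thesis
      by (rule solves_if_scale_large[OF assms \<gamma>_def ck_def A cc cB CC_def P_def Kc_def C_def n d ps z_def z8(1) large])
  qed
  moreover have "0 < c0" by (simp add: c0_def)
  ultimately show ?thesis using C0 by blast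
qed

end
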